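(* Let $s\in[\frac12,1)$, $0<\lambda\le\Lambda$, $\beta\ge0$, and let $\Omega\subset\mathbb{R}^n$ be a Lipschitz domain with $0\in\partial\Omega$. Then there is $\delta>0$, depending only on $n,s,\Omega,\lambda,\Lambda,\beta$, such that the following holds. Let $u_1,u_2\in C(B_1)$ satisfy, in the viscosity sense, \[\widetilde M^+(au_1+bu_2)\ge-\delta(|a|+|b|)\ \text{ in } B_1\cap\Omega\quad\text{for all } a,b\in\mathbb{R},\qquad u_1=u_2=0\ \text{ in } B_1\setminus\Omega,\] and $u_i\ge0$ in $\mathbb{R}^n$, $\int_{\mathbb{R}^n}\frac{u_i(x)}{1+|x|^{n+2s}}\,dx=1$ for $i=1,2$. Then there are $\alpha\in(0,1)$ and $C$, depending only on $n,s,\Omega,\lambda,\Lambda,\beta$, such that \[\left\|\frac{u_1}{u_2}\right\|_{C^{0,\alpha}(\overline\Omega\cap B_{1/2})}\le C.\]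
   Context: $B_r(x)$ denotes the open ball of radius $r$ centered at $x$, and $B_r=B_r(0)$. $\mathcal L(\lambda,\Lambda,\beta)$ is the class of all linear operators $\tilde Lu(x)=\int_{\mathbb{R}^n}\bigl(u(x+y)-u(x)-\nabla u(x)\cdot y\,\chi_{B_1}(y)\bigr)K(y)\,dy+b\cdot\nabla u(x)$, where $b\in\mathbb{R}^n$ and the (not necessarily symmetric) kernel $K$ satisfies $\frac{\lambda}{|y|^{n+2s}}\le K(y)\le\frac{\Lambda}{|y|^{n+2s}}$ for all $y$, and $|b|+\left|r^{2s-1}\int_{B_1\setminus B_r}y\,K(y)\,dy\right|\le\beta$ for all $r\in(0,1)$. The extremal operators are $\widetilde M^+u=\sup_{\tilde L\in\mathcal L(\lambda,\Lambda,\beta)}\tilde Lu$ and $\widetilde M^-u=\inf_{\tilde L\in\mathcal L(\lambda,\Lambda,\beta)}\tilde Lu$; inequalities are in the viscosity sense. *)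

theory Defs
  imports "HOL-Analysis.Analysis"
begin

definition grad :: "('a::euclidean_space \<Rightarrow> real) \<Rightarrow> 'a \<Rightarrow> 'a" where
  "grad u x = (THE p. GDERIV u x :> p)"

definition Lop :: "('a::euclidean_space \<Rightarrow> real) \<Rightarrow> 'a \<Rightarrow> ('a \<Rightarrow> real) \<Rightarrow> 'a \<Rightarrow> real" where
  "Lop K b u x =
     (\<integral>y. (u (x + y) - u x - (grad u x \<bullet> y) * indicator (ball 0 1) y) * K y \<partial>lborel)
     + b \<bullet> grad u x"

definition Lclass :: "real \<Rightarrow> real \<Rightarrow> real \<Rightarrow> real \<Rightarrow> (('a::euclidean_space \<Rightarrow> real) \<times> 'a) set" where
  "Lclass lam Lam beta s = {(K, b).
     K \<in> borel_measurable lborel \<and>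
     (\<forall>y. y \<noteq> 0 \<longrightarrow> lam / norm y powr (real DIM('a) + 2 * s) \<le> K y
                  \<and> K y \<le> Lam / norm y powr (real DIM('a) + 2 * s)) \<and>
     (\<forall>r. 0 < r \<and> r < 1 \<longrightarrow>
        norm b + norm (r powr (2 * s - 1) *\<^sub>R (LINT y:(ball 0 1 - ball 0 r)|lborel. K y *\<^sub>R y)) \<le> beta)}"

definition Mplus :: "real \<Rightarrow> real \<Rightarrow> real \<Rightarrow> real \<Rightarrow> ('a::euclidean_space \<Rightarrow> real) \<Rightarrow> 'a \<Rightarrow> ereal" where
  "Mplus lam Lam beta s u x = (SUP KB \<in> Lclass lam Lam beta s. ereal (Lop (fst KB) (snd KB) u x))"

definition C2_on :: "'a::euclidean_space set \<Rightarrow> ('a \<Rightarrow> real) \<Rightarrow> bool" where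
  "C2_on U \<phi> \<longleftrightarrow> (\<exists>g H. (\<forall>y\<in>U. GDERIV \<phi> y :> g y \<and> (g has_derivative H y) (at y)) \<and>
                     (\<forall>i\<in>Basis. \<forall>j\<in>Basis. continuous_on U (\<lambda>y. H y i \<bullet> j)))"

text \<open>Viscosity inequality  M^+ w >= f  in D (Caffarelli--Silvestre): whenever a C^2 function
  phi touches w from above at x in a neighbourhood N of x in D, the function equal to phi in N
  and to w outside N satisfies M^+ v(x) >= f(x).\<close>
definition visc_Mplus_ge ::
  "real \<Rightarrow> real \<Rightarrow> real \<Rightarrow> real \<Rightarrow> ('a::euclidean_space \<Rightarrow> real) \<Rightarrow> ('a \<Rightarrow> real) \<Rightarrow> 'a set \<Rightarrow> bool" where
  "visc_Mplus_ge lam Lam beta s w f D \<longleftrightarrow>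
     (\<forall>x\<in>D. \<forall>N \<phi>. open N \<and> x \<in> N \<and> N \<subseteq> D \<and>
        (\<exists>U. open U \<and> closure N \<subseteq> U \<and> C2_on U \<phi>) \<and>
        \<phi> x = w x \<and> (\<forall>y\<in>N - {x}. \<phi> y > w y)
        \<longrightarrow> Mplus lam Lam beta s (\<lambda>y. if y \<in> N then \<phi> y else w y) x \<ge> ereal (f x))"

definition lipschitz_domain :: "'a::euclidean_space set \<Rightarrow> bool" where
  "lipschitz_domain \<Omega> \<longleftrightarrow> open \<Omega> \<and> connected \<Omega> \<and> \<Omega> \<noteq> {} \<and>
     (\<forall>x0\<in>frontier \<Omega>. \<exists>e r \<Gamma> L. norm e = 1 \<and> 0 < r \<and>
        L-lipschitz_on {z. z \<bullet> e = 0} \<Gamma> \<and>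
        \<Omega> \<inter> ball x0 r = {x \<in> ball x0 r. \<Gamma> (x - (x \<bullet> e) *\<^sub>R e) < x \<bullet> e})"

definition holder_norm :: "real \<Rightarrow> 'a::metric_space set \<Rightarrow> ('a \<Rightarrow> real) \<Rightarrow> ereal" where
  "holder_norm \<alpha> A f = (SUP x\<in>A. ereal \<bar>f x\<bar>)
     + (SUP xy\<in>{(x, y). x \<in> A \<and> y \<in> A \<and> x \<noteq> y}.
          ereal (\<bar>f (fst xy) - f (snd xy)\<bar> / dist (fst xy) (snd xy) powr \<alpha>))"

end

theory Submission
  imports Defs
begin

text \<open>
  Nonlocality replaces barriers and measure estimates: at a point where a function is touched by a
  paraboloid of radius comparable to the scale $r$, the operator sees the whole mass of the function.
  With $T_r(u) = \int u(y)\,(r + |y - c|)^{-n-2s}\,dy$ this yields, at every scale and in every open set,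
  $u \le C r^{2s} T_r(u)$ in $B_{r/2}(c)$, $u \ge c_0 r^{2s} T_r(u)$ in balls inside $\Omega$, and $u_1 \le C u_2$
  for two normalised solutions. As $\Omega$ contains a ball of size comparable to $r$ near $c$, the lower bound shows
  that $T_{r/8}(u_2) \ge G\, T_r(u_2)$ with $G > 1$. This growth makes the right-hand side $\delta$ and the
  nonlocal tails of $u_1 - m u_2$ harmless in an iteration which traps $u_1 / u_2$ in intervals of
  length $C_0 q^j$ on $B_{R 8^{-j-1}}(c)$. The centre $c$ may be any point of $\Omega \cap B_{1/2}$,
  interior or near the boundary, so that no separate interior regularity theory is needed.
\<close>

subsection \<open>Radial weights\<close>

text \<open>The obstacle is that \<delta> is a fixed number while the oscillation shrinks like q^j,
  so a fixed error would dominate after finitely many steps. It does not, because every error is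
  measured against (M - m) T_j: the interval length has the factor q^j, T_j grows at least like G^j,
  and q G >= 1. The scale against which \<delta> itself is chosen is a lower bound for T_r that the
  normalisation gives uniformly in the centre and the radius. The constants are fixed in an order
  that avoids circularity: the sup bound, the mass fraction and G, then the gain and the admissible
  tail size, then q, then the initial length C0, and \<delta> last. The set \<Omega> enters them
  only through the radius and the ratio of its interior balls. Since the hypothesis covers all
  linear combinations, viscosity inequalities never have to be subtracted from each other. Only M^+
  and touching from above occur; M^- is present as -M^+(-u). The exponent k = n + 2s is that of the
  kernels, so r^(2s) T_r(u) scales like a value of u.\<close>

definition weight :: "real \<Rightarrow> real \<Rightarrow> 'a::euclidean_space \<Rightarrow> 'a \<Rightarrow> real" where
  "weight k r c y = (r + dist y c) powr (- k)"

declare borel_open[OF open_ball, measurable] borel_closed[OF closed_cball, measurable]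

lemma weight_nonneg [simp]: "0 \<le> weight k r c y"
  by (simp add: weight_def)

lemma weight_measurable [measurable]: "weight k r c \<in> borel_measurable borel"
  unfolding weight_def by measurable

lemma weight_le:
  assumes le: "r' + dist y c' \<le> M * (r + dist y c)"
    and "0 < r + dist y c" "0 < r' + dist y c'" "0 \<le> k"
  shows "weight k r c y \<le> M powr k * weight k r' c' y"
proof -
  define a b where "a = r + dist y c" and "b = r' + dist y c'"
  have ab: "0 < a" "0 < b" "b \<le> M * a" using assms by (auto simp: a_def b_def)
  have M: "0 < M" using ab by (smt (verit) mult_nonneg_nonneg mult_pos_pos zero_less_mult_iff)
  have "b powr k \<le> (M * a) powr k" using ab assms(4) by (intro powr_mono2) auto
  also have "\<dots> = M powr k * a powr k" using M ab by (simp add: powr_mult)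
  finally have "b powr k \<le> M powr k * a powr k" .
  then have "a powr - k \<le> M powr k * b powr - k"
    using ab by (simp add: powr_minus_divide field_simps)
  then show ?thesis by (simp add: weight_def a_def b_def)
qed

lemma weight_antimono:
  assumes "0 < r" "r \<le> r'" "0 \<le> k"
  shows "weight k r' c y \<le> weight k r c y"
proof -
  have "0 < r + dist y c" using assms by (smt (verit) zero_le_dist)
  then show ?thesis using assms unfolding weight_def by (intro powr_mono2') auto
qed

section \<open>Integrals of powers of the norm over balls and their complements\<close>

lemma ex_power_bracket:
  fixes q t :: real
  assumes "0 < q" "q < 1" "0 < t" "t \<le> 1"
  shows "\<exists>j. q ^ Suc j < t \<and> t \<le> q ^ j"
proof -
  obtain n where n: "q ^ n < t" using real_arch_pow_inv assms by blast
  define j where "j = (LEAST n. q ^ n < t)"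
  have j: "q ^ j < t" unfolding j_def by (rule LeastI[of _ n]) (rule n)
  have "j \<noteq> 0" using j assms by (intro notI) simp
  then obtain i where i: "j = Suc i" by (cases j) auto
  have "\<not> q ^ i < t" using not_less_Least[of i "\<lambda>n. q ^ n < t"] i j_def by auto
  with j i show ?thesis by (auto simp: not_less)
qed

text \<open>Dyadic decomposition with full balls in place of shells: the overlap costs only a
  constant, and as only an upper bound is wanted, neither \<open>f\<close> nor \<open>A\<close> has
  to be measurable. The origin lies in no shell and is discarded as a null set.\<close>

lemma nn_integral_power_le_geometric:
  fixes A :: "'a::euclidean_space set"
  assumes f: "\<And>y. y \<noteq> 0 \<Longrightarrow> y \<in> A \<Longrightarrow> \<exists>j. y \<in> cball 0 (R j) \<and> f y \<le> h j"
    and R: "\<And>j. 0 \<le> R j" and h: "\<And>j. 0 \<le> h j"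
    and x: "0 < x" "x < 1" and "0 \<le> a"
    and eq: "\<And>j. h j * R j ^ DIM('a) \<le> a * x ^ j"
  shows "(\<integral>\<^sup>+y. ennreal (f y) * indicator A y \<partial>lborel)
           \<le> ennreal (unit_ball_vol DIM('a) * a / (1 - x))"
proof -
  have "(\<integral>\<^sup>+y. ennreal (f y) * indicator A y \<partial>lborel)
      \<le> (\<integral>\<^sup>+y. (\<Sum>j. ennreal (h j) * indicator (cball 0 (R j)) y) \<partial>(lborel :: 'a measure))"
  proof (rule nn_integral_mono_AE)
    have ae: "AE y in lborel. y \<noteq> (0::'a)" by (rule AE_lborel_singleton)
    show "AE y in lborel. ennreal (f y) * indicator A y
        \<le> (\<Sum>j. ennreal (h j) * indicator (cball 0 (R j)) y)"
      using ae
    proof eventually_elim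
      fix y :: 'a assume y: "y \<noteq> 0"
      show "ennreal (f y) * indicator A y \<le> (\<Sum>j. ennreal (h j) * indicator (cball 0 (R j)) y)"
      proof (cases "y \<in> A")
        case True
        then obtain j where j: "y \<in> cball 0 (R j)" "f y \<le> h j" using f y by blast
        have "ennreal (f y) * indicator A y \<le> (\<Sum>j\<in>{j}. ennreal (h j) * indicator (cball 0 (R j)) y)"
          using j True by (simp add: ennreal_leI)
        also have "\<dots> \<le> (\<Sum>j. ennreal (h j) * indicator (cball 0 (R j)) y)"
          by (rule sum_le_suminf) auto
        finally show ?thesis .
      qed auto
    qed
  qed
  also have "\<dots> = (\<Sum>j. \<integral>\<^sup>+y. ennreal (h j) * indicator (cball 0 (R j)) y \<partial>(lborel :: 'a measure))"
    by (rule nn_integral_suminf) (intro borel_measurable_times_ennreal borel_measurable_const borel_measurable_indicator, simp)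
  also have "\<dots> = (\<Sum>j. ennreal (h j) * ennreal (unit_ball_vol DIM('a) * R j ^ DIM('a)))"
    using R by (simp add: nn_integral_cmult_indicator emeasure_cball)
  also have "\<dots> \<le> (\<Sum>j. ennreal (unit_ball_vol DIM('a) * a * x ^ j))"
  proof (rule suminf_le)
    fix j
    have "h j * (unit_ball_vol DIM('a) * R j ^ DIM('a)) \<le> unit_ball_vol DIM('a) * a * x ^ j"
      using mult_left_mono[OF eq[of j], of "unit_ball_vol DIM('a)"] by (simp add: mult_ac)
    then show "ennreal (h j) * ennreal (unit_ball_vol DIM('a) * R j ^ DIM('a))
      \<le> ennreal (unit_ball_vol DIM('a) * a * x ^ j)"
      using h by (simp flip: ennreal_mult' add: ennreal_leI)
  qed auto
  also have "\<dots> = ennreal (unit_ball_vol DIM('a) * a * (1 / (1 - x)))"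
  proof (rule suminf_ennreal_eq)
    show "(\<lambda>j. unit_ball_vol (real DIM('a)) * a * x ^ j) sums (unit_ball_vol (real DIM('a)) * a * (1 / (1 - x)))"
      by (intro sums_mult geometric_sums) (use x in auto)
  qed (use x \<open>0 \<le> a\<close> in auto)
  finally show ?thesis by simp
qed

text \<open>On the shell between \<rho> 2^(-j-1) and \<rho> 2^(-j) the integrand is at most its
  value at the inner radius; the resulting series has ratio 2^(a - n), hence the condition a <
  n.\<close>

lemma nn_integral_powr_ball:
  fixes a \<rho> :: real
  assumes a: "0 \<le> a" "a < DIM('a::euclidean_space)" and "0 < \<rho>"
  shows "(\<integral>\<^sup>+y. ennreal (norm y powr (- a)) * indicator (ball 0 \<rho> :: 'a set) y \<partial>lborel)
    \<le> ennreal (unit_ball_vol DIM('a) * (2 powr a * \<rho> powr (DIM('a) - a)) / (1 - 2 powr (a - DIM('a))))"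
proof (rule nn_integral_power_le_geometric[where R = "\<lambda>j. \<rho> * (1/2) ^ j" and h = "\<lambda>j. (\<rho> * (1/2) ^ Suc j) powr (- a)"])
  fix y :: 'a assume y: "y \<noteq> 0" "y \<in> ball 0 \<rho>"
  then obtain j where j: "(1/2) ^ Suc j < norm y / \<rho>" "norm y / \<rho> \<le> (1/2) ^ j"
    using ex_power_bracket[of "1/2" "norm y / \<rho>"] assms by auto
  have "\<rho> * (1/2) ^ Suc j < norm y" "norm y \<le> \<rho> * (1/2) ^ j"
    using j \<open>0 < \<rho>\<close> by (simp_all add: field_simps)
  then show "\<exists>j. y \<in> cball 0 (\<rho> * (1/2) ^ j) \<and> norm y powr - a \<le> (\<rho> * (1/2) ^ Suc j) powr - a"
    using a \<open>0 < \<rho>\<close> by (intro exI[of _ j] conjI powr_mono2') auto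
next
  fix j
  have h: "(1/2::real) ^ i = 2 powr (- real i)" for i
    by (simp add: powr_minus powr_realpow power_one_over inverse_eq_divide)
  have "(\<rho> * (1/2) ^ Suc j) powr - a * (\<rho> * (1/2) ^ j) ^ DIM('a)
     = (\<rho> * 2 powr (- real (Suc j))) powr - a * (\<rho> * 2 powr (- real j)) powr DIM('a)"
    using \<open>0 < \<rho>\<close> unfolding h by (simp add: powr_realpow)
  also have "\<dots> = (2 powr a * \<rho> powr (DIM('a) - a)) * 2 powr ((a - DIM('a)) * real j)"
    using \<open>0 < \<rho>\<close> by (simp add: powr_def ln_mult algebra_simps flip: exp_add)
  also have "2 powr ((a - DIM('a)) * real j) = (2 powr (a - DIM('a))) ^ j"
    by (simp add: powr_powr flip: powr_realpow)
  finally show "(\<rho> * (1/2) ^ Suc j) powr - a * (\<rho> * (1/2) ^ j) ^ DIM('a)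
     \<le> (2 powr a * \<rho> powr (DIM('a) - a)) * (2 powr (a - DIM('a))) ^ j" by simp
qed (use assms in \<open>auto simp: powr_less_one\<close>)

text \<open>The same argument with shells growing outwards; now the ratio is 2^(n - a).\<close>

lemma nn_integral_powr_compl_ball:
  fixes a \<rho> :: real
  assumes a: "DIM('a::euclidean_space) < a" and "0 < \<rho>"
  shows "(\<integral>\<^sup>+y. ennreal (norm y powr (- a)) * indicator (- ball 0 \<rho> :: 'a set) y \<partial>lborel)
    \<le> ennreal (unit_ball_vol DIM('a) * (2 ^ DIM('a) * \<rho> powr (DIM('a) - a)) / (1 - 2 powr (DIM('a) - a)))"
proof (rule nn_integral_power_le_geometric[where R = "\<lambda>j. \<rho> * 2 ^ Suc j" and h = "\<lambda>j. (\<rho> * 2 ^ j) powr (- a)"])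
  fix y :: 'a assume y: "y \<noteq> 0" "y \<in> - ball 0 \<rho>"
  then obtain j where j: "(1/2) ^ Suc j < \<rho> / norm y" "\<rho> / norm y \<le> (1/2) ^ j"
    using ex_power_bracket[of "1/2" "\<rho> / norm y"] assms by auto
  have "norm y \<le> \<rho> * 2 ^ Suc j" "\<rho> * 2 ^ j \<le> norm y"
    using j y \<open>0 < \<rho>\<close> by (simp_all add: field_simps)
  then show "\<exists>j. y \<in> cball 0 (\<rho> * 2 ^ Suc j) \<and> norm y powr - a \<le> (\<rho> * 2 ^ j) powr - a"
    using a \<open>0 < \<rho>\<close> by (intro exI[of _ j] conjI powr_mono2') auto
next
  fix j
  have "(\<rho> * 2 ^ j) powr - a * (\<rho> * 2 ^ Suc j) ^ DIM('a)
     = (\<rho> * 2 powr real j) powr - a * (\<rho> * 2 powr (real (Suc j))) powr DIM('a)"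
    using \<open>0 < \<rho>\<close> by (simp add: powr_realpow del: of_nat_Suc power_Suc)
  also have "\<dots> = (2 powr DIM('a) * \<rho> powr (DIM('a) - a)) * 2 powr ((DIM('a) - a) * real j)"
    using \<open>0 < \<rho>\<close> by (simp add: powr_def ln_mult algebra_simps flip: exp_add)
  also have "2 powr ((DIM('a) - a) * real j) = (2 powr (DIM('a) - a)) ^ j"
    by (simp add: powr_powr flip: powr_realpow)
  finally show "(\<rho> * 2 ^ j) powr - a * (\<rho> * 2 ^ Suc j) ^ DIM('a)
     \<le> (2 ^ DIM('a) * \<rho> powr (DIM('a) - a)) * (2 powr (DIM('a) - a)) ^ j" by (simp add: powr_realpow)
qed (use assms in \<open>auto simp: powr_less_one\<close>)

lemma integrable_and_integral_le:
  fixes f :: "'a \<Rightarrow> real"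
  assumes "f \<in> borel_measurable M" "\<And>x. 0 \<le> f x" "(\<integral>\<^sup>+x. ennreal (f x) \<partial>M) \<le> ennreal B" "0 \<le> B"
  shows "integrable M f \<and> integral\<^sup>L M f \<le> B"
proof
  show "integrable M f"
    by (rule integrableI_nonneg)
      (use assms in \<open>auto intro!: le_less_trans[OF assms(3)] ennreal_less_top\<close>)
  show "integral\<^sup>L M f \<le> B" by (rule integral_real_bounded) (use assms in auto)
qed

text \<open>Second moment of the kernel near the origin, finite because s < 1. This is what a
  paraboloid of opening one costs on a ball of radius \<rho>.\<close>

lemma ball_powr_integral:
  assumes s: "1/2 \<le> s" "s < 1" and k: "k = real DIM('a::euclidean_space) + 2 * s"
  shows "\<exists>C>0. \<forall>\<rho>>0. integrable lborel (\<lambda>y::'a. norm y powr (2 - k) * indicator (ball 0 \<rho>) y) \<and>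
     (\<integral>y. norm y powr (2 - k) * indicator (ball 0 \<rho> :: 'a set) y \<partial>lborel) \<le> C * \<rho> powr (2 - 2 * s)"
proof -
  define C where "C = unit_ball_vol DIM('a) * 2 powr (k - 2) / (1 - 2 powr ((k - 2) - DIM('a)))"
  have n: "1 \<le> real DIM('a)" using DIM_positive[where 'a='a] by linarith
  have k2: "0 \<le> k - 2" "k - 2 < DIM('a)" using n s k by linarith+
  have e: "2 powr ((k - 2) - DIM('a)) < 1" by (rule powr_less_one) (use s k in auto)
  have C: "0 < C" unfolding C_def using e by (intro divide_pos_pos mult_pos_pos) auto
  have "integrable lborel (\<lambda>y::'a. norm y powr (2 - k) * indicator (ball 0 \<rho>) y) \<and>
     (\<integral>y. norm y powr (2 - k) * indicator (ball 0 \<rho> :: 'a set) y \<partial>lborel) \<le> C * \<rho> powr (2 - 2 * s)"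
    if "0 < \<rho>" for \<rho>
  proof (rule integrable_and_integral_le)
    have "(\<integral>\<^sup>+y. ennreal (norm y powr (2 - k) * indicator (ball 0 \<rho> :: 'a set) y) \<partial>lborel)
      = (\<integral>\<^sup>+y. ennreal (norm y powr (- (k - 2))) * indicator (ball 0 \<rho> :: 'a set) y \<partial>lborel)"
      by (intro nn_integral_cong) (auto simp: indicator_def)
    also have "\<dots> \<le> ennreal (unit_ball_vol DIM('a) * (2 powr (k - 2) * \<rho> powr (DIM('a) - (k - 2))) / (1 - 2 powr ((k - 2) - DIM('a))))"
      by (rule nn_integral_powr_ball) (use k2 that in auto)
    also have "\<dots> = ennreal (C * \<rho> powr (2 - 2 * s))"
      by (simp add: C_def k algebra_simps)
    finally show "(\<integral>\<^sup>+y. ennreal (norm y powr (2 - k) * indicator (ball 0 \<rho> :: 'a set) y) \<partial>lborel)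
      \<le> ennreal (C * \<rho> powr (2 - 2 * s))" .
  qed (use C in auto)
  with C show ?thesis by blast
qed

text \<open>Mass of the kernel away from the origin; it makes constants and bounded gradients
  integrable against the kernel there.\<close>

lemma compl_ball_powr_integral:
  assumes s: "1/2 \<le> s" and k: "k = real DIM('a::euclidean_space) + 2 * s"
  shows "\<exists>C>0. \<forall>\<rho>>0. integrable lborel (\<lambda>y::'a. norm y powr (- k) * indicator (- ball 0 \<rho>) y) \<and>
     (\<integral>y. norm y powr (- k) * indicator (- ball 0 \<rho> :: 'a set) y \<partial>lborel) \<le> C * \<rho> powr (- 2 * s)"
proof -
  define C where "C = unit_ball_vol DIM('a) * 2 ^ DIM('a) / (1 - 2 powr (DIM('a) - k))"
  have e: "2 powr (DIM('a) - k) < 1" by (rule powr_less_one) (use s k in auto)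
  have C: "0 < C" unfolding C_def using e by (intro divide_pos_pos mult_pos_pos) auto
  have "integrable lborel (\<lambda>y::'a. norm y powr (- k) * indicator (- ball 0 \<rho>) y) \<and>
     (\<integral>y. norm y powr (- k) * indicator (- ball 0 \<rho> :: 'a set) y \<partial>lborel) \<le> C * \<rho> powr (- 2 * s)"
    if "0 < \<rho>" for \<rho>
  proof (rule integrable_and_integral_le)
    have "(\<integral>\<^sup>+y. ennreal (norm y powr (- k) * indicator (- ball 0 \<rho> :: 'a set) y) \<partial>lborel)
      = (\<integral>\<^sup>+y. ennreal (norm y powr (- k)) * indicator (- ball 0 \<rho> :: 'a set) y \<partial>lborel)"
      by (intro nn_integral_cong) (auto simp: indicator_def)
    also have "\<dots> \<le> ennreal (unit_ball_vol DIM('a) * (2 ^ DIM('a) * \<rho> powr (DIM('a) - k)) / (1 - 2 powr (DIM('a) - k)))"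
      by (rule nn_integral_powr_compl_ball) (use s k that in auto)
    also have "\<dots> = ennreal (C * \<rho> powr (- 2 * s))"
      by (simp add: C_def k algebra_simps)
    finally show "(\<integral>\<^sup>+y. ennreal (norm y powr (- k) * indicator (- ball 0 \<rho> :: 'a set) y) \<partial>lborel)
      \<le> ennreal (C * \<rho> powr (- 2 * s))" .
  qed (use C in auto)
  with C show ?thesis by blast
qed

lemma lborel_translate:
  fixes f :: "'a::euclidean_space \<Rightarrow> 'b::{banach, second_countable_topology}"
  assumes "f \<in> borel_measurable borel"
  shows "integrable lborel (\<lambda>y. f (x + y)) \<longleftrightarrow> integrable lborel f"
    and "(\<integral>y. f (x + y) \<partial>lborel) = (\<integral>y. f y \<partial>lborel)"
  using assms integrable_distr_eq[of "(+) x" lborel borel f] integral_distr[of "(+) x" lborel borel f]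
  by (simp_all add: lborel_distr_plus)

subsection \<open>Touching by paraboloids\<close>

lemma GDERIV_unique:
  assumes "GDERIV f x :> d" "GDERIV f x :> e"
  shows "d = e"
proof -
  have "(\<lambda>h. h \<bullet> d) = (\<lambda>h. h \<bullet> e)"
    using assms unfolding gderiv_def by (rule has_derivative_unique)
  then have "(d - e) \<bullet> d = (d - e) \<bullet> e" by metis
  then have "(d - e) \<bullet> (d - e) = 0" by (simp only: inner_diff_right)
  then show ?thesis by simp
qed

lemma grad_eq:
  assumes "GDERIV f x :> d" shows "grad f x = d"
  unfolding grad_def using assms GDERIV_unique by blast

lemma inner_indicator_le:
  fixes p y :: "'a::euclidean_space"
  shows "\<bar>(p \<bullet> y) * indicator (ball 0 1) y\<bar> \<le> norm p"
proof (cases "y \<in> ball 0 1")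
  case True
  have "\<bar>p \<bullet> y\<bar> \<le> norm p * norm y" by (rule Cauchy_Schwarz_ineq2)
  also have "\<dots> \<le> norm p * 1" using True by (intro mult_left_mono) auto
  finally show ?thesis using True by simp
qed auto

text \<open>Radius 0 in the weight gives the pure kernel |y - c|^(-k), with which every K of the
  class is directly comparable; removing a ball avoids its singularity.\<close>

abbreviation outer_tail :: "real \<Rightarrow> 'a::euclidean_space \<Rightarrow> real \<Rightarrow> ('a \<Rightarrow> real) \<Rightarrow> real" where
  "outer_tail k c \<rho> u \<equiv> \<integral>y. u y * weight k 0 c y * indicator (- ball c \<rho>) y \<partial>lborel"

abbreviation outer_integrable :: "real \<Rightarrow> 'a::euclidean_space \<Rightarrow> real \<Rightarrow> ('a \<Rightarrow> real) \<Rightarrow> bool" where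
  "outer_integrable k c \<rho> u \<equiv> integrable lborel (\<lambda>y. u y * weight k 0 c y * indicator (- ball c \<rho>) y)"

text \<open>The compensator p . y on B_1 is split at radius \<rho>. Inside B_\<rho> it cancels the
  linear part of the paraboloid, leaving the second moment; on B_1 - B_\<rho> it combines with the
  drift into (b - integral of y K) . p, which the class condition at r = \<rho> controls. Outside
  B_\<rho> the upper kernel bound is applied to \<open>P\<close> and the lower one to
  \<open>N\<close>. Equality with the paraboloid is required only on the smaller ball of radius
  \<sigma>, where it serves to make the integral converge.\<close>

lemma Lop_touching_le:
  fixes v P N :: "'a::euclidean_space \<Rightarrow> real"
  assumes s: "1/2 \<le> s" "s < 1" and k: "k = real DIM('a) + 2 * s" and lam: "0 < lam"
    and KB: "(K, b) \<in> Lclass lam Lam beta s"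
    and vm [measurable]: "v \<in> borel_measurable borel"
    and vi: "outer_integrable k x0 \<sigma> v"
    and \<sigma>: "0 < \<sigma>" "\<sigma> \<le> \<rho>" and \<rho>: "\<rho> < 1" and Q: "0 \<le> Q" and "grad v x0 = p"
    and near: "\<And>y. dist y x0 < \<sigma> \<Longrightarrow> v y = v x0 + p \<bullet> (y - x0) + Q * (norm (y - x0))\<^sup>2"
    and mid: "\<And>y. dist y x0 < \<rho> \<Longrightarrow> v y \<le> v x0 + p \<bullet> (y - x0) + Q * (norm (y - x0))\<^sup>2"
    and far: "\<And>y. \<rho> \<le> dist y x0 \<Longrightarrow> v y - v x0 \<le> P y - N y"
    and PN: "\<And>y. 0 \<le> P y" "\<And>y. 0 \<le> N y"
    and Pi: "outer_integrable k x0 \<rho> P"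
    and Ni: "outer_integrable k x0 \<rho> N"
  shows "Lop K b v x0 \<le> Q * Lam * (\<integral>y. norm y powr (2 - k) * indicator (ball 0 \<rho> :: 'a set) y \<partial>lborel)
     + beta * \<rho> powr (1 - 2 * s) * norm p
     + Lam * outer_tail k x0 \<rho> P
     - lam * outer_tail k x0 \<rho> N"
proof -
  have \<rho>0: "0 < \<rho>" using \<sigma> by simp
  have Km [measurable]: "K \<in> borel_measurable borel"
    and Kb: "\<And>y. y \<noteq> 0 \<Longrightarrow> lam * norm y powr (- k) \<le> K y \<and> K y \<le> Lam * norm y powr (- k)"
    and Kc: "\<And>r. 0 < r \<Longrightarrow> r < 1 \<Longrightarrow>
        norm b + norm (r powr (2 * s - 1) *\<^sub>R (LINT y:(ball 0 1 - ball 0 r)|lborel. K y *\<^sub>R y)) \<le> beta"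
    using KB by (auto simp: Lclass_def powr_minus_divide k[symmetric])
  have K0: "0 \<le> K y" if "y \<noteq> 0" for y
  proof -
    have "0 \<le> lam * norm y powr (- k)" using lam by simp
    then show ?thesis using Kb[OF that] by linarith
  qed
  have Lam0: "0 \<le> Lam"
  proof -
    obtain i :: 'a where "i \<in> Basis" using nonempty_Basis by blast
    then have "norm i = 1" "i \<noteq> 0" by auto
    then show ?thesis using Kb[of i] lam by simp
  qed
  obtain C1 where C1: "\<And>\<rho>. 0 < \<rho> \<Longrightarrow> integrable lborel (\<lambda>y::'a. norm y powr (2 - k) * indicator (ball 0 \<rho>) y)"
    using ball_powr_integral[OF s k] by blast
  obtain C2 where C2: "\<And>\<rho>. 0 < \<rho> \<Longrightarrow> integrable lborel (\<lambda>y::'a. norm y powr (- k) * indicator (- ball 0 \<rho>) y)"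
    using compl_ball_powr_integral[OF s(1) k] by blast
  have tr: "integrable lborel (\<lambda>y. h (x0 + y) * norm y powr (- k) * indicator (- ball 0 r) y)"
    "(\<integral>y. h (x0 + y) * norm y powr (- k) * indicator (- ball 0 r) y \<partial>lborel)
      = outer_tail k x0 r h"
    if "outer_integrable k x0 r h" for h r
  proof -
    define f where "f = (\<lambda>y. h y * weight k 0 x0 y * indicator (- ball x0 r) y)"
    have f: "integrable lborel f" using that by (simp add: f_def)
    then have fm: "f \<in> borel_measurable borel" by (simp add: borel_measurable_integrable)
    have e: "f (x0 + y) = h (x0 + y) * norm y powr (- k) * indicator (- ball 0 r) y" for y
      by (auto simp: f_def weight_def dist_norm indicator_def)
    show "integrable lborel (\<lambda>y. h (x0 + y) * norm y powr (- k) * indicator (- ball 0 r) y)"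
      using lborel_translate(1)[OF fm, of x0] f by (simp add: e)
    show "(\<integral>y. h (x0 + y) * norm y powr (- k) * indicator (- ball 0 r) y \<partial>lborel)
      = outer_tail k x0 r h"
      using lborel_translate(2)[OF fm, of x0] by (simp add: e) (simp add: f_def)
  qed
  define g where "g y = (v (x0 + y) - v x0 - (p \<bullet> y) * indicator (ball 0 1) y) * K y" for y
  have gm [measurable]: "g \<in> borel_measurable borel" unfolding g_def by measurable
  have pow: "norm y powr (2 - k) = (norm y)\<^sup>2 * norm y powr (- k)" if "y \<noteq> 0" for y :: 'a
    using that by (simp add: powr_diff powr_minus_divide)
  have nearg: "g y = Q * (norm y)\<^sup>2 * K y" if "y \<in> ball 0 \<sigma>" for y
    using near[of "x0 + y"] that \<sigma> \<rho> by (simp add: g_def dist_norm)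
  \<comment> \<open>Integrable majorant of \<open>g\<close>: on B_\<sigma> exact quadratic behaviour
    turns the singularity into |y|^(2 - k), elsewhere the three summands of \<open>g\<close> are
    bounded separately.\<close>
  define B where "B y = Q * Lam * (norm y powr (2 - k) * indicator (ball 0 \<sigma>) y)
      + Lam * \<bar>v (x0 + y) * norm y powr (- k) * indicator (- ball 0 \<sigma>) y\<bar>
      + Lam * (\<bar>v x0\<bar> + norm p) * (norm y powr (- k) * indicator (- ball 0 \<sigma>) y)" for y
  have Bi: "integrable lborel B"
    unfolding B_def
    by (intro Bochner_Integration.integrable_add integrable_mult_right integrable_abs C1 C2 tr(1)[OF vi] \<sigma>)
  have gi: "integrable lborel g"
  proof (rule Bochner_Integration.integrable_bound[OF Bi])
    show "AE y in lborel. norm (g y) \<le> norm (B y)"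
    proof (rule AE_I2)
      fix y :: 'a
      have Bge: "\<bar>g y\<bar> \<le> B y"
      proof (cases "y \<in> ball 0 \<sigma>")
        case True
        show ?thesis
        proof (cases "y = 0")
          case False
          have "\<bar>g y\<bar> = Q * ((norm y)\<^sup>2 * K y)" using nearg[OF True] Q K0[OF False] by simp
          also have "\<dots> \<le> Q * ((norm y)\<^sup>2 * (Lam * norm y powr (- k)))"
            using Q Kb[OF False] by (intro mult_left_mono) auto
          also have "\<dots> = B y" using True False by (simp add: B_def pow)
          finally show ?thesis .
        qed (use nearg[OF True] Q Lam0 \<sigma> in \<open>simp add: B_def\<close>)
      next
        case False
        then have y0: "y \<noteq> 0" using \<sigma> by auto
        have "\<bar>g y\<bar> = \<bar>v (x0 + y) - v x0 - (p \<bullet> y) * indicator (ball 0 1) y\<bar> * K y"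
          using K0[OF y0] by (simp add: g_def abs_mult)
        also have "\<dots> \<le> (\<bar>v (x0 + y)\<bar> + (\<bar>v x0\<bar> + norm p)) * (Lam * norm y powr (- k))"
          using inner_indicator_le[of p y] K0[OF y0] Kb[OF y0] by (intro mult_mono) linarith+
        also have "\<dots> = B y" using False by (simp add: B_def abs_mult algebra_simps)
        finally show ?thesis .
      qed
      then show "norm (g y) \<le> norm (B y)" by simp
    qed
  qed simp
  \<comment> \<open>The first moment of K on B_1 - B_\<rho> stays a vector: only its integral, not
    its norm under the integral sign, obeys the scale-invariant bound.\<close>
  define E where "E y = indicator (ball 0 1 - ball 0 \<rho>) y *\<^sub>R (K y *\<^sub>R y)" for y :: 'a
  have Em [measurable]: "E \<in> borel_measurable borel" unfolding E_def by measurable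
  have Ei: "integrable lborel E"
  proof (rule Bochner_Integration.integrable_bound)
    show "integrable lborel (\<lambda>y::'a. Lam * (norm y powr (- k) * indicator (- ball 0 \<rho>) y))"
      by (intro integrable_mult_right C2 \<rho>0)
    show "AE y in lborel. norm (E y) \<le> norm (Lam * (norm y powr (- k) * indicator (- ball 0 \<rho>) y))"
    proof (rule AE_I2)
      fix y :: 'a
      show "norm (E y) \<le> norm (Lam * (norm y powr (- k) * indicator (- ball 0 \<rho>) y))"
      proof (cases "y \<in> ball 0 1 - ball 0 \<rho>")
        case True
        then have y0: "y \<noteq> 0" using \<rho>0 by auto
        have "norm (E y) = K y * norm y" using True K0[OF y0] by (simp add: E_def)
        also have "\<dots> \<le> (Lam * norm y powr (- k)) * 1"
          using True K0[OF y0] Kb[OF y0] by (intro mult_mono) auto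
        finally show ?thesis using True Lam0 by simp
      qed (simp add: E_def)
    qed
  qed simp
  define U where "U y = Q * Lam * (norm y powr (2 - k) * indicator (ball 0 \<rho>) y)
     + Lam * (P (x0 + y) * norm y powr (- k) * indicator (- ball 0 \<rho>) y)
     - lam * (N (x0 + y) * norm y powr (- k) * indicator (- ball 0 \<rho>) y)" for y
  have Ui: "integrable lborel U"
    unfolding U_def
    by (intro Bochner_Integration.integrable_add Bochner_Integration.integrable_diff integrable_mult_right C1 \<rho>0 tr(1)[OF Pi] tr(1)[OF Ni])
  have pt: "g y \<le> U y - p \<bullet> E y" for y
  proof (cases "y = 0")
    case True
    then show ?thesis using Q Lam0 \<rho>0 \<sigma> nearg[of 0] by (simp add: U_def E_def)
  next
    case y0: False
    show ?thesis
    proof (cases "y \<in> ball 0 \<rho>")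
      case True
      have "v (x0 + y) - v x0 - p \<bullet> y \<le> Q * (norm y)\<^sup>2"
        using mid[of "x0 + y"] True by (simp add: dist_norm)
      then have "g y \<le> Q * (norm y)\<^sup>2 * K y"
        using True \<rho> K0[OF y0] by (auto simp: g_def intro!: mult_right_mono)
      also have "\<dots> \<le> Q * (norm y)\<^sup>2 * (Lam * norm y powr (- k))"
        using Q Kb[OF y0] by (intro mult_left_mono) auto
      also have "\<dots> = U y - p \<bullet> E y" using True y0 by (simp add: U_def E_def pow)
      finally show ?thesis .
    next
      case False
      have "(v (x0 + y) - v x0) * K y \<le> (P (x0 + y) - N (x0 + y)) * K y"
        using far[of "x0 + y"] False K0[OF y0] by (intro mult_right_mono) (auto simp: dist_norm)
      also have "\<dots> = P (x0 + y) * K y - N (x0 + y) * K y" by (simp add: algebra_simps)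
      also have "\<dots> \<le> P (x0 + y) * (Lam * norm y powr (- k)) - N (x0 + y) * (lam * norm y powr (- k))"
        using PN Kb[OF y0] by (intro diff_mono mult_left_mono) auto
      also have "\<dots> = U y" using False by (simp add: U_def)
      finally have "(v (x0 + y) - v x0) * K y \<le> U y" .
      moreover have "g y = (v (x0 + y) - v x0) * K y - p \<bullet> E y"
        using False by (simp add: g_def E_def algebra_simps indicator_def)
      ultimately show ?thesis by linarith
    qed
  qed
  have "(\<integral>y. g y \<partial>lborel) \<le> (\<integral>y. U y - p \<bullet> E y \<partial>lborel)"
    using pt by (intro integral_mono gi Ui Ei Bochner_Integration.integrable_diff integrable_inner_right) auto
  also have "\<dots> = integral\<^sup>L lborel U - p \<bullet> integral\<^sup>L lborel E"
    using Ui Ei by (simp add: Bochner_Integration.integral_diff)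
  finally have g_le: "(\<integral>y. g y \<partial>lborel) \<le> integral\<^sup>L lborel U - p \<bullet> integral\<^sup>L lborel E" .
  have U_eq: "integral\<^sup>L lborel U = Q * Lam * (\<integral>y. norm y powr (2 - k) * indicator (ball 0 \<rho> :: 'a set) y \<partial>lborel)
     + Lam * outer_tail k x0 \<rho> P
     - lam * outer_tail k x0 \<rho> N"
    unfolding U_def tr(2)[OF Pi, symmetric] tr(2)[OF Ni, symmetric]
    using C1[OF \<rho>0] tr(1)[OF Pi] tr(1)[OF Ni] by simp
  have "norm b + \<rho> powr (2 * s - 1) * norm (integral\<^sup>L lborel E) \<le> beta"
    using Kc[OF \<rho>0 \<rho>] by (simp add: E_def[abs_def] set_lebesgue_integral_def)
  then have "\<rho> powr (1 - 2 * s) * (norm b + \<rho> powr (2 * s - 1) * norm (integral\<^sup>L lborel E)) \<le> \<rho> powr (1 - 2 * s) * beta"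
    by (intro mult_left_mono) auto
  moreover have "\<rho> powr (1 - 2 * s) * (\<rho> powr (2 * s - 1) * norm (integral\<^sup>L lborel E)) = norm (integral\<^sup>L lborel E)"
    using \<rho>0 by (simp add: mult.assoc[symmetric] flip: powr_add)
  \<comment> \<open>Here s >= 1/2 matters: \<rho>^(1 - 2s) >= 1 for \<rho> < 1, so the drift is no
    worse than the first moment at small scales.\<close>
  moreover have "norm b \<le> \<rho> powr (1 - 2 * s) * norm b"
  proof -
    have "\<rho> powr 0 \<le> \<rho> powr (1 - 2 * s)" by (rule powr_mono') (use s \<rho>0 \<rho> in auto)
    then show ?thesis using \<rho>0 mult_right_mono[of 1 "\<rho> powr (1 - 2 * s)" "norm b"] by simp
  qed
  ultimately have "norm b + norm (integral\<^sup>L lborel E) \<le> \<rho> powr (1 - 2 * s) * beta"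
    unfolding distrib_left by linarith
  then have "norm (b - integral\<^sup>L lborel E) \<le> \<rho> powr (1 - 2 * s) * beta"
    using norm_triangle_ineq4[of b "integral\<^sup>L lborel E"] by linarith
  then have "norm p * norm (b - integral\<^sup>L lborel E) \<le> norm p * (\<rho> powr (1 - 2 * s) * beta)"
    by (intro mult_left_mono) auto
  moreover have "p \<bullet> (b - integral\<^sup>L lborel E) \<le> norm p * norm (b - integral\<^sup>L lborel E)"
    by (rule norm_cauchy_schwarz)
  ultimately have "b \<bullet> p - p \<bullet> integral\<^sup>L lborel E \<le> beta * \<rho> powr (1 - 2 * s) * norm p"
    by (simp add: inner_diff_right inner_commute mult_ac)
  moreover have "Lop K b v x0 = (\<integral>y. g y \<partial>lborel) + b \<bullet> p"
    unfolding Lop_def \<open>grad v x0 = p\<close> g_def by simp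
  ultimately show ?thesis using g_le U_eq by linarith
qed

text \<open>Moving the centre or the radius costs a bounded factor wherever r' + |y - c'| stays
  above some a > 0. With r' = 0 this applies outside a ball, with r' = a on the whole space.\<close>

lemma weight_le_weight:
  assumes "0 < a" "a \<le> r' + dist y c'" "0 \<le> r'" "0 < r" "0 \<le> k"
  shows "weight k r' c' y \<le> ((r + dist c c') / a + 1) powr k * weight k r c y"
proof (rule weight_le)
  have "r + dist y c \<le> (r + dist c c') * 1 + dist y c'"
    using dist_triangle[of y c c'] by (simp add: dist_commute)
  also have "\<dots> \<le> (r + dist c c') * ((r' + dist y c') / a) + (r' + dist y c')"
    using assms by (intro add_mono mult_left_mono) auto
  finally show "r + dist y c \<le> ((r + dist c c') / a + 1) * (r' + dist y c')"
    by (simp add: algebra_simps)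
  show "0 < r + dist y c" using assms by (smt (verit) zero_le_dist)
qed (use assms in auto)

abbreviation tail_integrable :: "real \<Rightarrow> real \<Rightarrow> 'a::euclidean_space \<Rightarrow> ('a \<Rightarrow> real) \<Rightarrow> bool" where
  "tail_integrable k r c u \<equiv> integrable lborel (\<lambda>y. u y * weight k r c y)"

lemma integrable_weight_mono:
  assumes u: "tail_integrable k r c u" "0 < r" "0 \<le> k"
    and um: "u \<in> borel_measurable borel" and a: "0 < a" "0 \<le> r'" and A: "A \<in> sets borel"
    and sub: "\<And>y. y \<in> A \<Longrightarrow> a \<le> r' + dist y c'"
  shows "integrable lborel (\<lambda>y. u y * weight k r' c' y * indicator A y)"
proof (rule Bochner_Integration.integrable_bound)
  show "integrable lborel (\<lambda>y. ((r + dist c c') / a + 1) powr k * (u y * weight k r c y))"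
    using u(1) by simp
  show "(\<lambda>y. u y * weight k r' c' y * indicator A y) \<in> borel_measurable lborel"
    using um A by (auto intro!: borel_measurable_times borel_measurable_indicator weight_measurable)
  show "AE y in lborel. norm (u y * weight k r' c' y * indicator A y)
      \<le> norm (((r + dist c c') / a + 1) powr k * (u y * weight k r c y))"
  proof (rule AE_I2)
    fix y
    show "norm (u y * weight k r' c' y * indicator A y)
      \<le> norm (((r + dist c c') / a + 1) powr k * (u y * weight k r c y))"
    proof (cases "y \<in> A")
      case True
      have "weight k r' c' y \<le> ((r + dist c c') / a + 1) powr k * weight k r c y"
        by (rule weight_le_weight) (use a u sub[OF True] in auto)
      then have "\<bar>u y\<bar> * weight k r' c' y \<le> \<bar>u y\<bar> * (((r + dist c c') / a + 1) powr k * weight k r c y)"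
        by (intro mult_left_mono) auto
      then show ?thesis using True by (simp add: abs_mult mult_ac)
    qed auto
  qed
qed

lemma integrable_weight:
  assumes "tail_integrable k r c u" "0 < r" "0 \<le> k"
    and "u \<in> borel_measurable borel" "0 < r'"
  shows "tail_integrable k r' c' u"
  using integrable_weight_mono[OF assms(1-4), of r' r' UNIV c'] assms by simp

lemma integrable_weight_compl:
  assumes "tail_integrable k r c u" "0 < r" "0 \<le> k"
    and "u \<in> borel_measurable borel" "0 < \<rho>"
  shows "outer_integrable k c' \<rho> u"
  by (rule integrable_weight_mono[OF assms(1-4), of \<rho>]) (use assms in \<open>auto simp: dist_commute\<close>)

section \<open>Paraboloids as test functions for the viscosity inequality\<close>

lemma GDERIV_quadratic:
  "GDERIV (\<lambda>y. c + p \<bullet> (y - x0) + Q * (norm (y - x0))\<^sup>2) y :> p + (2 * Q) *\<^sub>R (y - x0)"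
  unfolding gderiv_def power2_norm_eq_inner
  by (auto intro!: derivative_eq_intros simp: algebra_simps inner_commute)

lemma C2_on_quadratic: "C2_on UNIV (\<lambda>y. c + p \<bullet> (y - x0) + Q * (norm (y - x0))\<^sup>2)"
  unfolding C2_on_def
proof (intro exI conjI ballI)
  fix y
  show "GDERIV (\<lambda>y. c + p \<bullet> (y - x0) + Q * (norm (y - x0))\<^sup>2) y :> p + (2 * Q) *\<^sub>R (y - x0)"
    by (rule GDERIV_quadratic)
  show "((\<lambda>y. p + (2 * Q) *\<^sub>R (y - x0)) has_derivative (\<lambda>h. (2 * Q) *\<^sub>R h)) (at y)"
    by (auto intro!: derivative_eq_intros)
next
  show "continuous_on UNIV (\<lambda>y. (2 * Q) *\<^sub>R i \<bullet> j)" for i j :: 'a by simp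
qed

text \<open>The paraboloid is given by its vertex z because touching points arise by maximising w(y)
  - Q |y - z|^2. The quotient |x0 - z| / \<rho> compares the slope of the paraboloid at x0 with Q
  \<rho>. The number a is the right-hand side of the equation at x0.\<close>

definition paraboloid_bound ::
  "real \<Rightarrow> real \<Rightarrow> real \<Rightarrow> real \<Rightarrow> real \<Rightarrow> ('a::euclidean_space \<Rightarrow> real) \<Rightarrow> real \<Rightarrow> 'a \<Rightarrow> bool" where
  "paraboloid_bound lam Lam s k C w a x0 \<longleftrightarrow> (\<forall>\<rho> z Q P N. 0 < \<rho> \<longrightarrow> \<rho> < 1 \<longrightarrow> 0 \<le> Q \<longrightarrow>
    (\<forall>y. dist y x0 < \<rho> \<longrightarrow> w y \<le> w x0 + Q * ((norm (y - z))\<^sup>2 - (norm (x0 - z))\<^sup>2)) \<longrightarrow>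
    (\<forall>y. \<rho> \<le> dist y x0 \<longrightarrow> w y - w x0 \<le> P y - N y) \<longrightarrow> (\<forall>y. 0 \<le> P y \<and> 0 \<le> N y) \<longrightarrow>
    outer_integrable k x0 \<rho> P \<longrightarrow>
    outer_integrable k x0 \<rho> N \<longrightarrow>
    a \<le> C * (1 + norm (x0 - z) / \<rho>) * Q * \<rho> powr (2 - 2 * s)
      + Lam * outer_tail k x0 \<rho> P
      - lam * outer_tail k x0 \<rho> N)"

lemmas paraboloid_boundD = paraboloid_bound_def[THEN iffD1, rule_format]

text \<open>Every use of the viscosity hypothesis goes through this lemma: the test function is a
  paraboloid, so no regularisation is needed, and bounding the increments of $w$ away from $x_0$
  by $P - N$ removes the kernel from the conclusion. The bound on $b$ and on the first moments in
  \<^const>\<open>Lclass\<close> is exactly what makes the gradient contribute at the scaling-invariant rate.\<close>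

lemma visc_touch:
  fixes s lam Lam beta k :: real
  assumes s: "1/2 \<le> s" "s < 1" and k: "k = real DIM('a::euclidean_space) + 2 * s"
    and lam: "0 < lam" "lam \<le> Lam" "0 \<le> beta"
  shows "\<exists>C>0. \<forall>(w::'a \<Rightarrow> real) F D x0.
    visc_Mplus_ge lam Lam beta s w F D \<longrightarrow> open D \<longrightarrow> x0 \<in> D \<longrightarrow> w \<in> borel_measurable borel \<longrightarrow>
    tail_integrable k 1 0 w \<longrightarrow> paraboloid_bound lam Lam s k C w (F x0) x0"
proof -
  obtain C1 where C1: "0 < C1" "\<And>\<rho>. 0 < \<rho> \<Longrightarrow>
     (\<integral>y. norm y powr (2 - k) * indicator (ball 0 \<rho> :: 'a set) y \<partial>lborel) \<le> C1 * \<rho> powr (2 - 2 * s)"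
    using ball_powr_integral[OF s k] by blast
  \<comment> \<open>\<open>Lam * C1\<close> pays for the opening through the second moment;
    \<open>2 * beta\<close> for the slope, as |p| = 2 Q |x0 - z|.\<close>
  define C where "C = Lam * C1 + 2 * beta"
  have Lam: "0 < Lam" using lam by simp
  have C: "0 < C" using C1 Lam lam unfolding C_def by (intro add_pos_nonneg mult_pos_pos) auto
  show ?thesis
    unfolding paraboloid_bound_def
  proof (intro exI[of _ C] conjI allI impI C)
    fix w P N :: "'a \<Rightarrow> real" and F D x0 z \<rho> Q
    assume visc: "visc_Mplus_ge lam Lam beta s w F D" and D: "open D" "x0 \<in> D"
      and wm [measurable]: "w \<in> borel_measurable borel" and wi: "tail_integrable k 1 0 w"
      and \<rho>: "0 < \<rho>" "\<rho> < 1" and Q: "0 \<le> Q"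
      and mid: "\<forall>y. dist y x0 < \<rho> \<longrightarrow> w y \<le> w x0 + Q * ((norm (y - z))\<^sup>2 - (norm (x0 - z))\<^sup>2)"
      and far: "\<forall>y. \<rho> \<le> dist y x0 \<longrightarrow> w y - w x0 \<le> P y - N y"
      and PN: "\<forall>y. 0 \<le> P y \<and> 0 \<le> N y"
      and Pi: "outer_integrable k x0 \<rho> P"
      and Ni: "outer_integrable k x0 \<rho> N"
    define IP where "IP = outer_tail k x0 \<rho> P"
    define IN where "IN = outer_tail k x0 \<rho> N"
    define J where "J = (\<integral>y. norm y powr (2 - k) * indicator (ball 0 \<rho> :: 'a set) y \<partial>lborel)"
    have J0: "0 \<le> J" unfolding J_def by simp
    have J1: "J \<le> C1 * \<rho> powr (2 - 2 * s)" unfolding J_def by (rule C1(2)) (rule \<rho>)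
    define p where "p = (2 * Q) *\<^sub>R (x0 - z)"
    have k0: "0 \<le> k" using s k by simp
    have expand: "Q * ((norm (y - z))\<^sup>2 - (norm (x0 - z))\<^sup>2) = p \<bullet> (y - x0) + Q * (norm (y - x0))\<^sup>2" for y
      unfolding p_def power2_norm_eq_inner by (simp add: algebra_simps inner_commute)
    \<comment> \<open>A test function must lie strictly above w off x0, whereas the given paraboloid
      may touch elsewhere too. Raising the opening by \<epsilon> makes the contact strict;
      \<epsilon> tends to 0 afterwards.\<close>
    have step: "F x0 \<le> (Q + \<epsilon>) * Lam * J + beta * \<rho> powr (1 - 2 * s) * norm p + Lam * IP - lam * IN"
      if \<epsilon>: "0 < \<epsilon>" for \<epsilon>
    proof -
      obtain \<sigma>' where \<sigma>': "0 < \<sigma>'" "ball x0 \<sigma>' \<subseteq> D" using D open_contains_ball by blast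
      \<comment> \<open>The ball of radius \<rho> may leave D, but the neighbourhood in the
        viscosity definition may not: w is replaced by the paraboloid only on the smaller ball, and
        between \<sigma> and \<rho> the one-sided bound on w is enough.\<close>
      define \<sigma> where "\<sigma> = min \<sigma>' \<rho>"
      have \<sigma>: "0 < \<sigma>" "\<sigma> \<le> \<rho>" "ball x0 \<sigma> \<subseteq> D" using \<sigma>' \<rho> by (auto simp: \<sigma>_def)
      define \<phi> where "\<phi> y = w x0 + p \<bullet> (y - x0) + (Q + \<epsilon>) * (norm (y - x0))\<^sup>2" for y
      define v where "v y = (if y \<in> ball x0 \<sigma> then \<phi> y else w y)" for y
      have vx0: "v x0 = w x0" using \<sigma> by (simp add: v_def \<phi>_def)
      have w_le: "w y \<le> w x0 + p \<bullet> (y - x0) + Q * (norm (y - x0))\<^sup>2" if "dist y x0 < \<rho>" for y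
        using mid[rule_format, OF that] expand[of y] by linarith
      have "\<phi> y > w y" if "y \<in> ball x0 \<sigma> - {x0}" for y
      proof -
        have "w y \<le> w x0 + p \<bullet> (y - x0) + Q * (norm (y - x0))\<^sup>2"
          by (rule w_le) (use that \<sigma> in \<open>auto simp: dist_commute\<close>)
        moreover have "0 < \<epsilon> * (norm (y - x0))\<^sup>2" using that \<epsilon> by simp
        ultimately show ?thesis by (simp add: \<phi>_def algebra_simps)
      qed
      then have "ereal (F x0) \<le> Mplus lam Lam beta s (\<lambda>y. if y \<in> ball x0 \<sigma> then \<phi> y else w y) x0"
        using visc[unfolded visc_Mplus_ge_def, rule_format, of x0 "ball x0 \<sigma>" \<phi>] D \<sigma>
          C2_on_quadratic[of "w x0" p x0 "Q + \<epsilon>"]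
        by (auto simp: \<phi>_def[abs_def])
      also have "(\<lambda>y. if y \<in> ball x0 \<sigma> then \<phi> y else w y) = v" by (simp add: v_def[abs_def])
      also have "Mplus lam Lam beta s v x0
        \<le> ereal ((Q + \<epsilon>) * Lam * J + beta * \<rho> powr (1 - 2 * s) * norm p + Lam * IP - lam * IN)"
        unfolding Mplus_def
      proof (rule SUP_least)
        fix KB assume "KB \<in> (Lclass lam Lam beta s :: (('a \<Rightarrow> real) \<times> 'a) set)"
        then have KB: "(fst KB, snd KB) \<in> Lclass lam Lam beta s" by simp
        have "Lop (fst KB) (snd KB) v x0 \<le> (Q + \<epsilon>) * Lam * J
           + beta * \<rho> powr (1 - 2 * s) * norm p + Lam * IP - lam * IN"
          unfolding J_def IP_def IN_def
        proof (rule Lop_touching_le[OF s k lam(1) KB])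
          have [measurable]: "\<phi> \<in> borel_measurable borel" unfolding \<phi>_def[abs_def] by measurable
          show "v \<in> borel_measurable borel" unfolding v_def by measurable
          have "outer_integrable k x0 \<sigma> w"
            by (rule integrable_weight_compl[OF wi]) (use k0 wm \<sigma> in auto)
          moreover have "v y * weight k 0 x0 y * indicator (- ball x0 \<sigma>) y = w y * weight k 0 x0 y * indicator (- ball x0 \<sigma>) y" for y
            by (auto simp: v_def indicator_def)
          ultimately show "outer_integrable k x0 \<sigma> v" by presburger
          show "0 < \<sigma>" "\<sigma> \<le> \<rho>" "\<rho> < 1" "0 \<le> Q + \<epsilon>" using \<sigma> \<rho> Q \<epsilon> by auto
          have "GDERIV \<phi> x0 :> p"
            using GDERIV_quadratic[of "w x0" p x0 "Q + \<epsilon>" x0] by (simp add: \<phi>_def[abs_def])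
          then have "GDERIV v x0 :> p" unfolding gderiv_def
            by (rule has_derivative_transform_within_open[of _ _ _ _ "ball x0 \<sigma>"]) (use \<sigma> in \<open>auto simp: v_def\<close>)
          then show "grad v x0 = p" by (rule grad_eq)
          show near: "v y = v x0 + p \<bullet> (y - x0) + (Q + \<epsilon>) * (norm (y - x0))\<^sup>2" if "dist y x0 < \<sigma>" for y
            using that vx0 by (simp add: v_def \<phi>_def dist_commute)
          show "v y \<le> v x0 + p \<bullet> (y - x0) + (Q + \<epsilon>) * (norm (y - x0))\<^sup>2" if "dist y x0 < \<rho>" for y
          proof (cases "dist y x0 < \<sigma>")
            case False
            have "0 \<le> \<epsilon> * (norm (y - x0))\<^sup>2" using \<epsilon> by simp
            moreover have "v y = w y" using False by (simp add: v_def dist_commute)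
            ultimately show ?thesis using w_le[OF that] vx0 by (simp add: algebra_simps)
          qed (use near in simp)
          show "v y - v x0 \<le> P y - N y" if "\<rho> \<le> dist y x0" for y
            using far that vx0 \<sigma> by (auto simp: v_def dist_commute)
        qed (use PN Pi Ni in auto)
        then show "ereal (Lop (fst KB) (snd KB) v x0) \<le> ereal ((Q + \<epsilon>) * Lam * J
           + beta * \<rho> powr (1 - 2 * s) * norm p + Lam * IP - lam * IN)" by simp
      qed
      finally show ?thesis by simp
    qed
    have "F x0 \<le> Q * Lam * J + beta * \<rho> powr (1 - 2 * s) * norm p + Lam * IP - lam * IN"
    proof (rule field_le_epsilon)
      fix e :: real assume e: "0 < e"
      have L: "0 \<le> Lam * J" using Lam J0 by simp
      define \<epsilon> where "\<epsilon> = e / (Lam * J + 1)"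
      have "0 < \<epsilon>" using e L by (simp add: \<epsilon>_def)
      moreover have "\<epsilon> * (Lam * J) \<le> e" using e L by (simp add: \<epsilon>_def field_simps)
      ultimately show "F x0 \<le> Q * Lam * J + beta * \<rho> powr (1 - 2 * s) * norm p + Lam * IP - lam * IN + e"
        using step[of \<epsilon>] by (simp add: algebra_simps)
    qed
    moreover have "Q * Lam * J \<le> Q * Lam * (C1 * \<rho> powr (2 - 2 * s))"
      using J1 Q Lam by (intro mult_left_mono) auto
    moreover have "beta * \<rho> powr (1 - 2 * s) * norm p = 2 * beta * (norm (x0 - z) / \<rho>) * Q * \<rho> powr (2 - 2 * s)"
    proof -
      have "\<rho> powr (2 - 2 * s) = \<rho> * \<rho> powr (1 - 2 * s)"
        using \<rho> powr_add[of \<rho> 1 "1 - 2 * s"] by simp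
      moreover have "norm p = 2 * Q * norm (x0 - z)" unfolding p_def norm_scaleR using Q by simp
      ultimately show ?thesis using \<rho> by (simp add: field_simps)
    qed
    moreover have "C * (1 + norm (x0 - z) / \<rho>) * Q * \<rho> powr (2 - 2 * s)
      = Q * Lam * (C1 * \<rho> powr (2 - 2 * s)) + 2 * beta * (norm (x0 - z) / \<rho>) * Q * \<rho> powr (2 - 2 * s)
       + 2 * beta * Q * \<rho> powr (2 - 2 * s) + Lam * C1 * (norm (x0 - z) / \<rho>) * Q * \<rho> powr (2 - 2 * s)"
      unfolding C_def by (simp add: algebra_simps)
    moreover have "0 \<le> 2 * beta * Q * \<rho> powr (2 - 2 * s)"
      "0 \<le> Lam * C1 * (norm (x0 - z) / \<rho>) * Q * \<rho> powr (2 - 2 * s)"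
      using lam Q Lam C1(1) \<rho> by auto
    ultimately show "F x0 \<le> C * (1 + norm (x0 - z) / \<rho>) * Q * \<rho> powr (2 - 2 * s)
      + Lam * outer_tail k x0 \<rho> P
      - lam * outer_tail k x0 \<rho> N"
      unfolding IP_def IN_def by linarith
  qed
qed

subsection \<open>Supremum bound and comparison\<close>

text \<open>The quantity T_r(u) of the overview. The shift by r keeps the weight bounded near the
  centre, so local mass at scale r is counted together with the far tail.\<close>

definition tail :: "real \<Rightarrow> real \<Rightarrow> 'a::euclidean_space \<Rightarrow> ('a \<Rightarrow> real) \<Rightarrow> real" where
  "tail k r c u = (\<integral>y. u y * weight k r c y \<partial>lborel)"

lemma measure_lborel_ball:
  "0 \<le> r \<Longrightarrow> measure lborel (ball (c::'a::euclidean_space) r) = unit_ball_vol DIM('a) * r ^ DIM('a)"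
  by (simp add: measure_def emeasure_ball)

lemma integrable_indicator_ball:
  "integrable lborel (\<lambda>y. a * indicator (ball (c::'a::euclidean_space) r) y :: real)"
  using emeasure_lborel_ball_finite[of c r] by (intro integrable_mult_right integrable_real_indicator) auto

lemma tail_compl_le:
  assumes u: "tail_integrable k r c u" "\<And>y. 0 \<le> u y" "0 < r" "0 \<le> k"
    and ui: "outer_integrable k c' \<rho> u"
    and \<rho>: "0 < \<rho>" and M: "(r + dist c c') / \<rho> + 1 \<le> M"
  shows "outer_tail k c' \<rho> u \<le> M powr k * tail k r c u"
proof -
  have "outer_tail k c' \<rho> u \<le> (\<integral>y. M powr k * (u y * weight k r c y) \<partial>lborel)"
  proof (rule integral_mono[OF ui])
    show "integrable lborel (\<lambda>y. M powr k * (u y * weight k r c y))" using u(1) by simp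
    fix y
    show "u y * weight k 0 c' y * indicator (- ball c' \<rho>) y \<le> M powr k * (u y * weight k r c y)"
    proof (cases "y \<in> ball c' \<rho>")
      case False
      have "weight k 0 c' y \<le> ((r + dist c c') / \<rho> + 1) powr k * weight k r c y"
        by (rule weight_le_weight) (use False \<rho> u in \<open>auto simp: dist_commute\<close>)
      also have "\<dots> \<le> M powr k * weight k r c y"
        using M u \<rho> by (intro mult_right_mono powr_mono2 add_nonneg_nonneg divide_nonneg_pos) auto
      finally have "u y * weight k 0 c' y \<le> u y * (M powr k * weight k r c y)" by (rule mult_left_mono) (rule u(2))
      then show ?thesis using False by (simp add: mult_ac)
    qed (use u in auto)
  qed
  then show ?thesis by (simp add: tail_def)
qed

text \<open>Outside the removed ball |y - c'| <= r + |y - c|, so the pure kernel at c' dominates the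
  weight at c. Only the mass inside that ball is lost, and the bound H controls it.\<close>

lemma tail_compl_ge:
  fixes u :: "'a::euclidean_space \<Rightarrow> real"
  assumes u: "tail_integrable k r c u" "\<And>y. 0 \<le> u y" "0 < r" "0 \<le> k"
    and ui: "outer_integrable k c' \<rho> u"
    and \<rho>: "0 < \<rho>" and c': "dist c c' \<le> r" and H: "\<And>y. y \<in> ball c' \<rho> \<Longrightarrow> u y \<le> H"
  shows "tail k r c u - H * r powr (- k) * (unit_ball_vol DIM('a) * \<rho> ^ DIM('a))
     \<le> outer_tail k c' \<rho> u"
proof -
  have H0: "0 \<le> H" using H[of c'] u(2)[of c'] \<rho> by simp
  have "tail k r c u \<le> (\<integral>y. u y * weight k 0 c' y * indicator (- ball c' \<rho>) y + H * r powr (- k) * indicator (ball c' \<rho>) y \<partial>lborel)"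
    unfolding tail_def
  proof (rule integral_mono[OF u(1)])
    show "integrable lborel (\<lambda>y. u y * weight k 0 c' y * indicator (- ball c' \<rho>) y + H * r powr (- k) * indicator (ball c' \<rho>) y)"
      by (intro Bochner_Integration.integrable_add ui integrable_indicator_ball)
    fix y
    show "u y * weight k r c y \<le> u y * weight k 0 c' y * indicator (- ball c' \<rho>) y + H * r powr (- k) * indicator (ball c' \<rho>) y"
    proof (cases "y \<in> ball c' \<rho>")
      case True
      have "weight k r c y \<le> r powr (- k)" unfolding weight_def using u by (intro powr_mono2') auto
      then have "u y * weight k r c y \<le> H * r powr (- k)"
        using H[OF True] u(2) H0 by (intro mult_mono) auto
      then show ?thesis using True by simp
    next
      case False
      have "dist y c' \<le> r + dist y c" using dist_triangle[of y c' c] c' by linarith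
      then have "weight k r c y \<le> weight k 0 c' y"
        unfolding weight_def using u False \<rho> by (intro powr_mono2') (auto simp: dist_commute)
      then show ?thesis using False u(2)[of y] by (simp add: mult_left_mono)
    qed
  qed
  also have "\<dots> = outer_tail k c' \<rho> u
      + H * r powr (- k) * (unit_ball_vol DIM('a) * \<rho> ^ DIM('a))"
    using \<rho> measure_lborel_ball[of \<rho> c'] by (subst Bochner_Integration.integral_add[OF ui integrable_indicator_ball]) simp
  finally show ?thesis by simp
qed

text \<open>Choose $x_0$ maximising $u(x)\,(r - |x - c|)^k$ and put $d = r - |x_0 - c|$. On a ball of radius
  $\eta d$ around $x_0$ the function $u$ exceeds $u(x_0)$ by at most a small factor, so a paraboloid
  with a small opening touches $u$ from above nearby, at $x_1$. The term $N$, the value $u(x_1)$ on an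
  annulus, then beats the paraboloid and only the integral of $u$ can compensate for it.\<close>

lemma sup_bound:
  fixes s lam Lam beta k :: real
  assumes s: "1/2 \<le> s" "s < 1" and k: "k = real DIM('a::euclidean_space) + 2 * s"
    and lam: "0 < lam" "lam \<le> Lam" "0 \<le> beta"
  shows "\<exists>C>0. \<forall>\<Omega> (u :: 'a \<Rightarrow> real) (c :: 'a) r e.
    open \<Omega> \<longrightarrow> continuous_on (ball 0 1) u \<longrightarrow> (\<forall>x. 0 \<le> u x) \<longrightarrow> (\<forall>x\<in>ball 0 1 - \<Omega>. u x = 0) \<longrightarrow>
    u \<in> borel_measurable borel \<longrightarrow> tail_integrable k 1 0 u \<longrightarrow>
    visc_Mplus_ge lam Lam beta s u (\<lambda>_. - e) (ball 0 1 \<inter> \<Omega>) \<longrightarrow> 0 \<le> e \<longrightarrow> 0 < r \<longrightarrow> r < 1 \<longrightarrow>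
    cball c r \<subseteq> ball 0 1 \<longrightarrow> (\<forall>x\<in>cball c (r/2). u x \<le> C * r powr (2 * s) * (tail k r c u + e))"
proof -
  from visc_touch[OF s k lam] obtain Cm where Cm: "0 < Cm" and touch: "\<forall>(w::'a \<Rightarrow> real) F D x0.
    visc_Mplus_ge lam Lam beta s w F D \<longrightarrow> open D \<longrightarrow> x0 \<in> D \<longrightarrow> w \<in> borel_measurable borel \<longrightarrow>
    tail_integrable k 1 0 w \<longrightarrow> paraboloid_bound lam Lam s k Cm w (F x0) x0"
    by (elim exE conjE) (rule that)
  define V where "V = unit_ball_vol DIM('a)"
  have V: "0 < V" by (simp add: V_def)
  have n1: "1 \<le> DIM('a)" using DIM_positive[where 'a='a] by linarith
  have k0: "0 < k" using s k by simp
  have Lam: "0 < Lam" using lam by simp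
  \<comment> \<open>Chosen so that \<open>lam\<close> times the annulus mass of \<open>N\<close> is
    at least 2 c1 u(x0) \<rho>^(-2s). The choice of \<delta> lets the paraboloid use up half of
    this, and \<eta> is the relative radius on which the weight (r - |x - c|)^k varies by the factor
    1 + \<delta>.\<close>
  define c1 where "c1 = lam * V * 2 powr (- k) / 2"
  have c1: "0 < c1" using lam V by (simp add: c1_def)
  define \<delta> where "\<delta> = min 1 (2 * c1 / Cm)"
  have \<delta>: "0 < \<delta>" "\<delta> \<le> 1" "Cm * \<delta> \<le> 2 * c1" using c1 Cm by (auto simp: \<delta>_def min_def field_simps)
  define \<eta> where "\<eta> = 1 - (1 + \<delta>) powr (- 1 / k)"
  have \<eta>pow: "(1 - \<eta>) powr (- k) = 1 + \<delta>" using \<delta> k0 by (simp add: \<eta>_def powr_powr)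
  have \<eta>: "0 < \<eta>" "\<eta> < 1" using \<delta> k0 by (auto simp: \<eta>_def powr_less_one intro!: powr_gt_zero)
  \<comment> \<open>3^k comes from recentring the tail at x1, where (r + |c - x1|)/\<rho> + 1 <= 3
    r/\<rho>. In \<open>C\<close> below, the factor 8/\<eta> is 4/\<eta> from d = 4 \<rho>/\<eta>
    times 2 from (r/2)^k.\<close>
  define C0 where "C0 = (1 + Lam * 3 powr k) / c1"
  have C0: "0 < C0" using Lam c1 by (simp add: C0_def add_pos_nonneg)
  define C where "C = (8 / \<eta>) powr k * C0"
  have C: "0 < C" using C0 \<eta> by (simp add: C_def)
  show ?thesis
  proof (intro exI[of _ C] conjI allI impI ballI C)
    fix \<Omega> and u :: "'a \<Rightarrow> real" and c r e and x :: 'a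
    assume \<Omega>: "open \<Omega>" and cont: "continuous_on (ball 0 1) u" and u0: "\<forall>x. 0 \<le> u x"
      and uz: "\<forall>x\<in>ball 0 1 - \<Omega>. u x = 0"
      and um [measurable]: "u \<in> borel_measurable borel" and ui: "tail_integrable k 1 0 u"
      and visc: "visc_Mplus_ge lam Lam beta s u (\<lambda>_. - e) (ball 0 1 \<inter> \<Omega>)"
      and e: "0 \<le> e" and r: "0 < r" "r < 1" and sub: "cball c r \<subseteq> ball 0 1" and x: "x \<in> cball c (r/2)"
    define T where "T = tail k r c u"
    have uW: "tail_integrable k r c u"
      by (rule integrable_weight[OF ui]) (use k0 r in auto)
    have T0: "0 \<le> T" unfolding T_def tail_def using u0 by (intro Bochner_Integration.integral_nonneg) auto
    define \<Phi> where "\<Phi> y = u y * (r - dist y c) powr k" for y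
    have "continuous_on (cball c r) \<Phi>"
      unfolding \<Phi>_def
      by (intro continuous_intros continuous_on_powr' continuous_on_subset[OF cont] sub)
        (use k0 in \<open>auto simp: dist_commute\<close>)
    then obtain x0 where x0: "x0 \<in> cball c r" "\<And>y. y \<in> cball c r \<Longrightarrow> \<Phi> y \<le> \<Phi> x0"
      using continuous_attains_sup[of "cball c r" \<Phi>] r by auto
    define d where "d = r - dist x0 c"
    have d: "0 \<le> d" "d \<le> r" using x0 by (auto simp: d_def dist_commute)
    have ux: "u x * (r / 2) powr k \<le> u x0 * d powr k"
    proof -
      have "u x * (r / 2) powr k \<le> u x * (r - dist x c) powr k"
        using x r k0 u0 by (intro mult_left_mono powr_mono2) (auto simp: dist_commute)
      also have "\<dots> \<le> u x0 * d powr k" using x0(2)[of x] x r by (auto simp: \<Phi>_def d_def)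
      finally show ?thesis .
    qed
    have main: "u x0 * d powr k \<le> (4 / \<eta>) powr k * (C0 * (r powr (2 * s) * r powr k) * (T + e))"
    proof (cases "u x0 * d powr k = 0")
      case True
      then show ?thesis using C0 T0 e unfolding True by (intro mult_nonneg_nonneg add_nonneg_nonneg) auto
    next
      case False
      then have d0: "0 < d" and ux0: "0 < u x0" using d u0[rule_format, of x0] by (auto simp: less_le)
      define R where "R = \<eta> * d"
      have R: "0 < R" "R < d" using \<eta> d0 by (auto simp: R_def)
      have near: "u y \<le> (1 + \<delta>) * u x0" if "y \<in> cball x0 R" for y
      proof -
        have dy: "d - R \<le> r - dist y c"
          using that dist_triangle[of y c x0] by (simp add: d_def dist_commute)
        then have y: "y \<in> cball c r" using R by (simp add: dist_commute)
        have "u y * ((1 - \<eta>) powr k * d powr k) = u y * ((1 - \<eta>) * d) powr k"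
          using \<eta> d by (simp add: powr_mult)
        also have "\<dots> \<le> u y * (r - dist y c) powr k"
          using dy \<eta> d0 k0 u0 by (intro mult_left_mono powr_mono2) (auto simp: R_def algebra_simps)
        also have "\<dots> \<le> u x0 * d powr k" using x0(2)[OF y] by (simp add: \<Phi>_def d_def)
        finally have "u y * (1 - \<eta>) powr k \<le> u x0" using d0 by (simp add: mult.assoc[symmetric])
        then have "u y \<le> (1 - \<eta>) powr (- k) * u x0" using \<eta> by (simp add: powr_minus_divide field_simps)
        then show ?thesis by (simp add: \<eta>pow)
      qed
      have csub: "cball x0 R \<subseteq> cball c r"
      proof
        fix y assume "y \<in> cball x0 R"
        then show "y \<in> cball c r" using R dist_triangle[of y c x0] by (simp add: d_def dist_commute)
      qed
      \<comment> \<open>At distance R from x0 the paraboloid takes away 2 \<delta> u(x0), while u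
        exceeds u(x0) by at most \<delta> u(x0). Hence the maximum point x1 satisfies |x1 - x0|^2 <=
        R^2/2 and lies in the ball of radius 3R/4, which leaves room for a touching ball of radius
        \<rho> = R/4.\<close>
      define Q where "Q = 2 * \<delta> * u x0 / R\<^sup>2"
      have Q: "0 \<le> Q" "Q * R\<^sup>2 = 2 * \<delta> * u x0" using \<delta> ux0 R by (auto simp: Q_def)
      have "continuous_on (cball x0 R) (\<lambda>y. u y - Q * (norm (y - x0))\<^sup>2)"
        by (intro continuous_intros continuous_on_subset[OF cont]) (use csub sub in blast)
      then obtain x1 where x1: "x1 \<in> cball x0 R"
        "\<And>y. y \<in> cball x0 R \<Longrightarrow> u y - Q * (norm (y - x0))\<^sup>2 \<le> u x1 - Q * (norm (x1 - x0))\<^sup>2"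
        using continuous_attains_sup[of "cball x0 R" "\<lambda>y. u y - Q * (norm (y - x0))\<^sup>2"] R by auto
      have val: "u x0 \<le> u x1 - Q * (norm (x1 - x0))\<^sup>2" using x1(2)[of x0] R by simp
      then have ux1: "u x0 \<le> u x1" using Q(1) by (smt (verit) mult_nonneg_nonneg zero_le_power2)
      have "Q * (norm (x1 - x0))\<^sup>2 \<le> \<delta> * u x0" using val near[OF x1(1)] by (simp add: algebra_simps)
      also have "\<dots> = Q * (R\<^sup>2 / 2)" using Q(2) by simp
      finally have "Q * (norm (x1 - x0))\<^sup>2 \<le> Q * (R\<^sup>2 / 2)" .
      moreover have "0 < Q" using \<delta> ux0 R by (simp add: Q_def)
      ultimately have "(norm (x1 - x0))\<^sup>2 \<le> R\<^sup>2 / 2" by (rule mult_left_le_imp_le)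
      also have "\<dots> \<le> (3/4 * R)\<^sup>2" by (simp add: power2_eq_square)
      finally have x1R: "norm (x1 - x0) \<le> 3/4 * R" using R by (simp add: power2_le_iff_abs_le)
      define \<rho> where "\<rho> = R / 4"
      have \<rho>: "0 < \<rho>" "\<rho> \<le> r" "\<rho> < 1" "R = 4 * \<rho>" using R d r by (auto simp: \<rho>_def)
      have x1b: "x1 \<in> cball c r" using x1(1) csub by blast
      have x1\<Omega>: "x1 \<in> ball 0 1 \<inter> \<Omega>"
        using uz x1b sub ux1 ux0 by (smt (verit) DiffI IntI subset_iff)
      \<comment> \<open>As N <= u(x1), the increment u(y) - u(x1) is at most u(y) - N(y); thus the
        drop by u(x1) is kept on a bounded annulus only.\<close>
      define N where "N y = u x1 * indicator (ball x1 (2 * \<rho>)) y" for y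
      have PiI: "outer_integrable k x1 \<rho> u"
        by (rule integrable_weight_compl[OF ui]) (use k0 \<rho> in auto)
      have NiI: "outer_integrable k x1 \<rho> N"
      proof (rule Bochner_Integration.integrable_bound[OF integrable_indicator_ball[of "u x1 * \<rho> powr (- k)" x1 "2 * \<rho>"]])
        show "(\<lambda>y. N y * weight k 0 x1 y * indicator (- ball x1 \<rho>) y) \<in> borel_measurable lborel"
          unfolding N_def by measurable
        have "weight k 0 x1 y \<le> \<rho> powr - k" if "y \<notin> ball x1 \<rho>" for y
          unfolding weight_def using that \<rho> k0 by (intro powr_mono2') (auto simp: dist_commute)
        then show "AE y in lborel. norm (N y * weight k 0 x1 y * indicator (- ball x1 \<rho>) y)
            \<le> norm (u x1 * \<rho> powr - k * indicator (ball x1 (2 * \<rho>)) y)"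
          using u0 by (intro AE_I2) (auto simp: N_def indicator_def abs_mult intro!: mult_left_mono)
      qed
      have "- e \<le> Cm * (1 + norm (x1 - x0) / \<rho>) * Q * \<rho> powr (2 - 2 * s)
        + Lam * outer_tail k x1 \<rho> u
        - lam * outer_tail k x1 \<rho> N"
      proof (rule paraboloid_boundD[OF touch[rule_format, OF visc _ x1\<Omega> um ui] \<rho>(1) \<rho>(3) Q(1) _ _ _ PiI NiI])
        show "open (ball 0 1 \<inter> \<Omega>)" using \<Omega> by auto
        show "u y \<le> u x1 + Q * ((norm (y - x0))\<^sup>2 - (norm (x1 - x0))\<^sup>2)" if "dist y x1 < \<rho>" for y
        proof -
          from that have "y \<in> cball x0 R"
            using x1R \<rho> dist_triangle[of y x0 x1] by (simp add: dist_norm norm_minus_commute)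
          then show "u y \<le> u x1 + Q * ((norm (y - x0))\<^sup>2 - (norm (x1 - x0))\<^sup>2)"
            using x1(2)[of y] by (simp add: algebra_simps)
        qed
        show "u y - u x1 \<le> u y - N y" for y using u0 by (auto simp: N_def indicator_def)
        show "0 \<le> u y \<and> 0 \<le> N y" for y using u0 by (auto simp: N_def)
      qed
      moreover have "outer_tail k x1 \<rho> u \<le> (3 * r / \<rho>) powr k * T"
        unfolding T_def
      proof (rule tail_compl_le[OF uW _ _ _ PiI \<rho>(1)])
        have "dist c x1 \<le> r" using x1b by simp
        then have "(r + dist c x1 + \<rho>) / \<rho> \<le> 3 * r / \<rho>" using \<rho> by (intro divide_right_mono) auto
        then show "(r + dist c x1) / \<rho> + 1 \<le> 3 * r / \<rho>" using \<rho> by (simp add: add_divide_distrib)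
      qed (use u0 r k0 in auto)
      \<comment> \<open>On the annulus between \<rho> and 2 \<rho> the kernel is at least (2
        \<rho>)^(-k), and the volume is at least V \<rho>^n because 2^n - 1 >= 1.\<close>
      moreover have "u x0 * (2 * c1 / lam * \<rho> powr (- 2 * s))
           \<le> outer_tail k x1 \<rho> N"
      proof -
        define a where "a = u x1 * (2 * \<rho>) powr (- k)"
        have "(\<integral>y. a * indicator (ball x1 (2 * \<rho>)) y - a * indicator (ball x1 \<rho>) y \<partial>lborel)
           \<le> outer_tail k x1 \<rho> N"
        proof (rule integral_mono[OF _ NiI])
          show "integrable lborel (\<lambda>y. a * indicator (ball x1 (2 * \<rho>)) y - a * indicator (ball x1 \<rho>) y)"
            by (intro Bochner_Integration.integrable_diff integrable_indicator_ball)
          fix y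
          show "a * indicator (ball x1 (2 * \<rho>)) y - a * indicator (ball x1 \<rho>) y
             \<le> N y * weight k 0 x1 y * indicator (- ball x1 \<rho>) y"
          proof (cases "y \<in> ball x1 (2 * \<rho>) - ball x1 \<rho>")
            case True
            have "(2 * \<rho>) powr (- k) \<le> weight k 0 x1 y"
              unfolding weight_def using True \<rho> k0 by (intro powr_mono2') (auto simp: dist_commute)
            then show ?thesis using True u0 by (auto simp: a_def N_def intro!: mult_left_mono)
          qed (use u0 \<rho> in \<open>auto simp: a_def N_def indicator_def\<close>)
        qed
        also have "(\<integral>y. a * indicator (ball x1 (2 * \<rho>)) y - a * indicator (ball x1 \<rho>) y \<partial>lborel)
          = a * (V * (2 * \<rho>) ^ DIM('a)) - a * (V * \<rho> ^ DIM('a))"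
          using \<rho> by (subst Bochner_Integration.integral_diff[OF integrable_indicator_ball integrable_indicator_ball])
             (simp add: measure_lborel_ball V_def)
        also have "\<dots> = a * V * ((2 ^ DIM('a) - 1) * \<rho> ^ DIM('a))" by (simp add: power_mult_distrib algebra_simps)
        finally have "a * V * ((2 ^ DIM('a) - 1) * \<rho> ^ DIM('a))
          \<le> outer_tail k x1 \<rho> N" .
        moreover have "a * V * (1 * \<rho> ^ DIM('a)) \<le> a * V * ((2 ^ DIM('a) - 1) * \<rho> ^ DIM('a))"
        proof -
          have "(2::real) ^ 1 \<le> 2 ^ DIM('a)" using n1 by (intro power_increasing) auto
          then have "(1::real) \<le> 2 ^ DIM('a) - 1" by simp
          moreover have "0 \<le> a * V" using V u0 by (simp add: a_def)
          ultimately show ?thesis using \<rho> by (intro mult_left_mono mult_right_mono) auto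
        qed
        moreover have "a * V * (1 * \<rho> ^ DIM('a)) = u x1 * (2 * c1 / lam * \<rho> powr (- 2 * s))"
        proof -
          have "\<rho> powr (- 2 * s) = \<rho> powr (- k) * \<rho> ^ DIM('a)"
            using \<rho> by (simp add: k flip: powr_realpow powr_add)
          then show ?thesis using \<rho> lam by (simp add: a_def c1_def powr_mult)
        qed
        moreover have "u x0 * (2 * c1 / lam * \<rho> powr (- 2 * s)) \<le> u x1 * (2 * c1 / lam * \<rho> powr (- 2 * s))"
          using ux1 c1 lam by (intro mult_right_mono) auto
        ultimately show ?thesis by linarith
      qed
      moreover have "Cm * (1 + norm (x1 - x0) / \<rho>) * Q * \<rho> powr (2 - 2 * s) \<le> c1 * u x0 * \<rho> powr (- 2 * s)"
      proof -
        have "1 + norm (x1 - x0) / \<rho> \<le> 4" using x1R \<rho> by (simp add: field_simps)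
        then have "Cm * (1 + norm (x1 - x0) / \<rho>) * Q * \<rho> powr (2 - 2 * s) \<le> Cm * 4 * Q * \<rho> powr (2 - 2 * s)"
          using Cm Q by (intro mult_right_mono mult_left_mono) auto
        also have "Cm * 4 * Q * \<rho> powr (2 - 2 * s) = Cm * 4 * Q * (\<rho>\<^sup>2 * \<rho> powr (- 2 * s))"
          using \<rho> powr_add[of \<rho> 2 "- 2 * s"] by simp
        also have "Cm * 4 * Q * (\<rho>\<^sup>2 * \<rho> powr (- 2 * s)) = Cm * \<delta> * (u x0 * \<rho> powr (- 2 * s)) / 2"
          using \<rho> by (simp add: Q_def field_simps power2_eq_square)
        also have "\<dots> \<le> 2 * c1 * (u x0 * \<rho> powr (- 2 * s)) / 2"
          using \<delta>(3) ux0 by (intro divide_right_mono mult_right_mono) auto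
        finally show ?thesis by simp
      qed
      ultimately have "- e \<le> c1 * u x0 * \<rho> powr (- 2 * s) + Lam * ((3 * r / \<rho>) powr k * T)
         - lam * (u x0 * (2 * c1 / lam * \<rho> powr (- 2 * s)))"
        using mult_left_mono[of _ _ Lam] mult_left_mono[of _ _ lam] Lam lam(1) by (smt (verit))
      moreover have "lam * (u x0 * (2 * c1 / lam * \<rho> powr (- 2 * s))) = 2 * (c1 * u x0 * \<rho> powr (- 2 * s))"
        using lam by simp
      ultimately have "c1 * u x0 * \<rho> powr (- 2 * s) \<le> e + Lam * ((3 * r / \<rho>) powr k * T)" by linarith
      \<comment> \<open>Multiplying by \<rho>^(k + 2s) produces u(x0) \<rho>^k, which is u(x0) d^k
        up to (4/\<eta>)^k, and cancels the blow-up of (3 r/\<rho>)^k. The bound thus does not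
        degenerate as d tends to 0.\<close>
      then have "(\<rho> powr k * \<rho> powr (2 * s)) * (c1 * u x0 * \<rho> powr (- 2 * s))
         \<le> (\<rho> powr k * \<rho> powr (2 * s)) * (e + Lam * ((3 * r / \<rho>) powr k * T))"
        by (intro mult_left_mono) auto
      moreover have "(\<rho> powr k * \<rho> powr (2 * s)) * (c1 * u x0 * \<rho> powr (- 2 * s)) = c1 * (u x0 * \<rho> powr k)"
        using \<rho> by (simp add: powr_minus_divide)
      moreover have "(\<rho> powr k * \<rho> powr (2 * s)) * (e + Lam * ((3 * r / \<rho>) powr k * T))
         = \<rho> powr (2 * s) * (\<rho> powr k * e + Lam * 3 powr k * r powr k * T)"
        using \<rho> r by (simp add: powr_mult powr_divide field_simps)
      moreover have "\<rho> powr (2 * s) * (\<rho> powr k * e + Lam * 3 powr k * r powr k * T)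
         \<le> r powr (2 * s) * (r powr k * e + Lam * 3 powr k * r powr k * T)"
        using \<rho> r s k0 e T0 Lam
        by (intro mult_mono add_mono mult_right_mono powr_mono2 order_refl add_nonneg_nonneg mult_nonneg_nonneg) auto
      moreover have "r powr (2 * s) * (r powr k * e + Lam * 3 powr k * r powr k * T)
         \<le> r powr (2 * s) * (r powr k * ((1 + Lam * 3 powr k) * (T + e)))"
        using e T0 Lam
        by (auto intro!: mult_left_mono simp: algebra_simps)
      ultimately have "c1 * (u x0 * \<rho> powr k) \<le> r powr (2 * s) * (r powr k * ((1 + Lam * 3 powr k) * (T + e)))"
        by linarith
      then have "u x0 * \<rho> powr k \<le> C0 * (r powr (2 * s) * r powr k) * (T + e)"
        using c1 by (simp add: C0_def field_simps)
      moreover have "d powr k = (4 / \<eta>) powr k * \<rho> powr k"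
        using \<eta> d0 by (simp add: \<rho>_def R_def flip: powr_mult)
      ultimately show ?thesis using \<eta> mult_left_mono[of "u x0 * \<rho> powr k" _ "(4 / \<eta>) powr k"] by (simp add: mult_ac)
    qed
    have "u x * (r / 2) powr k \<le> (4 / \<eta>) powr k * (C0 * (r powr (2 * s) * r powr k) * (T + e))"
      using ux main by linarith
    also have "\<dots> = (C * r powr (2 * s) * (T + e)) * (r / 2) powr k"
    proof -
      have 8: "(8 / \<eta>) powr k = (4 / \<eta>) powr k * 2 powr k" using \<eta> powr_mult[of "4 / \<eta>" 2 k] by simp
      have 2: "r powr k = (r / 2) powr k * 2 powr k" using r powr_mult[of "r / 2" 2 k] by simp
      show ?thesis unfolding C_def 8 2 by (simp only: mult_ac)
    qed
    finally show "u x \<le> C * r powr (2 * s) * (tail k r c u + e)" using r by (simp add: T_def)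
  qed
qed

text \<open>The level \<tau> is a positive constant when u is bounded below by a constant, with w =
  -u, and 0 when two functions are compared. Positivity of w + \<tau> forces a point into \<Omega>,
  so the maximum lies where the equation holds. The bound H fixes the opening of the paraboloid, H'
  the mass of N that can be hidden near the maximum.\<close>

definition comparison_setting where
  "comparison_setting lam Lam beta s k \<kappa> \<Omega> (w :: 'a::euclidean_space \<Rightarrow> real) e c r x1 \<tau> P N H H' \<longleftrightarrow>
    open \<Omega> \<and> continuous_on (ball 0 1) w \<and> w \<in> borel_measurable borel \<and>
    tail_integrable k 1 0 w \<and>
    visc_Mplus_ge lam Lam beta s w (\<lambda>_. - e) (ball 0 1 \<inter> \<Omega>) \<and> 0 < r \<and> r \<le> 1 \<and>
    ball c (r/2) \<subseteq> ball 0 1 \<and> cball x1 (2 * \<kappa> * r) \<subseteq> ball c (r/2) \<and>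
    (\<forall>y\<in>cball x1 (\<kappa> * r). 0 < w y + \<tau> \<longrightarrow> y \<in> \<Omega>) \<and>
    (\<forall>y. w y + \<tau> \<le> P y - N y) \<and> (\<forall>y. 0 \<le> P y \<and> 0 \<le> N y) \<and>
    P \<in> borel_measurable borel \<and> N \<in> borel_measurable borel \<and>
    tail_integrable k r c P \<and> tail_integrable k r c N \<and>
    (\<forall>y\<in>ball c (r/2). P y \<le> H \<and> N y \<le> H')"

text \<open>At a positive maximum of $w + \tau$ minus a paraboloid centred at $x_1$ the equation is violated as
  soon as the negative part $N$ has enough mass. The parameter $\varepsilon$ comes from cutting out a
  small ball around the maximum point, where the mass of $N$ is not seen.\<close>

lemma comparison:
  fixes s lam Lam beta k \<kappa> \<epsilon> :: real
  assumes s: "1/2 \<le> s" "s < 1" and k: "k = real DIM('a::euclidean_space) + 2 * s"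
    and lam: "0 < lam" "lam \<le> Lam" "0 \<le> beta"
    and \<kappa>: "0 < \<kappa>" "\<kappa> < 1" and \<epsilon>: "0 < \<epsilon>"
  shows "\<exists>A>0. \<forall>\<Omega> (w :: 'a \<Rightarrow> real) c r x1 e \<tau> P N H H'.
    comparison_setting lam Lam beta s k \<kappa> \<Omega> w e c r x1 \<tau> P N H H' \<longrightarrow>
    A * (tail k r c P + H * r powr (- 2 * s)) + e < lam * tail k r c N - \<epsilon> * H' * r powr (- 2 * s) \<longrightarrow>
    w x1 + \<tau> \<le> 0"
proof -
  from visc_touch[OF s k lam] obtain Cm where Cm: "0 < Cm" and touch: "\<forall>(w::'a \<Rightarrow> real) F D x0.
    visc_Mplus_ge lam Lam beta s w F D \<longrightarrow> open D \<longrightarrow> x0 \<in> D \<longrightarrow> w \<in> borel_measurable borel \<longrightarrow>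
    tail_integrable k 1 0 w \<longrightarrow> paraboloid_bound lam Lam s k Cm w (F x0) x0"
    by (elim exE conjE) (rule that)
  define V where "V = unit_ball_vol DIM('a)"
  have V: "0 < V" by (simp add: V_def)
  have n1: "1 \<le> DIM('a)" using DIM_positive[where 'a='a] by linarith
  have k0: "0 < k" using s k by simp
  have Lam: "0 < Lam" using lam by simp
  \<comment> \<open>Removing the ball of radius \<eta> r hides at most H' r^(-k) V (\<eta> r)^n of
    the mass of N; times \<open>lam\<close> this is at most \<epsilon> H' r^(-2s), because \<eta>^n
    <= \<eta>.\<close>
  define \<eta> where "\<eta> = min \<kappa> (\<epsilon> / (lam * V))"
  have \<eta>: "0 < \<eta>" "\<eta> \<le> \<kappa>" using \<kappa> \<epsilon> lam V by (auto simp: \<eta>_def)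
  then have "\<eta> < 1" using \<kappa> by linarith
  moreover have "lam * V * \<eta> \<le> lam * V * (\<epsilon> / (lam * V))"
    using lam V by (intro mult_left_mono) (auto simp: \<eta>_def)
  ultimately have \<eta>: "0 < \<eta>" "\<eta> \<le> \<kappa>" "\<eta> < 1" "lam * V * \<eta> \<le> \<epsilon>"
    using \<eta> lam V by auto
  have \<eta>n: "lam * V * \<eta> ^ DIM('a) \<le> \<epsilon>"
  proof -
    have "\<eta> ^ DIM('a) \<le> \<eta> ^ 1" using \<eta> n1 by (intro power_decreasing) auto
    then have "lam * V * \<eta> ^ DIM('a) \<le> lam * V * \<eta>" using lam V by (intro mult_left_mono) auto
    with \<eta>(4) show ?thesis by linarith
  qed
  \<comment> \<open>Cost of the paraboloid with Q = H/(\<kappa> r)^2 and touching radius \<eta> r,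
    where |x0 - x1|/\<rho> <= \<kappa>/\<eta>, in units of H r^(-2s).\<close>
  define A1 where "A1 = Cm * (1 + \<kappa> / \<eta>) / \<kappa>\<^sup>2 * \<eta> powr (2 - 2 * s)"
  define A where "A = Lam * (3 / \<eta>) powr k + A1"
  have A1: "0 < A1" unfolding A1_def using Cm \<kappa> \<eta> by (intro mult_pos_pos divide_pos_pos add_pos_pos) auto
  have A: "0 < A" "Lam * (3 / \<eta>) powr k \<le> A" "A1 \<le> A" unfolding A_def using A1 Lam \<eta>
    by (auto intro!: add_nonneg_pos)
  show ?thesis
  proof (intro exI[of _ A] conjI allI impI A(1))
    fix \<Omega> and w P N :: "'a \<Rightarrow> real" and c r x1 e \<tau> H H'
    assume setting: "comparison_setting lam Lam beta s k \<kappa> \<Omega> w e c r x1 \<tau> P N H H'"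
      and less: "A * (tail k r c P + H * r powr (- 2 * s)) + e < lam * tail k r c N - \<epsilon> * H' * r powr (- 2 * s)"
    have \<Omega>: "open \<Omega>" and cont: "continuous_on (ball 0 1) w"
      and wm: "w \<in> borel_measurable borel" and wi: "tail_integrable k 1 0 w"
      and visc: "visc_Mplus_ge lam Lam beta s w (\<lambda>_. - e) (ball 0 1 \<inter> \<Omega>)"
      and r: "0 < r" "r \<le> 1" and sub: "ball c (r/2) \<subseteq> ball 0 1"
      and sub1: "cball x1 (2 * \<kappa> * r) \<subseteq> ball c (r/2)"
      and dom: "\<forall>y\<in>cball x1 (\<kappa> * r). 0 < w y + \<tau> \<longrightarrow> y \<in> \<Omega>"
      and wPN: "\<forall>y. w y + \<tau> \<le> P y - N y" and PN: "\<forall>y. 0 \<le> P y \<and> 0 \<le> N y"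
      and Pm: "P \<in> borel_measurable borel" and Nm: "N \<in> borel_measurable borel"
      and Pi: "tail_integrable k r c P" and Ni: "tail_integrable k r c N"
      and HH: "\<forall>y\<in>ball c (r/2). P y \<le> H \<and> N y \<le> H'"
      using setting unfolding comparison_setting_def by blast+
    have H: "0 \<le> H" "0 \<le> H'" using HH[rule_format, of c] PN[rule_format, of c] r by auto
    have TP: "0 \<le> tail k r c P" unfolding tail_def using PN by (intro Bochner_Integration.integral_nonneg) auto
    define R where "R = \<kappa> * r"
    have R: "0 < R" "cball x1 (2 * R) \<subseteq> ball c (r/2)" using \<kappa> r sub1 by (simp_all add: R_def mult.assoc)
    have "cball x1 R \<subseteq> cball x1 (2 * R)" using R by auto
    then have Rsub: "cball x1 R \<subseteq> ball c (r/2)" using R by blast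
    define Q where "Q = H / R\<^sup>2"
    have Q: "0 \<le> Q" "Q * R\<^sup>2 = H" using H R by (auto simp: Q_def)
    show "w x1 + \<tau> \<le> 0"
    proof (rule ccontr)
      assume "\<not> w x1 + \<tau> \<le> 0"
      then have pos: "0 < w x1 + \<tau>" by simp
      have "continuous_on (cball x1 R) (\<lambda>y. w y - Q * (norm (y - x1))\<^sup>2)"
        by (intro continuous_intros continuous_on_subset[OF cont]) (use Rsub sub in blast)
      then obtain x0 where x0: "x0 \<in> cball x1 R"
        "\<And>y. y \<in> cball x1 R \<Longrightarrow> w y - Q * (norm (y - x1))\<^sup>2 \<le> w x0 - Q * (norm (x0 - x1))\<^sup>2"
        using continuous_attains_sup[of "cball x1 R" "\<lambda>y. w y - Q * (norm (y - x1))\<^sup>2"] R by auto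
      have max0: "0 < w x0 + \<tau> - Q * (norm (x0 - x1))\<^sup>2" using x0(2)[of x1] R pos by simp
      moreover have "0 \<le> Q * (norm (x0 - x1))\<^sup>2" using Q by simp
      ultimately have pos0: "0 < w x0 + \<tau>" by linarith
      have x0\<Omega>: "x0 \<in> ball 0 1 \<inter> \<Omega>" using dom x0(1) pos0 Rsub sub unfolding R_def by blast
      define \<rho> where "\<rho> = \<eta> * r"
      have \<rho>: "0 < \<rho>" "\<rho> \<le> R" "\<rho> < 1" "\<rho> \<le> r"
      proof -
        show "0 < \<rho>" "\<rho> \<le> R" using \<eta> r by (auto simp: \<rho>_def R_def)
        have "\<eta> * r < 1 * r" using \<eta> r by (intro mult_strict_right_mono) auto
        then show "\<rho> < 1" "\<rho> \<le> r" using r unfolding \<rho>_def by linarith+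
      qed
      have dx: "dist y x1 \<le> 2 * R" if "dist y x0 < \<rho>" for y
        using that \<rho> x0(1) dist_triangle[of y x1 x0] by (simp add: dist_commute)
      have nearsub: "ball x0 \<rho> \<subseteq> ball c (r/2)"
        using dx R(2) by (metis dist_commute mem_ball mem_cball subset_iff)
      have cx0: "dist c x0 \<le> r" using Rsub x0(1) r by (auto dest!: subsetD)
      have PiI: "outer_integrable k x0 \<rho> P"
        by (rule integrable_weight_compl[OF Pi]) (use k0 \<rho> r Pm in auto)
      have NiI: "outer_integrable k x0 \<rho> N"
        by (rule integrable_weight_compl[OF Ni]) (use k0 \<rho> r Nm in auto)
      have "- e \<le> Cm * (1 + norm (x0 - x1) / \<rho>) * Q * \<rho> powr (2 - 2 * s)
        + Lam * outer_tail k x0 \<rho> P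
        - lam * outer_tail k x0 \<rho> N"
      proof (rule paraboloid_boundD[OF touch[rule_format, OF visc _ x0\<Omega> wm wi] \<rho>(1) \<rho>(3) Q(1) _ _ _ PiI NiI])
        show "open (ball 0 1 \<inter> \<Omega>)" using \<Omega> by auto
        \<comment> \<open>The touching ball can leave the ball of radius R, though not that of
          radius 2R. Beyond R the paraboloid is at least Q R^2 = H, an upper bound for w + \<tau>,
          so the contact stays one-sided there.\<close>
        show "w y \<le> w x0 + Q * ((norm (y - x1))\<^sup>2 - (norm (x0 - x1))\<^sup>2)" if y: "dist y x0 < \<rho>" for y
        proof (cases "y \<in> cball x1 R")
          case True
          then show ?thesis using x0(2)[of y] by (simp add: algebra_simps)
        next
          case False
          have "y \<in> ball c (r/2)" using y nearsub by (auto simp: dist_commute)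
          then have "w y + \<tau> \<le> H" using wPN[rule_format, of y] PN[rule_format, of y] HH[rule_format, of y] by linarith
          also have "H = Q * R\<^sup>2" using Q by simp
          also have "\<dots> \<le> Q * (norm (y - x1))\<^sup>2"
            using False R Q by (intro mult_left_mono power_mono) (auto simp: dist_norm norm_minus_commute)
          finally show ?thesis using max0 by (simp add: algebra_simps)
        qed
        show "w y - w x0 \<le> P y - N y" for y using wPN[rule_format, of y] pos0 by linarith
        show "0 \<le> P y \<and> 0 \<le> N y" for y using PN by blast
      qed
      moreover have "outer_tail k x0 \<rho> P \<le> (3 / \<eta>) powr k * tail k r c P"
      proof (rule tail_compl_le[OF Pi _ _ _ PiI \<rho>(1)])
        have "(r + dist c x0 + \<rho>) / \<rho> \<le> (3 * r) / \<rho>" using cx0 \<rho> by (intro divide_right_mono) auto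
        then show "(r + dist c x0) / \<rho> + 1 \<le> 3 / \<eta>" using \<rho> r \<eta>(1) by (simp add: add_divide_distrib \<rho>_def)
      qed (use PN r k0 in auto)
      then have "Lam * outer_tail k x0 \<rho> P \<le> Lam * ((3 / \<eta>) powr k * tail k r c P)"
        using Lam by (intro mult_left_mono) auto
      moreover have "Lam * ((3 / \<eta>) powr k * tail k r c P) \<le> A * tail k r c P"
        using A TP by (simp add: mult.assoc[symmetric] mult_right_mono)
      moreover have "tail k r c N - H' * r powr (- k) * (V * \<rho> ^ DIM('a))
         \<le> outer_tail k x0 \<rho> N"
        unfolding V_def
        by (rule tail_compl_ge[OF Ni _ _ _ NiI \<rho>(1) cx0]) (use PN r k0 HH nearsub in auto)
      then have "lam * (tail k r c N - H' * r powr (- k) * (V * \<rho> ^ DIM('a)))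
         \<le> lam * outer_tail k x0 \<rho> N"
        using lam by (intro mult_left_mono) auto
      moreover have "lam * (H' * r powr (- k) * (V * \<rho> ^ DIM('a))) \<le> \<epsilon> * H' * r powr (- 2 * s)"
      proof -
        have "r powr (- k) * r ^ DIM('a) = r powr (- 2 * s)"
          using r by (simp add: k flip: powr_realpow powr_add)
        then have "lam * (H' * r powr (- k) * (V * \<rho> ^ DIM('a))) = (lam * V * \<eta> ^ DIM('a)) * (H' * r powr (- 2 * s))"
          by (simp add: \<rho>_def power_mult_distrib mult_ac)
        also have "\<dots> \<le> \<epsilon> * (H' * r powr (- 2 * s))" using \<eta>n H by (intro mult_right_mono) auto
        finally show ?thesis by simp
      qed
      moreover have "Cm * (1 + norm (x0 - x1) / \<rho>) * Q * \<rho> powr (2 - 2 * s) \<le> A * (H * r powr (- 2 * s))"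
      proof -
        have "norm (x0 - x1) / \<rho> \<le> R / \<rho>"
          using x0(1) \<rho> by (intro divide_right_mono) (auto simp: dist_norm norm_minus_commute)
        also have "\<dots> = \<kappa> / \<eta>" using r by (simp add: R_def \<rho>_def)
        finally have "Cm * (1 + norm (x0 - x1) / \<rho>) * Q * \<rho> powr (2 - 2 * s) \<le> Cm * (1 + \<kappa> / \<eta>) * Q * \<rho> powr (2 - 2 * s)"
          using Cm Q by (intro mult_right_mono mult_left_mono) auto
        also have "\<dots> = Cm * (1 + \<kappa> / \<eta>) * (H / (\<kappa>\<^sup>2 * r\<^sup>2)) * (\<eta> powr (2 - 2 * s) * (r\<^sup>2 * r powr (- 2 * s)))"
          using r \<eta> powr_add[of r 2 "- 2 * s"] by (simp add: Q_def R_def \<rho>_def power_mult_distrib powr_mult)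
        also have "\<dots> = A1 * (H * r powr (- 2 * s))" using r by (simp add: A1_def)
        also have "\<dots> \<le> A * (H * r powr (- 2 * s))" using A H by (intro mult_right_mono) auto
        finally show ?thesis .
      qed
      ultimately show False using less unfolding distrib_left right_diff_distrib by linarith
    qed
  qed
qed

subsection \<open>Solutions\<close>

text \<open>Tail of the constant 1, by splitting at radius r into a ball with bounded weight and the
  integrable pure kernel; needed for the constant level \<tau> in \<open>solves_inf\<close>.\<close>

lemma tail_const:
  assumes s: "1/2 \<le> s" "s < 1" and k: "k = real DIM('a::euclidean_space) + 2 * s"
  shows "\<exists>B>0. \<forall>r>0. \<forall>c::'a. integrable lborel (weight k r c) \<and> (\<integral>y. weight k r c y \<partial>lborel) \<le> B * r powr (- 2 * s)"
proof -
  obtain C where C: "0 < C" and C1: "\<And>\<rho>. 0 < \<rho> \<Longrightarrow> integrable lborel (\<lambda>y::'a. norm y powr (- k) * indicator (- ball 0 \<rho>) y)"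
     and C2: "\<And>\<rho>. 0 < \<rho> \<Longrightarrow> (\<integral>y. norm y powr (- k) * indicator (- ball 0 \<rho> :: 'a set) y \<partial>lborel) \<le> C * \<rho> powr (- 2 * s)"
    using compl_ball_powr_integral[OF s(1) k] by blast
  define V where "V = unit_ball_vol DIM('a)"
  have V: "0 < V" by (simp add: V_def)
  have "integrable lborel (weight k r c) \<and> (\<integral>y. weight k r c y \<partial>lborel) \<le> (V + C) * r powr (- 2 * s)"
    if r: "0 < r" for r and c :: 'a
  proof -
    define f where "f y = weight k 0 c y * indicator (- ball c r) y" for y
    have fm: "f \<in> borel_measurable borel" unfolding f_def[abs_def] by measurable
    have e: "f (c + y) = norm y powr (- k) * indicator (- ball 0 r) y" for y
      by (auto simp: f_def weight_def dist_norm indicator_def)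
    have fi: "integrable lborel f" using lborel_translate(1)[OF fm, of c] C1[OF r] by (simp add: e)
    have fI: "(\<integral>y. f y \<partial>lborel) \<le> C * r powr (- 2 * s)" using lborel_translate(2)[OF fm, of c] C2[OF r] by (simp add: e)
    define g where "g y = r powr (- k) * indicator (ball c r) y + f y" for y
    have gi: "integrable lborel g" unfolding g_def[abs_def]
      by (intro Bochner_Integration.integrable_add integrable_indicator_ball fi)
    have le: "weight k r c y \<le> g y" for y
    proof (cases "y \<in> ball c r")
      case True
      have "weight k r c y \<le> r powr (- k)" unfolding weight_def using r s k by (intro powr_mono2') auto
      then show ?thesis using True by (simp add: g_def f_def)
    next
      case False
      have "weight k r c y \<le> weight k 0 c y" unfolding weight_def using False r s k by (intro powr_mono2') (auto simp: dist_commute)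
      then show ?thesis using False by (simp add: g_def f_def)
    qed
    have Wi: "integrable lborel (weight k r c)"
    proof (rule Bochner_Integration.integrable_bound[OF gi])
      show "AE y in lborel. norm (weight k r c y) \<le> norm (g y)"
        using le by (intro AE_I2) (smt (verit) weight_nonneg real_norm_def)
    qed simp
    have "(\<integral>y. weight k r c y \<partial>lborel) \<le> (\<integral>y. g y \<partial>lborel)" by (intro integral_mono Wi gi le)
    also have "\<dots> = r powr (- k) * (V * r ^ DIM('a)) + (\<integral>y. f y \<partial>lborel)"
      unfolding g_def[abs_def]
      using r by (subst Bochner_Integration.integral_add[OF integrable_indicator_ball fi]) (simp add: measure_lborel_ball V_def)
    also have "r powr (- k) * (V * r ^ DIM('a)) = V * r powr (- 2 * s)"
      using r by (simp add: k flip: powr_realpow powr_add)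
    also have "V * r powr (- 2 * s) + (\<integral>y. f y \<partial>lborel) \<le> (V + C) * r powr (- 2 * s)"
      using fI by (simp add: algebra_simps)
    finally show ?thesis using Wi by simp
  qed
  moreover have "0 < V + C" using V C by simp
  ultimately show ?thesis by blast
qed

text \<open>The two viscosity clauses are M^+ u >= -e and M^- u <= e, the latter through M^- u =
  -M^+(-u).\<close>

definition solves ::
  "real \<Rightarrow> real \<Rightarrow> real \<Rightarrow> real \<Rightarrow> 'a::euclidean_space set \<Rightarrow> real \<Rightarrow> ('a \<Rightarrow> real) \<Rightarrow> bool" where
  "solves lam Lam beta s \<Omega> e u \<longleftrightarrow>
     open \<Omega> \<and> continuous_on (ball 0 1) u \<and> (\<forall>x. 0 \<le> u x) \<and> (\<forall>x\<in>ball 0 1 - \<Omega>. u x = 0) \<and>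
     u \<in> borel_measurable borel \<and> integrable lborel (\<lambda>y. u y * weight (real DIM('a) + 2 * s) 1 0 y) \<and> 0 \<le> e \<and>
     visc_Mplus_ge lam Lam beta s u (\<lambda>_. - e) (ball 0 1 \<inter> \<Omega>) \<and>
     visc_Mplus_ge lam Lam beta s (\<lambda>x. - u x) (\<lambda>_. - e) (ball 0 1 \<inter> \<Omega>)"

lemma solves_sup:
  assumes s: "1/2 \<le> s" "s < 1" and k: "k = real DIM('a::euclidean_space) + 2 * s"
    and lam: "0 < lam" "lam \<le> Lam" "0 \<le> beta"
  shows "\<exists>C>0. \<forall>\<Omega> (u :: 'a \<Rightarrow> real) (c :: 'a) r e.
    solves lam Lam beta s \<Omega> e u \<longrightarrow> 0 < r \<longrightarrow> r < 1 \<longrightarrow> cball c r \<subseteq> ball 0 1 \<longrightarrow> e \<le> tail k r c u \<longrightarrow>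
    (\<forall>x\<in>cball c (r/2). u x \<le> C * (r powr (2 * s) * tail k r c u))"
proof -
  from sup_bound[OF s k lam] obtain C where C: "0 < C" and sup: "\<forall>\<Omega> (u :: 'a \<Rightarrow> real) (c :: 'a) r e.
    open \<Omega> \<longrightarrow> continuous_on (ball 0 1) u \<longrightarrow> (\<forall>x. 0 \<le> u x) \<longrightarrow> (\<forall>x\<in>ball 0 1 - \<Omega>. u x = 0) \<longrightarrow>
    u \<in> borel_measurable borel \<longrightarrow> tail_integrable k 1 0 u \<longrightarrow>
    visc_Mplus_ge lam Lam beta s u (\<lambda>_. - e) (ball 0 1 \<inter> \<Omega>) \<longrightarrow> 0 \<le> e \<longrightarrow> 0 < r \<longrightarrow> r < 1 \<longrightarrow>
    cball c r \<subseteq> ball 0 1 \<longrightarrow> (\<forall>x\<in>cball c (r/2). u x \<le> C * r powr (2 * s) * (tail k r c u + e))"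
    by (elim exE conjE) (rule that)
  show ?thesis
  proof (intro exI[of _ "2 * C"] conjI allI impI ballI)
    fix \<Omega> and u :: "'a \<Rightarrow> real" and c r e x
    assume sol: "solves lam Lam beta s \<Omega> e u" and r: "0 < r" "r < 1" "cball c r \<subseteq> ball 0 1"
      and e: "e \<le> tail k r c u" and x: "x \<in> cball c (r/2)"
    have "u x \<le> C * r powr (2 * s) * (tail k r c u + e)"
      by (rule sup[rule_format, OF _ _ _ _ _ _ _ _ r x])
        (use sol in \<open>auto simp: solves_def k\<close>)
    also have "\<dots> \<le> C * r powr (2 * s) * (tail k r c u + tail k r c u)"
      using C e by (intro mult_left_mono) auto
    finally show "u x \<le> 2 * C * (r powr (2 * s) * tail k r c u)" by simp
  qed (use C in auto)
qed

text \<open>If u fell below the level \<tau> = c0 r^(2s) T, then \<tau> - u would be positive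
  somewhere inside \<Omega>. Comparison with P = \<tau> and N = u excludes this, as the whole mass
  of u stands on the negative side. A pointwise bound thus follows from a mass in one step, without
  a chain of balls.\<close>

lemma solves_inf:
  assumes s: "1/2 \<le> s" "s < 1" and k: "k = real DIM('a::euclidean_space) + 2 * s"
    and lam: "0 < lam" "lam \<le> Lam" "0 \<le> beta" and \<kappa>: "0 < \<kappa>" "\<kappa> < 1"
  shows "\<exists>c0>0. \<exists>\<gamma>>0. \<forall>\<Omega> (u :: 'a \<Rightarrow> real) (c :: 'a) r e z.
    solves lam Lam beta s \<Omega> e u \<longrightarrow> 0 < r \<longrightarrow> r < 1 \<longrightarrow> cball c r \<subseteq> ball 0 1 \<longrightarrow> e \<le> \<gamma> * tail k r c u \<longrightarrow>
    cball z (3 * \<kappa> * r) \<subseteq> \<Omega> \<inter> ball c (r/2) \<longrightarrow>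
    (\<forall>x\<in>cball z (\<kappa> * r). c0 * (r powr (2 * s) * tail k r c u) \<le> u x)"
proof -
  obtain C where C: "0 < C" and sup: "\<And>\<Omega> (u :: 'a \<Rightarrow> real) (c :: 'a) r e x.
    solves lam Lam beta s \<Omega> e u \<Longrightarrow> 0 < r \<Longrightarrow> r < 1 \<Longrightarrow> cball c r \<subseteq> ball 0 1 \<Longrightarrow> e \<le> tail k r c u \<Longrightarrow>
    x\<in>cball c (r/2) \<Longrightarrow> u x \<le> C * (r powr (2 * s) * tail k r c u)"
    using solves_sup[OF s k lam] by blast
  obtain B where B: "0 < B" "\<And>r c::'a. 0 < r \<Longrightarrow> integrable lborel (weight k r c)"
      "\<And>r c::'a. 0 < r \<Longrightarrow> (\<integral>y. weight k r c y \<partial>lborel) \<le> B * r powr (- 2 * s)"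
    using tail_const[OF s k] by blast
  \<comment> \<open>Of the available \<open>lam * T\<close>, the hidden mass takes 1/2 since H' = C
    r^(2s) T by the sup bound; \<open>c0\<close> and \<open>\<gamma>\<close> are chosen so that the
    level \<tau> and the error e take at most 1/8 each.\<close>
  define \<epsilon> where "\<epsilon> = lam / (2 * C)"
  have \<epsilon>: "0 < \<epsilon>" using lam C by (simp add: \<epsilon>_def)
  from comparison[OF s k lam \<kappa> \<epsilon>] obtain A where A: "0 < A" and comp: "\<forall>\<Omega> (w :: 'a \<Rightarrow> real) c r x1 e \<tau> P N H H'.
    comparison_setting lam Lam beta s k \<kappa> \<Omega> w e c r x1 \<tau> P N H H' \<longrightarrow>
    A * (tail k r c P + H * r powr (- 2 * s)) + e < lam * tail k r c N - \<epsilon> * H' * r powr (- 2 * s) \<longrightarrow>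
    w x1 + \<tau> \<le> 0"
    by (elim exE conjE) (rule that)
  define c0 where "c0 = lam / (8 * (A * (B + 1)))"
  have AB: "0 < A * (B + 1)" using A B by simp
  have "x * (lam / (8 * x)) = lam / 8" if "0 < x" for x using that by simp
  from this[OF AB] have c0: "0 < c0" "A * (B + 1) * c0 = lam / 8"
    using lam AB unfolding c0_def by (simp, simp only:)
  define \<gamma> where "\<gamma> = min 1 (lam / 8)"
  have \<gamma>: "0 < \<gamma>" "\<gamma> \<le> 1" "\<gamma> \<le> lam / 8" using lam by (auto simp: \<gamma>_def)
  have k0: "0 < k" using s k by simp
  show ?thesis
  proof (rule exI[of _ c0], rule conjI[OF c0(1)], intro exI[of _ \<gamma>] conjI allI impI ballI)
    fix \<Omega> and u :: "'a \<Rightarrow> real" and c r e z x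
    assume sol: "solves lam Lam beta s \<Omega> e u" and r: "0 < r" "r < 1" "cball c r \<subseteq> ball 0 1"
      and e: "e \<le> \<gamma> * tail k r c u" and z: "cball z (3 * \<kappa> * r) \<subseteq> \<Omega> \<inter> ball c (r/2)" and x: "x \<in> cball z (\<kappa> * r)"
    define T where "T = tail k r c u"
    have u0: "\<forall>y. 0 \<le> u y" and um: "u \<in> borel_measurable borel" and ui: "tail_integrable k 1 0 u"
      and uc: "continuous_on (ball 0 1) u" using sol by (auto simp: solves_def k)
    have T0: "0 \<le> T" unfolding T_def tail_def using u0 by (intro Bochner_Integration.integral_nonneg) auto
    have uW: "tail_integrable k r c u"
      by (rule integrable_weight[OF ui]) (use k0 r um in auto)
    show "c0 * (r powr (2 * s) * tail k r c u) \<le> u x"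
    proof (cases "T = 0")
      case False
      then have T: "0 < T" using T0 by simp
      define \<tau> where "\<tau> = c0 * (r powr (2 * s) * T)"
      have \<tau>: "0 \<le> \<tau>" using c0 T by (simp add: \<tau>_def)
      have "\<gamma> * T \<le> 1 * T" using \<gamma> T by (intro mult_right_mono) auto
      then have eT: "e \<le> tail k r c u" using e by (simp add: T_def)
      have xs: "cball x (2 * \<kappa> * r) \<subseteq> cball z (3 * \<kappa> * r)"
      proof
        fix y assume "y \<in> cball x (2 * \<kappa> * r)"
        then show "y \<in> cball z (3 * \<kappa> * r)" using x dist_triangle[of z y x] by simp
      qed
      have "- u x + \<tau> \<le> 0"
      proof (rule comp[rule_format, where P = "\<lambda>_. \<tau>" and N = u and H = \<tau> and H' = "C * (r powr (2 * s) * T)"],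
        unfold comparison_setting_def, intro conjI)
        show "open \<Omega>" "continuous_on (ball 0 1) (\<lambda>x. - u x)" "(\<lambda>x. - u x) \<in> borel_measurable borel"
          "tail_integrable k 1 0 (\<lambda>y. - u y)"
          "visc_Mplus_ge lam Lam beta s (\<lambda>x. - u x) (\<lambda>_. - e) (ball 0 1 \<inter> \<Omega>)"
          using sol by (auto simp: solves_def k intro: continuous_on_minus)
        show "0 < r" "r \<le> 1" "\<forall>y. - u y + \<tau> \<le> \<tau> - u y" "\<forall>y. 0 \<le> \<tau> \<and> 0 \<le> u y" using r u0 \<tau> by auto
        show "ball c (r/2) \<subseteq> ball 0 1" using r by (auto dest!: subsetD)
        show "cball x (2 * \<kappa> * r) \<subseteq> ball c (r/2)" using xs z by blast
        have "cball x (\<kappa> * r) \<subseteq> cball x (2 * \<kappa> * r)"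
          using mult_pos_pos[OF \<kappa>(1) r(1)] by (intro subset_cball) simp
        then show "\<forall>y\<in>cball x (\<kappa> * r). 0 < - u y + \<tau> \<longrightarrow> y \<in> \<Omega>" using xs z by blast
        show "(\<lambda>_. \<tau>) \<in> borel_measurable borel" "u \<in> borel_measurable borel" using um by auto
        show "tail_integrable k r c (\<lambda>y. \<tau>)" using B(2)[OF r(1), of c] by (intro integrable_mult_right)
        show "tail_integrable k r c u" by (rule uW)
        show "\<forall>y\<in>ball c (r/2). \<tau> \<le> \<tau> \<and> u y \<le> C * (r powr (2 * s) * T)"
          using sup[OF sol r eT] unfolding T_def by auto
        have rr: "r powr (2 * s) * r powr (- 2 * s) = 1" using r by (simp flip: powr_add)
        have "tail k r c (\<lambda>_. \<tau>) \<le> \<tau> * (B * r powr (- 2 * s))"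
          unfolding tail_def using B(3)[OF r(1), of c] \<tau> by (simp add: mult_left_mono)
        then have "A * (tail k r c (\<lambda>_. \<tau>) + \<tau> * r powr (- 2 * s)) \<le> A * (\<tau> * (B * r powr (- 2 * s)) + \<tau> * r powr (- 2 * s))"
          using A by (intro mult_left_mono) auto
        also have "\<dots> = (A * (B + 1) * c0) * T * (r powr (2 * s) * r powr (- 2 * s))" by (simp add: \<tau>_def algebra_simps)
        also have "\<dots> = lam / 8 * T" unfolding c0(2) rr by simp
        finally have 1: "A * (tail k r c (\<lambda>_. \<tau>) + \<tau> * r powr (- 2 * s)) \<le> lam / 8 * T" .
        have "\<gamma> * T \<le> lam / 8 * T" using \<gamma> T by (intro mult_right_mono) auto
        then have 2: "e \<le> lam / 8 * T" using e by (simp add: T_def)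
        have "\<epsilon> * (C * (r powr (2 * s) * T)) * r powr (- 2 * s) = \<epsilon> * C * T * (r powr (2 * s) * r powr (- 2 * s))"
          by (simp add: mult_ac)
        also have "\<dots> = lam / 2 * T" unfolding rr using C by (simp add: \<epsilon>_def)
        finally have 3: "\<epsilon> * (C * (r powr (2 * s) * T)) * r powr (- 2 * s) = lam / 2 * T" .
        have "0 < lam * T" using lam T by simp
        then show "A * (tail k r c (\<lambda>_. \<tau>) + \<tau> * r powr (- 2 * s)) + e
          < lam * tail k r c u - \<epsilon> * (C * (r powr (2 * s) * T)) * r powr (- 2 * s)"
          unfolding 3 T_def[symmetric] using 1 2 by linarith
      qed
      then show ?thesis by (simp add: \<tau>_def T_def)
    qed (use u0 in \<open>simp add: T_def\<close>)
  qed (use \<gamma> in auto)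
qed

text \<open>The lower bound on one interior ball already accounts for a fixed fraction \<mu> of T_r
  inside B_r(c). Passing from r to r/8 multiplies the weight there by at least 3/2 and decreases it
  nowhere, which yields the growth factor 1 + \<mu>/2.\<close>

lemma solves_mass:
  assumes s: "1/2 \<le> s" "s < 1" and k: "k = real DIM('a::euclidean_space) + 2 * s"
    and lam: "0 < lam" "lam \<le> Lam" "0 \<le> beta" and \<kappa>: "0 < \<kappa>" "\<kappa> < 1"
  shows "\<exists>\<mu>>0. \<exists>\<gamma>>0. \<forall>\<Omega> (u :: 'a \<Rightarrow> real) (c :: 'a) r e z.
    solves lam Lam beta s \<Omega> e u \<longrightarrow> 0 < r \<longrightarrow> r < 1 \<longrightarrow> cball c r \<subseteq> ball 0 1 \<longrightarrow> e \<le> \<gamma> * tail k r c u \<longrightarrow>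
    cball z (3 * \<kappa> * r) \<subseteq> \<Omega> \<inter> ball c (r/2) \<longrightarrow>
    \<mu> * tail k r c u \<le> (\<integral>y. u y * weight k r c y * indicator (ball c r) y \<partial>lborel) \<and>
    (1 + \<mu> / 2) * tail k r c u \<le> tail k (r / 8) c u"
proof -
  from solves_inf[OF s k lam \<kappa>] obtain c0 \<gamma> where c0: "0 < c0" "0 < \<gamma>" and inf:
   "\<forall>\<Omega> (u :: 'a \<Rightarrow> real) (c :: 'a) r e z.
    solves lam Lam beta s \<Omega> e u \<longrightarrow> 0 < r \<longrightarrow> r < 1 \<longrightarrow> cball c r \<subseteq> ball 0 1 \<longrightarrow> e \<le> \<gamma> * tail k r c u \<longrightarrow>
    cball z (3 * \<kappa> * r) \<subseteq> \<Omega> \<inter> ball c (r/2) \<longrightarrow>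
    (\<forall>x\<in>cball z (\<kappa> * r). c0 * (r powr (2 * s) * tail k r c u) \<le> u x)"
    by (elim exE conjE) (rule that)
  define V where "V = unit_ball_vol DIM('a)"
  have V: "0 < V" by (simp add: V_def)
  have n1: "1 \<le> real DIM('a)" using DIM_positive[where 'a='a] by linarith
  have k1: "1 \<le> k" using s k n1 by linarith
  \<comment> \<open>Value c0 r^(2s) T, times weight at least (2r)^(-k), times volume V (\<kappa>
    r)^n; the powers of r cancel as k = n + 2s.\<close>
  define \<mu> where "\<mu> = c0 * 2 powr (- k) * V * \<kappa> ^ DIM('a)"
  have \<mu>: "0 < \<mu>" using c0 V \<kappa> by (simp add: \<mu>_def)
  show ?thesis
  proof (rule exI[of _ \<mu>], rule conjI[OF \<mu>], rule exI[of _ \<gamma>], rule conjI[OF c0(2)], intro allI impI)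
    fix \<Omega> and u :: "'a \<Rightarrow> real" and c r e z
    assume sol: "solves lam Lam beta s \<Omega> e u" and r: "0 < r" "r < 1" "cball c r \<subseteq> ball 0 1"
      and e: "e \<le> \<gamma> * tail k r c u" and z: "cball z (3 * \<kappa> * r) \<subseteq> \<Omega> \<inter> ball c (r/2)"
    define T where "T = tail k r c u"
    have u0: "\<forall>y. 0 \<le> u y" and um [measurable]: "u \<in> borel_measurable borel" and ui: "tail_integrable k 1 0 u"
      using sol by (auto simp: solves_def k)
    have T0: "0 \<le> T" unfolding T_def tail_def using u0 by (intro Bochner_Integration.integral_nonneg) auto
    have uW: "tail_integrable k r' c u" if "0 < r'" for r'
      by (rule integrable_weight[OF ui]) (use k1 that um in auto)
    have uWi: "integrable lborel (\<lambda>y. u y * weight k r c y * indicator (ball c r) y)"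
      by (rule integrable_weight_mono[OF ui, of r]) (use k1 r in auto)
    define a where "a = c0 * (r powr (2 * s) * T) * (2 * r) powr (- k)"
    have "(\<integral>y. a * indicator (ball z (\<kappa> * r)) y \<partial>lborel) \<le> (\<integral>y. u y * weight k r c y * indicator (ball c r) y \<partial>lborel)"
    proof (rule integral_mono[OF integrable_indicator_ball uWi])
      fix y
      show "a * indicator (ball z (\<kappa> * r)) y \<le> u y * weight k r c y * indicator (ball c r) y"
      proof (cases "y \<in> ball z (\<kappa> * r)")
        case True
        have "cball z (\<kappa> * r) \<subseteq> cball z (3 * \<kappa> * r)"
          using mult_pos_pos[OF \<kappa>(1) r(1)] by (intro subset_cball) simp
        moreover have "y \<in> cball z (\<kappa> * r)" using True by simp
        ultimately have y: "y \<in> ball c (r/2)" using z by blast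
        have "(2 * r) powr (- k) \<le> weight k r c y"
          unfolding weight_def using y k1 r by (intro powr_mono2') (auto simp: dist_commute intro: add_pos_nonneg)
        moreover have "c0 * (r powr (2 * s) * T) \<le> u y"
          unfolding T_def using True by (intro inf[rule_format, OF sol r e z]) auto
        ultimately have "a \<le> u y * weight k r c y" unfolding a_def using u0 by (intro mult_mono) auto
        moreover have "y \<in> ball c r" using y r by simp
        ultimately show ?thesis using True by simp
      qed (use u0 in auto)
    qed
    also have "(\<integral>y. a * indicator (ball z (\<kappa> * r)) y \<partial>lborel) = a * (V * (\<kappa> * r) ^ DIM('a))"
      using \<kappa> r by (simp add: measure_lborel_ball V_def)
    also have "\<dots> = \<mu> * T"
    proof -
      have "r powr (2 * s) * r powr (- k) * r ^ DIM('a) = 1"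
        using r by (simp add: k flip: powr_realpow powr_add)
      moreover have "a * (V * (\<kappa> * r) ^ DIM('a)) = \<mu> * T * (r powr (2 * s) * r powr (- k) * r ^ DIM('a))"
        using r by (simp add: a_def \<mu>_def powr_mult power_mult_distrib mult_ac)
      ultimately show ?thesis by simp
    qed
    finally have mass: "\<mu> * T \<le> (\<integral>y. u y * weight k r c y * indicator (ball c r) y \<partial>lborel)" .
    have "(\<integral>y. u y * weight k r c y + 1 / 2 * (u y * weight k r c y * indicator (ball c r) y) \<partial>lborel) \<le> tail k (r / 8) c u"
      unfolding tail_def
    proof (rule integral_mono)
      show "integrable lborel (\<lambda>y. u y * weight k r c y + 1 / 2 * (u y * weight k r c y * indicator (ball c r) y))"
        by (intro Bochner_Integration.integrable_add integrable_mult_right uW uWi r)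
      show "tail_integrable k (r / 8) c u" by (rule uW) (use r in simp)
      fix y
      show "u y * weight k r c y + 1 / 2 * (u y * weight k r c y * indicator (ball c r) y) \<le> u y * weight k (r / 8) c y"
      proof (cases "y \<in> ball c r")
        case True
        \<comment> \<open>For |y - c| < r one has r/8 + |y - c| <= 2/3 (r + |y - c|); k >= 1 then
          removes the exponent.\<close>
        have "weight k r c y \<le> (2 / 3) powr k * weight k (r / 8) c y"
          by (rule weight_le) (use True r k1 in \<open>auto simp: dist_commute intro: add_pos_nonneg\<close>)
        also have "\<dots> \<le> (2 / 3) powr 1 * weight k (r / 8) c y"
          using k1 by (intro mult_right_mono powr_mono') auto
        finally have "3 / 2 * weight k r c y \<le> weight k (r / 8) c y" by simp
        then have "u y * (3 / 2 * weight k r c y) \<le> u y * weight k (r / 8) c y" using u0 by (intro mult_left_mono) auto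
        then show ?thesis using True by simp
      next
        case False
        have "weight k r c y \<le> weight k (r / 8) c y" by (rule weight_antimono) (use r k1 in auto)
        then show ?thesis using False u0 by (simp add: mult_left_mono)
      qed
    qed
    then have "T + 1 / 2 * (\<integral>y. u y * weight k r c y * indicator (ball c r) y \<partial>lborel) \<le> tail k (r / 8) c u"
      using uW[OF r(1)] uWi by (simp add: T_def tail_def)
    then show "\<mu> * tail k r c u \<le> (\<integral>y. u y * weight k r c y * indicator (ball c r) y \<partial>lborel) \<and>
      (1 + \<mu> / 2) * tail k r c u \<le> tail k (r / 8) c u"
      using mass unfolding T_def[symmetric] by (auto simp: algebra_simps)
  qed
qed

subsection \<open>Boundary Harnack inequality and oscillation decay\<close>

lemma integrable_weight_dominated:
  assumes "tail_integrable k r c g" "h \<in> borel_measurable borel" "\<And>y. \<bar>h y\<bar> \<le> \<bar>g y\<bar>"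
  shows "tail_integrable k r c h"
  by (rule Bochner_Integration.integrable_bound[OF assms(1)])
    (use assms in \<open>auto simp: abs_mult mult_right_mono\<close>)

text \<open>Meant for v = u2, \<omega> = M - m, and f either u1 - m u2 or M u2 - u1. The
  nonnegativity of f is local, so the size of its negative part outside the ball is a hypothesis of
  its own. The conclusion moves one end of the interval by \<theta> \<omega>.\<close>

definition gain_property where
  "gain_property lam Lam beta s k C \<mu> \<theta>0 \<epsilon> \<Omega> \<longleftrightarrow> (\<forall>(f :: 'a::euclidean_space \<Rightarrow> real) v c r e \<omega> \<theta>.
    open \<Omega> \<longrightarrow> continuous_on (ball 0 1) f \<longrightarrow> continuous_on (ball 0 1) v \<longrightarrow>
    f \<in> borel_measurable borel \<longrightarrow> v \<in> borel_measurable borel \<longrightarrow>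
    tail_integrable k 1 0 f \<longrightarrow> tail_integrable k 1 0 v \<longrightarrow>
    (\<forall>y. 0 \<le> v y) \<longrightarrow> (\<forall>x\<in>ball 0 1 - \<Omega>. f x = 0 \<and> v x = 0) \<longrightarrow> 0 \<le> \<theta> \<longrightarrow> \<theta> \<le> \<theta>0 \<longrightarrow>
    visc_Mplus_ge lam Lam beta s (\<lambda>x. \<theta> * \<omega> * v x - f x) (\<lambda>_. - e) (ball 0 1 \<inter> \<Omega>) \<longrightarrow>
    0 < r \<longrightarrow> r \<le> 1 \<longrightarrow> ball c r \<subseteq> ball 0 1 \<longrightarrow> (\<forall>y\<in>ball c r. 0 \<le> f y \<and> f y \<le> \<omega> * v y) \<longrightarrow>
    0 < \<omega> \<longrightarrow> 0 < tail k r c v \<longrightarrow> (\<forall>y\<in>ball c (r/2). v y \<le> C * (r powr (2 * s) * tail k r c v)) \<longrightarrow>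
    \<mu> * (\<omega> * tail k r c v) \<le> (\<integral>y. f y * weight k r c y * indicator (ball c r) y \<partial>lborel) \<longrightarrow>
    outer_tail k c r (\<lambda>y. max 0 (- f y)) \<le> \<epsilon> * (\<omega> * tail k r c v) \<longrightarrow>
    e \<le> \<epsilon> * (\<omega> * tail k r c v) \<longrightarrow>
    (\<forall>x\<in>cball c (r/8). \<theta> * \<omega> * v x \<le> f x))"

text \<open>Comparison for w = \<theta> \<omega> v - f: the local mass of f enters as N, while
  \<theta> \<omega> v and the outside negative part of f form P and are small by the choice of
  \<theta> and \<epsilon>.\<close>

lemma lower_bound_gain:
  fixes s lam Lam beta k C \<mu> :: real
  assumes s: "1/2 \<le> s" "s < 1" and k: "k = real DIM('a::euclidean_space) + 2 * s"
    and lam: "0 < lam" "lam \<le> Lam" "0 \<le> beta" and C: "0 < C" and \<mu>: "0 < \<mu>"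
  shows "\<exists>\<theta>0>0. \<exists>\<epsilon>>0.
    \<forall>\<Omega> :: 'a set. gain_property lam Lam beta s k C \<mu> \<theta>0 \<epsilon> \<Omega>"
proof -
  \<comment> \<open>The mass hypothesis provides lam \<mu> \<omega> T. One eighth is allotted to the
    mass hidden near the maximum, one eighth to the terms with \<theta> and one eighth to those with
    \<epsilon>, including the error e.\<close>
  define \<epsilon>' where "\<epsilon>' = lam * \<mu> / (8 * C)"
  have \<epsilon>': "0 < \<epsilon>'" using lam C \<mu> by (simp add: \<epsilon>'_def)
  have \<kappa>: "0 < (1/16::real)" "(1/16::real) < 1" by auto
  from comparison[OF s k lam \<kappa> \<epsilon>'] obtain A where A: "0 < A" and comp: "\<forall>\<Omega> (w :: 'a \<Rightarrow> real) c r x1 e \<tau> P N H H'.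
    comparison_setting lam Lam beta s k (1/16) \<Omega> w e c r x1 \<tau> P N H H' \<longrightarrow>
    A * (tail k r c P + H * r powr (- 2 * s)) + e < lam * tail k r c N - \<epsilon>' * H' * r powr (- 2 * s) \<longrightarrow>
    w x1 + \<tau> \<le> 0"
    by (elim exE conjE) (rule that)
  have A1C: "0 < A * (1 + C)" using A C by simp
  define \<theta>0 where "\<theta>0 = lam * \<mu> / 8 / (A * (1 + C))"
  define \<epsilon> where "\<epsilon> = lam * \<mu> / 8 / (A + 1)"
  have lm: "0 < lam * \<mu>" using lam \<mu> by simp
  have \<theta>0: "0 < \<theta>0" "\<theta>0 * (A * (1 + C)) = lam * \<mu> / 8"
    using lm A1C by (simp add: \<theta>0_def, metis \<theta>0_def nonzero_eq_divide_eq A1C less_irrefl)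
  have A1: "0 < A + 1" using A by simp
  have \<epsilon>: "0 < \<epsilon>" "\<epsilon> * (A + 1) = lam * \<mu> / 8"
    using lm A1 by (simp add: \<epsilon>_def, metis \<epsilon>_def nonzero_eq_divide_eq A1 less_irrefl)
  have k0: "0 < k" using s k by simp
  show ?thesis
    unfolding gain_property_def
  proof (rule exI[of _ \<theta>0], rule conjI[OF \<theta>0(1)], rule exI[of _ \<epsilon>], rule conjI[OF \<epsilon>(1)], intro allI impI ballI)
    fix \<Omega> and f v :: "'a \<Rightarrow> real" and c r e \<omega> \<theta> x
    assume \<Omega>: "open \<Omega>" and fc: "continuous_on (ball 0 1) f" and vc: "continuous_on (ball 0 1) v"
      and fm [measurable]: "f \<in> borel_measurable borel" and vm [measurable]: "v \<in> borel_measurable borel"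
      and fi: "tail_integrable k 1 0 f" and vi: "tail_integrable k 1 0 v"
      and v0: "\<forall>y. 0 \<le> v y" and fz: "\<forall>x\<in>ball 0 1 - \<Omega>. f x = 0 \<and> v x = 0"
      and \<theta>: "0 \<le> \<theta>" "\<theta> \<le> \<theta>0"
      and visc: "visc_Mplus_ge lam Lam beta s (\<lambda>x. \<theta> * \<omega> * v x - f x) (\<lambda>_. - e) (ball 0 1 \<inter> \<Omega>)"
      and r: "0 < r" "r \<le> 1" and sub: "ball c r \<subseteq> ball 0 1"
      and f0: "\<forall>y\<in>ball c r. 0 \<le> f y \<and> f y \<le> \<omega> * v y" and \<omega>: "0 < \<omega>" and T: "0 < tail k r c v"
      and vC: "\<forall>y\<in>ball c (r/2). v y \<le> C * (r powr (2 * s) * tail k r c v)"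
      and mass: "\<mu> * (\<omega> * tail k r c v) \<le> (\<integral>y. f y * weight k r c y * indicator (ball c r) y \<partial>lborel)"
      and tl: "outer_tail k c r (\<lambda>y. max 0 (- f y)) \<le> \<epsilon> * (\<omega> * tail k r c v)"
      and e: "e \<le> \<epsilon> * (\<omega> * tail k r c v)" and x: "x \<in> cball c (r/8)"
    define T where "T = tail k r c v"
    have T0: "0 < \<omega> * T" using T \<omega> by (simp add: T_def)
    define g where "g y = max 0 (- f y)" for y
    have gm [measurable]: "g \<in> borel_measurable borel" unfolding g_def[abs_def] by measurable
    have gi: "tail_integrable k 1 0 g"
      by (rule integrable_weight_dominated[OF fi gm]) (auto simp: g_def)
    define P where "P y = \<theta> * \<omega> * v y + g y * indicator (- ball c r) y" for y
    define N where "N y = f y * indicator (ball c r) y" for y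
    have vW: "tail_integrable k r c v"
      by (rule integrable_weight[OF vi]) (use k0 r in auto)
    have gW: "integrable lborel (\<lambda>y. g y * weight k r c y * indicator (- ball c r) y)"
      by (rule integrable_weight_mono[OF gi, of r]) (use k0 r in auto)
    have gW0: "outer_integrable k c r g"
      by (rule integrable_weight_compl[OF gi]) (use k0 r in auto)
    have NW: "integrable lborel (\<lambda>y. f y * weight k r c y * indicator (ball c r) y)"
      by (rule integrable_weight_mono[OF fi, of r]) (use k0 r in auto)
    have PW: "(\<lambda>y. P y * weight k r c y) = (\<lambda>y. \<theta> * \<omega> * (v y * weight k r c y) + g y * weight k r c y * indicator (- ball c r) y)"
      by (auto simp: P_def algebra_simps)
    have NWe: "(\<lambda>y. N y * weight k r c y) = (\<lambda>y. f y * weight k r c y * indicator (ball c r) y)"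
      by (auto simp: N_def)
    have tailP: "tail k r c P \<le> (\<theta> + \<epsilon>) * (\<omega> * T)"
    proof -
      have "(\<integral>y. g y * weight k r c y * indicator (- ball c r) y \<partial>lborel) \<le> outer_tail k c r g"
      proof (rule integral_mono[OF gW gW0])
        fix y
        show "g y * weight k r c y * indicator (- ball c r) y \<le> g y * weight k 0 c y * indicator (- ball c r) y"
        proof (cases "y \<in> ball c r")
          case False
          have "weight k r c y \<le> weight k 0 c y" unfolding weight_def using False r k0 by (intro powr_mono2') (auto simp: dist_commute)
          then show ?thesis using False by (simp add: g_def mult_left_mono)
        qed auto
      qed
      then have "tail k r c P \<le> \<theta> * \<omega> * T + \<epsilon> * (\<omega> * T)"
        unfolding tail_def[of _ _ _ P] PW using tl vW gW by (simp add: T_def tail_def g_def)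
      then show ?thesis by (simp add: algebra_simps)
    qed
    define D where "D = r powr (2 * s) * T"
    have D: "0 \<le> D" using T by (simp add: D_def T_def)
    have rr: "r powr (2 * s) * r powr (- 2 * s) = 1" using r by (simp flip: powr_add)
    have Dr: "D * r powr (- 2 * s) = T"
    proof -
      have "D * r powr (- 2 * s) = T * (r powr (2 * s) * r powr (- 2 * s))" unfolding D_def by (simp only: mult_ac)
      then show ?thesis unfolding rr by simp
    qed
    have "(\<theta> * \<omega> * v x - f x) + 0 \<le> 0"
    proof (rule comp[rule_format, where P = P and N = N and H = "\<theta> * \<omega> * (C * D)" and H' = "\<omega> * (C * D)"],
        unfold comparison_setting_def, intro conjI)
      show "open \<Omega>" by (rule \<Omega>)
      show "continuous_on (ball 0 1) (\<lambda>x. \<theta> * \<omega> * v x - f x)" by (intro continuous_intros fc vc)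
      show "(\<lambda>x. \<theta> * \<omega> * v x - f x) \<in> borel_measurable borel" by measurable
      have "integrable lborel (\<lambda>y. \<theta> * \<omega> * (v y * weight k 1 0 y) - f y * weight k 1 0 y)"
        by (intro Bochner_Integration.integrable_diff integrable_mult_right fi vi)
      then show "tail_integrable k 1 0 (\<lambda>y. \<theta> * \<omega> * v y - f y)" by (simp add: algebra_simps)
      show "visc_Mplus_ge lam Lam beta s (\<lambda>x. \<theta> * \<omega> * v x - f x) (\<lambda>_. - e) (ball 0 1 \<inter> \<Omega>)" by (rule visc)
      show "0 < r" "r \<le> 1" using r by auto
      have rsub: "ball c (r/2) \<subseteq> ball c r" using r by (intro subset_ball) auto
      then show "ball c (r/2) \<subseteq> ball 0 1" using sub by blast
      show xsub: "cball x (2 * (1/16) * r) \<subseteq> ball c (r/2)"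
      proof
        fix y assume "y \<in> cball x (2 * (1/16) * r)"
        then show "y \<in> ball c (r/2)" using x r dist_triangle[of c y x] by simp
      qed
      have "cball x (1/16 * r) \<subseteq> cball x (2 * (1/16) * r)" using r by (intro subset_cball) auto
      then show "\<forall>y\<in>cball x (1/16 * r). 0 < \<theta> * \<omega> * v y - f y + 0 \<longrightarrow> y \<in> \<Omega>"
        using xsub rsub sub fz by (metis (no_types, lifting) Diff_iff add.right_neutral diff_self less_irrefl mult_zero_right subset_iff)
      show "\<forall>y. \<theta> * \<omega> * v y - f y + 0 \<le> P y - N y" by (auto simp: P_def N_def g_def indicator_def)
      show "\<forall>y. 0 \<le> P y \<and> 0 \<le> N y" using \<theta> \<omega> v0 f0 by (auto simp: P_def N_def g_def indicator_def)
      show "P \<in> borel_measurable borel" "N \<in> borel_measurable borel"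
        unfolding P_def[abs_def] N_def[abs_def] by measurable
      show "tail_integrable k r c P" unfolding PW
        by (intro Bochner_Integration.integrable_add integrable_mult_right vW gW)
      show "tail_integrable k r c N" unfolding NWe by (rule NW)
      show "\<forall>y\<in>ball c (r/2). P y \<le> \<theta> * \<omega> * (C * D) \<and> N y \<le> \<omega> * (C * D)"
      proof
        fix y assume y: "y \<in> ball c (r/2)"
        then have y': "y \<in> ball c r" using rsub by blast
        have vy: "v y \<le> C * D" using vC y by (simp add: D_def T_def)
        have "\<theta> * \<omega> * v y \<le> \<theta> * \<omega> * (C * D)" using vy \<theta> \<omega> by (intro mult_left_mono) auto
        moreover have "\<omega> * v y \<le> \<omega> * (C * D)" using vy \<omega> by (intro mult_left_mono) auto
        ultimately show "P y \<le> \<theta> * \<omega> * (C * D) \<and> N y \<le> \<omega> * (C * D)"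
          using f0 y' by (fastforce simp: P_def N_def)
      qed
      have "A * (tail k r c P + \<theta> * \<omega> * (C * D) * r powr (- 2 * s))
         = A * (tail k r c P + \<theta> * \<omega> * C * (D * r powr (- 2 * s)))" by (simp only: mult_ac)
      also have "\<dots> \<le> A * ((\<theta> + \<epsilon>) * (\<omega> * T) + \<theta> * \<omega> * C * T)"
        unfolding Dr using tailP A by (intro mult_left_mono) auto
      also have "\<dots> = (\<theta> * (A * (1 + C)) + A * \<epsilon>) * (\<omega> * T)" by (simp add: algebra_simps)
      finally have "A * (tail k r c P + \<theta> * \<omega> * (C * D) * r powr (- 2 * s)) + e
        \<le> (\<theta> * (A * (1 + C)) + A * \<epsilon>) * (\<omega> * T) + \<epsilon> * (\<omega> * T)" using e by (simp add: T_def)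
      also have "\<dots> = (\<theta> * (A * (1 + C)) + \<epsilon> * (A + 1)) * (\<omega> * T)" by (simp add: algebra_simps)
      also have "\<dots> \<le> (\<theta>0 * (A * (1 + C)) + \<epsilon> * (A + 1)) * (\<omega> * T)"
        using \<theta> A A1C T0 \<epsilon>(1) by (intro mult_right_mono add_mono) auto
      also have "\<dots> = lam * \<mu> / 4 * (\<omega> * T)" unfolding \<theta>0 \<epsilon> by simp
      finally have 1: "A * (tail k r c P + \<theta> * \<omega> * (C * D) * r powr (- 2 * s)) + e \<le> lam * \<mu> / 4 * (\<omega> * T)" .
      have "\<mu> * (\<omega> * T) \<le> tail k r c N" using mass unfolding tail_def[of _ _ _ N] NWe by (simp add: T_def)
      then have "lam * (\<mu> * (\<omega> * T)) \<le> lam * tail k r c N" using lam by (intro mult_left_mono) auto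
      then have 2: "lam * \<mu> * (\<omega> * T) \<le> lam * tail k r c N" by (simp only: mult.assoc)
      have "\<epsilon>' * (\<omega> * (C * D)) * r powr (- 2 * s) = \<epsilon>' * C * \<omega> * (D * r powr (- 2 * s))"
        by (simp only: mult_ac)
      also have "\<dots> = lam * \<mu> * (\<omega> * T) / 8" unfolding Dr using C by (simp add: \<epsilon>'_def)
      finally have 3: "\<epsilon>' * (\<omega> * (C * D)) * r powr (- 2 * s) = lam * \<mu> * (\<omega> * T) / 8" .
      have "0 < lam * \<mu> * (\<omega> * T)" using lm T0 by simp
      moreover have "A * (tail k r c P + \<theta> * \<omega> * (C * D) * r powr (- 2 * s)) + e \<le> lam * \<mu> * (\<omega> * T) / 4"
        using 1 by simp
      ultimately show "A * (tail k r c P + \<theta> * \<omega> * (C * D) * r powr (- 2 * s)) + e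
        < lam * tail k r c N - \<epsilon>' * (\<omega> * (C * D)) * r powr (- 2 * s)" using 2 3 by linarith
    qed
    then show "\<theta> * \<omega> * v x \<le> f x" by simp
  qed
qed

text \<open>Comparison for u1 - C0 u2 with P = u1 and N = C0 u2: for large C0 the mass of C0 u2
  outweighs that of u1, since their tails at this one scale are comparable. No barrier or boundary
  geometry enters. Allowing every C0 above \<open>Cm\<close> leaves room to enlarge C0
  later.\<close>

lemma boundary_harnack:
  fixes s lam Lam beta k C t :: real
  assumes s: "1/2 \<le> s" "s < 1" and k: "k = real DIM('a::euclidean_space) + 2 * s"
    and lam: "0 < lam" "lam \<le> Lam" "0 \<le> beta" and C: "0 < C" and t: "0 < t"
  shows "\<exists>Cm>0. \<forall>C0\<ge>Cm. \<forall>\<Omega> (u1 :: 'a \<Rightarrow> real) u2 c r e e1.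
    solves lam Lam beta s \<Omega> e1 u1 \<longrightarrow> solves lam Lam beta s \<Omega> e1 u2 \<longrightarrow>
    visc_Mplus_ge lam Lam beta s (\<lambda>x. u1 x - C0 * u2 x) (\<lambda>_. - e) (ball 0 1 \<inter> \<Omega>) \<longrightarrow>
    0 < r \<longrightarrow> r \<le> 1 \<longrightarrow> ball c r \<subseteq> ball 0 1 \<longrightarrow>
    (\<forall>y\<in>ball c (r/2). u1 y \<le> C * (r powr (2 * s) * tail k r c u1)) \<longrightarrow>
    (\<forall>y\<in>ball c (r/2). u2 y \<le> C * (r powr (2 * s) * tail k r c u2)) \<longrightarrow>
    0 < tail k r c u2 \<longrightarrow> tail k r c u1 \<le> t * tail k r c u2 \<longrightarrow> e \<le> lam / 4 * (C0 * tail k r c u2) \<longrightarrow>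
    (\<forall>x\<in>cball c (r/8). u1 x \<le> C0 * u2 x)"
proof -
  define \<epsilon>' where "\<epsilon>' = lam / (2 * C)"
  have \<epsilon>': "0 < \<epsilon>'" using lam C by (simp add: \<epsilon>'_def)
  have \<kappa>: "0 < (1/16::real)" "(1/16::real) < 1" by auto
  from comparison[OF s k lam \<kappa> \<epsilon>'] obtain A where A: "0 < A" and comp: "\<forall>\<Omega> (w :: 'a \<Rightarrow> real) c r x1 e \<tau> P N H H'.
    comparison_setting lam Lam beta s k (1/16) \<Omega> w e c r x1 \<tau> P N H H' \<longrightarrow>
    A * (tail k r c P + H * r powr (- 2 * s)) + e < lam * tail k r c N - \<epsilon>' * H' * r powr (- 2 * s) \<longrightarrow>
    w x1 + \<tau> \<le> 0"
    by (elim exE conjE) (rule that)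
  \<comment> \<open>With T(u1) <= t T(u2) the terms of P cost A (1 + C) t T(u2), which is thereby at
    most one eighth of lam C0 T(u2); the hidden mass takes one half and e one quarter.\<close>
  define Cm where "Cm = 8 * (A * (1 + C) * t) / lam"
  have Cm: "0 < Cm" using A C t lam by (simp add: Cm_def)
  have k0: "0 < k" using s k by simp
  show ?thesis
  proof (rule exI[of _ Cm], rule conjI[OF Cm], intro allI impI ballI)
    fix C0 \<Omega> and u1 u2 :: "'a \<Rightarrow> real" and c r e e1 x
    assume C0: "Cm \<le> C0" and sol1: "solves lam Lam beta s \<Omega> e1 u1" and sol2: "solves lam Lam beta s \<Omega> e1 u2"
      and visc: "visc_Mplus_ge lam Lam beta s (\<lambda>x. u1 x - C0 * u2 x) (\<lambda>_. - e) (ball 0 1 \<inter> \<Omega>)"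
      and r: "0 < r" "r \<le> 1" and sub: "ball c r \<subseteq> ball 0 1"
      and uC1: "\<forall>y\<in>ball c (r/2). u1 y \<le> C * (r powr (2 * s) * tail k r c u1)"
      and uC2: "\<forall>y\<in>ball c (r/2). u2 y \<le> C * (r powr (2 * s) * tail k r c u2)"
      and T: "0 < tail k r c u2" and tt: "tail k r c u1 \<le> t * tail k r c u2"
      and e: "e \<le> lam / 4 * (C0 * tail k r c u2)" and x: "x \<in> cball c (r/8)"
    define T1 T2 where "T1 = tail k r c u1" and "T2 = tail k r c u2"
    have C00: "0 < C0" using C0 Cm by linarith
    have facts: "open \<Omega>" "continuous_on (ball 0 1) u1" "continuous_on (ball 0 1) u2"
      "\<forall>y. 0 \<le> u1 y" "\<forall>y. 0 \<le> u2 y" "\<forall>x\<in>ball 0 1 - \<Omega>. u1 x = 0" "\<forall>x\<in>ball 0 1 - \<Omega>. u2 x = 0"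
      "tail_integrable k 1 0 u1" "tail_integrable k 1 0 u2"
      and [measurable]: "u1 \<in> borel_measurable borel" "u2 \<in> borel_measurable borel"
      using sol1 sol2 unfolding solves_def k by blast+
    have uW: "tail_integrable k r c u1" "tail_integrable k r c u2"
      using integrable_weight[OF facts(8)] integrable_weight[OF facts(9)] k0 r by auto
    have rr: "r powr (2 * s) * r powr (- 2 * s) = 1" using r by (simp flip: powr_add)
    have "(u1 x - C0 * u2 x) + 0 \<le> 0"
    proof (rule comp[rule_format, where P = u1 and N = "\<lambda>y. C0 * u2 y" and H = "C * (r powr (2 * s) * T1)"
          and H' = "C0 * (C * (r powr (2 * s) * T2))"],
        unfold comparison_setting_def, intro conjI)
      show "open \<Omega>" by (rule facts)
      show "continuous_on (ball 0 1) (\<lambda>x. u1 x - C0 * u2 x)" by (intro continuous_intros facts)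
      show "(\<lambda>x. u1 x - C0 * u2 x) \<in> borel_measurable borel" by measurable
      have "integrable lborel (\<lambda>y. u1 y * weight k 1 0 y - C0 * (u2 y * weight k 1 0 y))"
        by (intro Bochner_Integration.integrable_diff integrable_mult_right facts)
      then show "tail_integrable k 1 0 (\<lambda>y. u1 y - C0 * u2 y)" by (simp add: algebra_simps)
      show "visc_Mplus_ge lam Lam beta s (\<lambda>x. u1 x - C0 * u2 x) (\<lambda>_. - e) (ball 0 1 \<inter> \<Omega>)" by (rule visc)
      show "0 < r" "r \<le> 1" using r by auto
      have rsub: "ball c (r/2) \<subseteq> ball c r" using r by (intro subset_ball) auto
      then show "ball c (r/2) \<subseteq> ball 0 1" using sub by blast
      show xsub: "cball x (2 * (1/16) * r) \<subseteq> ball c (r/2)"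
      proof
        fix y assume "y \<in> cball x (2 * (1/16) * r)"
        then show "y \<in> ball c (r/2)" using x r dist_triangle[of c y x] by simp
      qed
      have "cball x (1/16 * r) \<subseteq> cball x (2 * (1/16) * r)" using r by (intro subset_cball) auto
      then show "\<forall>y\<in>cball x (1/16 * r). 0 < u1 y - C0 * u2 y + 0 \<longrightarrow> y \<in> \<Omega>"
        using xsub rsub sub facts(6,7) by (metis (no_types, lifting) Diff_iff add.right_neutral diff_self less_irrefl mult_zero_right subset_iff)
      show "\<forall>y. u1 y - C0 * u2 y + 0 \<le> u1 y - C0 * u2 y" by simp
      show "\<forall>y. 0 \<le> u1 y \<and> 0 \<le> C0 * u2 y" using facts C00 by auto
      show "u1 \<in> borel_measurable borel" "(\<lambda>y. C0 * u2 y) \<in> borel_measurable borel" by measurable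
      show "tail_integrable k r c u1" by (rule uW)
      show "tail_integrable k r c (\<lambda>y. C0 * u2 y)" using uW(2) by (simp add: mult.assoc)
      show "\<forall>y\<in>ball c (r/2). u1 y \<le> C * (r powr (2 * s) * T1) \<and> C0 * u2 y \<le> C0 * (C * (r powr (2 * s) * T2))"
        using uC1 uC2 C00 by (auto simp: T1_def T2_def)
      have "A * (T1 + C * (r powr (2 * s) * T1) * r powr (- 2 * s))
        = A * (T1 + C * T1 * (r powr (2 * s) * r powr (- 2 * s)))" by (simp only: mult_ac)
      also have "\<dots> = A * (1 + C) * T1" unfolding rr by (simp add: algebra_simps)
      also have "\<dots> \<le> A * (1 + C) * (t * T2)"
        using tt A C by (intro mult_left_mono) (auto simp: T1_def T2_def)
      also have "\<dots> = lam / 8 * (Cm * T2)" using lam by (simp add: Cm_def)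
      also have "\<dots> \<le> lam / 8 * (C0 * T2)" using lam C0 T by (intro mult_left_mono mult_right_mono) (auto simp: T2_def)
      finally have 1: "A * (T1 + C * (r powr (2 * s) * T1) * r powr (- 2 * s)) \<le> lam / 8 * (C0 * T2)" .
      have tN: "tail k r c (\<lambda>y. C0 * u2 y) = C0 * T2" by (simp add: tail_def T2_def mult.assoc)
      have "\<epsilon>' * (C0 * (C * (r powr (2 * s) * T2))) * r powr (- 2 * s)
        = \<epsilon>' * C * C0 * T2 * (r powr (2 * s) * r powr (- 2 * s))" by (simp only: mult_ac)
      also have "\<dots> = lam / 2 * (C0 * T2)" unfolding rr using C by (simp add: \<epsilon>'_def)
      finally have 2: "\<epsilon>' * (C0 * (C * (r powr (2 * s) * T2))) * r powr (- 2 * s) = lam / 2 * (C0 * T2)" .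
      have "0 < lam * (C0 * T2)" using lam C00 T by (simp add: T2_def)
      then show "A * (tail k r c u1 + C * (r powr (2 * s) * T1) * r powr (- 2 * s)) + e
        < lam * tail k r c (\<lambda>y. C0 * u2 y) - \<epsilon>' * (C0 * (C * (r powr (2 * s) * T2))) * r powr (- 2 * s)"
        unfolding tN 2 using 1 e unfolding T1_def T2_def by linarith
    qed
    then show "u1 x \<le> C0 * u2 x" by simp
  qed
qed

text \<open>Passing from one scale to the next: the kernel $|y - c|^{-k}$, unlike the truncated weights, does
  not change with the scale, so the old tail is carried over without loss.\<close>

lemma tail_step:
  fixes h h' v :: "'a::euclidean_space \<Rightarrow> real"
  assumes hi: "tail_integrable k 1 0 h" and hi': "tail_integrable k 1 0 h'"
    and vi: "tail_integrable k 1 0 v"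
    and [measurable]: "h \<in> borel_measurable borel" "h' \<in> borel_measurable borel" "v \<in> borel_measurable borel"
    and v0: "\<And>y. 0 \<le> v y" and a: "0 \<le> a" and le: "\<And>y. h' y \<le> h y + a * v y"
    and h0: "\<And>y. y \<in> ball c r \<Longrightarrow> h y \<le> 0" and r: "0 < r" "0 < r'" and k: "0 \<le> k"
  shows "outer_tail k c r' (\<lambda>y. max 0 (h' y))
     \<le> outer_tail k c r (\<lambda>y. max 0 (h y)) + a * (2 powr k * tail k r' c v)"
proof -
  have maxi: "outer_integrable k c \<rho> (\<lambda>y. max 0 (g y))"
    if "tail_integrable k 1 0 g" "g \<in> borel_measurable borel" "0 < \<rho>" for g \<rho>
  proof (rule integrable_weight_compl[where r = 1 and c = 0])
    show "tail_integrable k 1 0 (\<lambda>y. max 0 (g y))"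
      by (rule integrable_weight_dominated[OF that(1)]) (use that in auto)
  qed (use that k in auto)
  note i' = maxi[OF hi' _ r(2)] and i = maxi[OF hi _ r(1)]
  have vc: "outer_integrable k c r' v"
    by (rule integrable_weight_compl[OF vi]) (use k r in auto)
  have vW: "tail_integrable k r' c v"
    by (rule integrable_weight[OF vi]) (use k r in auto)
  have "outer_tail k c r' (\<lambda>y. max 0 (h' y))
     \<le> (\<integral>y. max 0 (h y) * weight k 0 c y * indicator (- ball c r) y + a * (v y * weight k 0 c y * indicator (- ball c r') y) \<partial>lborel)"
  proof (rule integral_mono)
    show "outer_integrable k c r' (\<lambda>y. max 0 (h' y))" by (rule i') simp
    show "integrable lborel (\<lambda>y. max 0 (h y) * weight k 0 c y * indicator (- ball c r) y + a * (v y * weight k 0 c y * indicator (- ball c r') y))"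
      by (intro Bochner_Integration.integrable_add integrable_mult_right i vc) simp
    fix y
    have av: "0 \<le> a * v y" using a v0 by simp
    show "max 0 (h' y) * weight k 0 c y * indicator (- ball c r') y
        \<le> max 0 (h y) * weight k 0 c y * indicator (- ball c r) y + a * (v y * weight k 0 c y * indicator (- ball c r') y)"
    proof (cases "y \<in> ball c r'")
      case False
      \<comment> \<open>In the old ball h <= 0, so the new positive part there is at most a v;
        outside it the old positive part is kept.\<close>
      have "max 0 (h' y) \<le> max 0 (h y) * indicator (- ball c r) y + a * v y"
        using le[of y] h0[of y] av by (cases "y \<in> ball c r") auto
      then have "max 0 (h' y) * weight k 0 c y \<le> (max 0 (h y) * indicator (- ball c r) y + a * v y) * weight k 0 c y"
        by (intro mult_right_mono) auto
      then show ?thesis using False by (simp add: algebra_simps)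
    qed (use a v0 in auto)
  qed
  also have "\<dots> = outer_tail k c r (\<lambda>y. max 0 (h y))
      + a * outer_tail k c r' v"
    using i vc by simp
  also have "outer_tail k c r' v \<le> 2 powr k * tail k r' c v"
    by (rule tail_compl_le[OF vW v0 r(2) k vc r(2)]) (use r in simp)
  finally show ?thesis using a by (simp add: mult_left_mono)
qed

definition solves_pair ::
  "real \<Rightarrow> real \<Rightarrow> real \<Rightarrow> real \<Rightarrow> 'a::euclidean_space set \<Rightarrow> real \<Rightarrow> ('a \<Rightarrow> real) \<Rightarrow> ('a \<Rightarrow> real) \<Rightarrow> bool" where
  "solves_pair lam Lam beta s \<Omega> \<delta> u1 u2 \<longleftrightarrow>
     solves lam Lam beta s \<Omega> \<delta> u1 \<and> solves lam Lam beta s \<Omega> \<delta> u2 \<and>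
     (\<forall>a b. visc_Mplus_ge lam Lam beta s (\<lambda>x. a * u1 x + b * u2 x) (\<lambda>_. - (\<delta> * (\<bar>a\<bar> + \<bar>b\<bar>))) (ball 0 1 \<inter> \<Omega>))"

text \<open>Both $u_1 - m u_2$ and $M u_2 - u_1$ are nonnegative on the current ball but not outside it; the
  invariant \<open>I\<close> in the proof therefore also keeps their negative tails small compared with
  $(M - m)\, T_i$, where $T_i$ is the tail of $u_2$. One of the two functions carries half of the local
  mass of $u_2$, which improves $m$ or $M$. The factor $G > 1$ by which $T_i$ grows absorbs both the loss in
  the tails and, through $q G \ge 1$, the fixed right-hand side $\delta$.\<close>

lemma oscillation:
  fixes s lam Lam beta k \<kappa> t0 t1 :: real
  assumes s: "1/2 \<le> s" "s < 1" and k: "k = real DIM('a::euclidean_space) + 2 * s"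
    and lam: "0 < lam" "lam \<le> Lam" "0 \<le> beta" and \<kappa>: "0 < \<kappa>" "\<kappa> < 1" and t: "0 < t0" "t0 \<le> t1"
  shows "\<exists>\<delta>>0. \<exists>C0>0. \<exists>q>1/8. q < 1 \<and> (\<forall>\<Omega> (u1 :: 'a \<Rightarrow> real) u2 c R.
    solves_pair lam Lam beta s \<Omega> \<delta> u1 u2 \<longrightarrow> 0 < R \<longrightarrow> R < 1 \<longrightarrow> cball c R \<subseteq> ball 0 1 \<longrightarrow>
    (\<forall>r. 0 < r \<and> r \<le> R \<longrightarrow> (\<exists>z. cball z (3 * \<kappa> * r) \<subseteq> \<Omega> \<inter> ball c (r/2))) \<longrightarrow>
    t0 \<le> tail k R c u1 \<longrightarrow> tail k R c u1 \<le> t1 \<longrightarrow> t0 \<le> tail k R c u2 \<longrightarrow>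
    (\<forall>j. \<exists>m M. 0 \<le> m \<and> M \<le> C0 \<and> M - m = C0 * q ^ j \<and>
       (\<forall>y\<in>ball c (R / 8 ^ Suc j). m * u2 y \<le> u1 y \<and> u1 y \<le> M * u2 y)))"
proof -
  from solves_sup[OF s k lam] obtain C where C: "0 < C" and sup: "\<forall>\<Omega> (u :: 'a \<Rightarrow> real) (c :: 'a) r e.
    solves lam Lam beta s \<Omega> e u \<longrightarrow> 0 < r \<longrightarrow> r < 1 \<longrightarrow> cball c r \<subseteq> ball 0 1 \<longrightarrow> e \<le> tail k r c u \<longrightarrow>
    (\<forall>x\<in>cball c (r/2). u x \<le> C * (r powr (2 * s) * tail k r c u))"
    by (elim exE conjE) (rule that)
  from solves_mass[OF s k lam \<kappa>] obtain \<mu> \<gamma> where \<mu>: "0 < \<mu>" and \<gamma>: "0 < \<gamma>"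
    and mass: "\<forall>\<Omega> (u :: 'a \<Rightarrow> real) (c :: 'a) r e z.
    solves lam Lam beta s \<Omega> e u \<longrightarrow> 0 < r \<longrightarrow> r < 1 \<longrightarrow> cball c r \<subseteq> ball 0 1 \<longrightarrow> e \<le> \<gamma> * tail k r c u \<longrightarrow>
    cball z (3 * \<kappa> * r) \<subseteq> \<Omega> \<inter> ball c (r/2) \<longrightarrow>
    \<mu> * tail k r c u \<le> (\<integral>y. u y * weight k r c y * indicator (ball c r) y \<partial>lborel) \<and>
    (1 + \<mu> / 2) * tail k r c u \<le> tail k (r / 8) c u"
    by (elim exE conjE) (rule that)
  \<comment> \<open>The gain is set up for \<mu>/2 because only one of u1 - m u2 and M u2 - u1,
    chosen anew at each step, is known to carry half of the mass.\<close>
  have "0 < \<mu> / 2" using \<mu> by simp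
  from lower_bound_gain[OF s k lam C this] obtain \<theta>0 \<epsilon> where \<theta>0: "0 < \<theta>0" and \<epsilon>: "0 < \<epsilon>"
    and gn: "\<forall>\<Omega> :: 'a set. gain_property lam Lam beta s k C (\<mu> / 2) \<theta>0 \<epsilon> \<Omega>"
    by (elim exE conjE) (rule that)
  have "0 < t1 / t0" using t by simp
  from boundary_harnack[OF s k lam C this] obtain Cm where Cm: "0 < Cm"
    and har: "\<forall>C0\<ge>Cm. \<forall>\<Omega> (u1 :: 'a \<Rightarrow> real) u2 c r e e1.
    solves lam Lam beta s \<Omega> e1 u1 \<longrightarrow> solves lam Lam beta s \<Omega> e1 u2 \<longrightarrow>
    visc_Mplus_ge lam Lam beta s (\<lambda>x. u1 x - C0 * u2 x) (\<lambda>_. - e) (ball 0 1 \<inter> \<Omega>) \<longrightarrow>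
    0 < r \<longrightarrow> r \<le> 1 \<longrightarrow> ball c r \<subseteq> ball 0 1 \<longrightarrow>
    (\<forall>y\<in>ball c (r/2). u1 y \<le> C * (r powr (2 * s) * tail k r c u1)) \<longrightarrow>
    (\<forall>y\<in>ball c (r/2). u2 y \<le> C * (r powr (2 * s) * tail k r c u2)) \<longrightarrow>
    0 < tail k r c u2 \<longrightarrow> tail k r c u1 \<le> t1 / t0 * tail k r c u2 \<longrightarrow> e \<le> lam / 4 * (C0 * tail k r c u2) \<longrightarrow>
    (\<forall>x\<in>cball c (r/8). u1 x \<le> C0 * u2 x)"
    by (elim exE conjE) (rule that)
  define G where "G = 1 + \<mu> / 2"
  have G: "1 < G" using \<mu> by (simp add: G_def)
  have k0: "0 < k" using s k by simp
  have G1: "0 < 1 - 1 / G" using G by simp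
  define b where "b = 2 powr k + \<epsilon>"
  have b: "0 < b" using \<epsilon> by (simp add: b_def add_pos_pos)
  \<comment> \<open>Four demands: \<open>\<theta>0\<close> for the gain, 1/2 to keep q above 1/8, 1
    - 1/G for q G >= 1, and the last for \<epsilon>/G + \<theta> 2^k <= \<epsilon> q, which
    reproduces the tail invariant. With q = 1 - \<theta> the latter reads \<theta> (2^k +
    \<epsilon>) <= \<epsilon> (1 - 1/G), whence \<open>b\<close>.\<close>
  define \<theta> where "\<theta> = min (min \<theta>0 (1/2)) (min (1 - 1 / G) (\<epsilon> * (1 - 1 / G) / b))"
  have \<theta>: "0 < \<theta>" "\<theta> \<le> \<theta>0" "\<theta> \<le> 1/2" "\<theta> \<le> 1 - 1 / G" "\<theta> * b \<le> \<epsilon> * (1 - 1 / G)"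
  proof -
    show "0 < \<theta>" using \<theta>0 G1 \<epsilon> b by (simp add: \<theta>_def)
    show "\<theta> \<le> \<theta>0" "\<theta> \<le> 1/2" "\<theta> \<le> 1 - 1 / G" unfolding \<theta>_def by linarith+
    have "\<theta> \<le> \<epsilon> * (1 - 1 / G) / b" unfolding \<theta>_def by linarith
    then show "\<theta> * b \<le> \<epsilon> * (1 - 1 / G)" using b by (simp add: pos_le_divide_eq)
  qed
  define q where "q = 1 - \<theta>"
  have q: "1 / 8 < q" "q < 1" "1 \<le> q * G" "\<epsilon> / G + \<theta> * 2 powr k \<le> \<epsilon> * q"
  proof -
    show "1 / 8 < q" "q < 1" using \<theta> by (auto simp: q_def)
    have "1 / G \<le> q" using \<theta> by (simp add: q_def)
    then show "1 \<le> q * G" using G by (simp add: pos_divide_le_eq)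
    show "\<epsilon> / G + \<theta> * 2 powr k \<le> \<epsilon> * q" using \<theta>(5) by (simp add: q_def b_def algebra_simps)
  qed
  \<comment> \<open>\<open>Cm\<close> starts the iteration by the boundary Harnack inequality; the
    other term starts the tail invariant, with 16^k = 2^k 8^k from passing to the pure kernel and
    from radius R to R/8.\<close>
  define C0 where "C0 = max Cm (16 powr k * t1 / (\<epsilon> * t0))"
  have C0: "Cm \<le> C0" "0 < C0" "16 powr k * t1 \<le> \<epsilon> * C0 * t0"
  proof -
    show "Cm \<le> C0" "0 < C0" using Cm by (auto simp: C0_def)
    have "16 powr k * t1 / (\<epsilon> * t0) \<le> C0" by (simp add: C0_def)
    then have "16 powr k * t1 \<le> C0 * (\<epsilon> * t0)" using \<epsilon> t by (simp add: pos_divide_le_eq)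
    then show "16 powr k * t1 \<le> \<epsilon> * C0 * t0" by (simp add: mult_ac)
  qed
  \<comment> \<open>Here 1 + 2 C0 bounds |a| + |b| for every combination to which the viscosity
    hypothesis is applied in the iteration.\<close>
  define \<delta> where "\<delta> = min (min t0 (\<gamma> * t0)) (min (lam / 4 * (C0 * t0)) (\<epsilon> * (C0 * t0)) / (1 + 2 * C0))"
  have d0: "0 < 1 + 2 * C0" using C0 by simp
  have \<delta>: "0 < \<delta>" "\<delta> \<le> t0" "\<delta> \<le> \<gamma> * t0" "\<delta> * (1 + 2 * C0) \<le> lam / 4 * (C0 * t0)" "\<delta> * (1 + 2 * C0) \<le> \<epsilon> * (C0 * t0)"
  proof -
    show "0 < \<delta>" using t \<gamma> lam \<epsilon> C0 d0 by (simp add: \<delta>_def)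
    show "\<delta> \<le> t0" "\<delta> \<le> \<gamma> * t0" unfolding \<delta>_def by linarith+
    have "\<delta> \<le> min (lam / 4 * (C0 * t0)) (\<epsilon> * (C0 * t0)) / (1 + 2 * C0)"
      unfolding \<delta>_def by (rule min.cobounded2)
    then have "\<delta> * (1 + 2 * C0) \<le> min (lam / 4 * (C0 * t0)) (\<epsilon> * (C0 * t0))" using d0 by (simp add: pos_le_divide_eq)
    then show "\<delta> * (1 + 2 * C0) \<le> lam / 4 * (C0 * t0)" "\<delta> * (1 + 2 * C0) \<le> \<epsilon> * (C0 * t0)" by auto
  qed
  show ?thesis
  proof (rule exI[of _ \<delta>], rule conjI[OF \<delta>(1)], rule exI[of _ C0], rule conjI[OF C0(2)],
      rule exI[of _ q], rule conjI[OF q(1)], rule conjI[OF q(2)], intro allI impI)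
    fix \<Omega> and u1 u2 :: "'a \<Rightarrow> real" and c R j
    assume pr: "solves_pair lam Lam beta s \<Omega> \<delta> u1 u2" and R: "0 < R" "R < 1" and sub: "cball c R \<subseteq> ball 0 1"
      and cork: "\<forall>r. 0 < r \<and> r \<le> R \<longrightarrow> (\<exists>z. cball z (3 * \<kappa> * r) \<subseteq> \<Omega> \<inter> ball c (r/2))"
      and T1: "t0 \<le> tail k R c u1" "tail k R c u1 \<le> t1" and T2: "t0 \<le> tail k R c u2"
    have sol1: "solves lam Lam beta s \<Omega> \<delta> u1" and sol2: "solves lam Lam beta s \<Omega> \<delta> u2"
      and visc: "\<And>a b. visc_Mplus_ge lam Lam beta s (\<lambda>x. a * u1 x + b * u2 x) (\<lambda>_. - (\<delta> * (\<bar>a\<bar> + \<bar>b\<bar>))) (ball 0 1 \<inter> \<Omega>)"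
      using pr by (auto simp: solves_pair_def)
    have facts: "open \<Omega>" "continuous_on (ball 0 1) u1" "continuous_on (ball 0 1) u2"
      "\<forall>y. 0 \<le> u1 y" "\<forall>y. 0 \<le> u2 y" "\<forall>x\<in>ball 0 1 - \<Omega>. u1 x = 0" "\<forall>x\<in>ball 0 1 - \<Omega>. u2 x = 0"
      "tail_integrable k 1 0 u1" "tail_integrable k 1 0 u2"
      and meas [measurable]: "u1 \<in> borel_measurable borel" "u2 \<in> borel_measurable borel"
      using sol1 sol2 unfolding solves_def k by blast+
    have uW: "tail_integrable k r c u1" "tail_integrable k r c u2" if "0 < r" for r
      using integrable_weight[OF facts(8)] integrable_weight[OF facts(9)] k0 that by auto
    have combi: "tail_integrable k 1 0 (\<lambda>y. a * u1 y + b * u2 y)" for a b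
    proof -
      have "integrable lborel (\<lambda>y. a * (u1 y * weight k 1 0 y) + b * (u2 y * weight k 1 0 y))"
        by (intro Bochner_Integration.integrable_add integrable_mult_right facts)
      then show ?thesis by (simp add: algebra_simps)
    qed
    have tail_mono: "tail k R c u \<le> tail k r c u" if "0 < r" "r \<le> R" "\<forall>y. 0 \<le> u y"
       "tail_integrable k r c u" "tail_integrable k R c u" for u r
      unfolding tail_def using that k0 by (intro integral_mono mult_left_mono weight_antimono) auto
    \<comment> \<open>The exponent starts at 1: the boundary Harnack inequality gives u1 <= C0 u2
      only on the ball of radius R/8.\<close>
    define \<rho> where "\<rho> i = R / 8 ^ Suc i" for i
    have \<rho>: "0 < \<rho> i" "\<rho> i \<le> R" "\<rho> (Suc i) = \<rho> i / 8" for i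
    proof -
      show "0 < \<rho> i" "\<rho> (Suc i) = \<rho> i / 8" using R by (auto simp: \<rho>_def)
      have "(1::real) \<le> 8 ^ Suc i" by (rule one_le_power) simp
      then show "\<rho> i \<le> R" using R by (simp add: \<rho>_def pos_divide_le_eq mult_le_cancel_left1 del: power_Suc)
    qed
    define T where "T i = tail k (\<rho> i) c u2" for i
    have T_t0: "t0 \<le> T i" for i
      using tail_mono[OF \<rho>(1,2) facts(5) uW(2)[OF \<rho>(1)] uW(2)[OF R(1)], of i] T2 by (simp add: T_def)
    have T0: "0 < T i" for i using T_t0[of i] t by linarith
    have \<rho>sub: "cball c (\<rho> i) \<subseteq> ball 0 1" for i
      using sub \<rho>(2)[of i] subset_cball[of "\<rho> i" R c] by blast
    have masses: "\<mu> * T i \<le> (\<integral>y. u2 y * weight k (\<rho> i) c y * indicator (ball c (\<rho> i)) y \<partial>lborel) \<and> G * T i \<le> T (Suc i)" for i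
    proof -
      obtain z where z: "cball z (3 * \<kappa> * \<rho> i) \<subseteq> \<Omega> \<inter> ball c (\<rho> i / 2)" using cork \<rho>(1,2)[of i] by blast
      have "\<gamma> * t0 \<le> \<gamma> * T i" using \<gamma> T_t0 by (intro mult_left_mono) auto
      then have "\<delta> \<le> \<gamma> * tail k (\<rho> i) c u2" using \<delta> by (simp add: T_def)
      from mass[rule_format, OF sol2 \<rho>(1) _ \<rho>sub this z] show ?thesis
        using \<rho>(2)[of i] R unfolding T_def G_def \<rho>(3) by simp
    qed
    \<comment> \<open>The interval shrinks by q while T grows by at least G >= 1/q, so their product
      never falls below its initial bound. This is where the fixed \<delta> stays harmless at all
      scales.\<close>
    have qT: "t0 \<le> q ^ i * T i" for i
    proof (induction i)
      case (Suc i)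
      have "q ^ i * T i * 1 \<le> q ^ i * T i * (q * G)" using q T0[of i] by (intro mult_left_mono) auto
      also have "\<dots> = q ^ Suc i * (G * T i)" by simp
      also have "\<dots> \<le> q ^ Suc i * T (Suc i)" using masses[of i] q by (intro mult_left_mono) auto
      finally show ?case using Suc by simp
    qed (use T_t0 in simp)
    have u2C: "\<forall>y\<in>ball c (r/2). u2 y \<le> C * (r powr (2 * s) * tail k r c u2)"
      if "0 < r" "r \<le> R" for r
    proof -
      have "\<delta> \<le> tail k r c u2"
        using tail_mono[OF that facts(5) uW(2)[OF that(1)] uW(2)[OF R(1)]] T2 \<delta> by linarith
      from sup[rule_format, OF sol2 that(1) _ _ this] show ?thesis
        using that R sub subset_cball[of r R c] by fastforce
    qed
    have u1C: "\<forall>y\<in>ball c (R/2). u1 y \<le> C * (R powr (2 * s) * tail k R c u1)"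
    proof -
      have "\<delta> \<le> tail k R c u1" using T1 \<delta> by linarith
      from sup[rule_format, OF sol1 R sub this] show ?thesis by fastforce
    qed
    define I where "I i m M \<longleftrightarrow> 0 \<le> m \<and> M \<le> C0 \<and> M - m = C0 * q ^ i \<and>
       (\<forall>y\<in>ball c (\<rho> i). m * u2 y \<le> u1 y \<and> u1 y \<le> M * u2 y) \<and>
       outer_tail k c (\<rho> i) (\<lambda>y. max 0 (m * u2 y - u1 y)) \<le> \<epsilon> * (C0 * q ^ i * T i) \<and>
       outer_tail k c (\<rho> i) (\<lambda>y. max 0 (u1 y - M * u2 y)) \<le> \<epsilon> * (C0 * q ^ i * T i)" for i m M
    have base: "I 0 0 C0"
    proof -
      have "\<forall>x\<in>cball c (R/8). u1 x \<le> C0 * u2 x"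
      proof
        fix x assume x: "x \<in> cball c (R/8)"
        show "u1 x \<le> C0 * u2 x"
        proof (rule har[rule_format, OF C0(1) sol1 sol2 _ _ _ _ _ _ _ _ _ x])
          show "u1 y \<le> C * (R powr (2 * s) * tail k R c u1)" if "y \<in> ball c (R/2)" for y
            using u1C that by blast
          show "u2 y \<le> C * (R powr (2 * s) * tail k R c u2)" if "y \<in> ball c (R/2)" for y
            using u2C[OF R(1) order_refl] that by blast
          show "visc_Mplus_ge lam Lam beta s (\<lambda>x. u1 x - C0 * u2 x) (\<lambda>_. - (\<delta> * (1 + C0))) (ball 0 1 \<inter> \<Omega>)"
            using visc[of 1 "- C0"] C0 by simp
          show "R \<le> 1" "0 < R" "0 < tail k R c u2" using R T2 t by auto
          show "ball c R \<subseteq> ball 0 1" using sub by (auto dest!: subsetD)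
          have "t1 / t0 * t0 \<le> t1 / t0 * tail k R c u2" using t T2 by (intro mult_left_mono) auto
          then show "tail k R c u1 \<le> t1 / t0 * tail k R c u2" using T1 t by simp
          have "\<delta> * (1 + C0) \<le> \<delta> * (1 + 2 * C0)" using \<delta> C0 by (intro mult_left_mono) auto
          also have "\<dots> \<le> lam / 4 * (C0 * t0)" by (rule \<delta>)
          also have "\<dots> \<le> lam / 4 * (C0 * tail k R c u2)" using lam C0 T2 by (intro mult_left_mono) auto
          finally show "\<delta> * (1 + C0) \<le> lam / 4 * (C0 * tail k R c u2)" .
        qed
      qed
      then have 1: "\<forall>y\<in>ball c (\<rho> 0). 0 * u2 y \<le> u1 y \<and> u1 y \<le> C0 * u2 y"
        using facts by (auto simp: \<rho>_def)
      have "0 \<le> \<epsilon> * (C0 * q ^ 0 * T 0)" using \<epsilon> C0 T0[of 0] by simp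
      moreover have "outer_tail k c (\<rho> 0) (\<lambda>y. max 0 (0 * u2 y - u1 y)) = 0"
        using facts(4) by simp
      ultimately have 2: "outer_tail k c (\<rho> 0) (\<lambda>y. max 0 (0 * u2 y - u1 y)) \<le> \<epsilon> * (C0 * q ^ 0 * T 0)"
        by linarith
      \<comment> \<open>The tail step is started from h = -C0 u2, whose positive part vanishes, with
        u1 as the added function and a = 1.\<close>
      have "outer_tail k c (\<rho> 0) (\<lambda>y. max 0 (u1 y - C0 * u2 y))
        \<le> outer_tail k c (\<rho> 0) (\<lambda>y. max 0 (- (C0 * u2 y))) + 1 * (2 powr k * tail k (\<rho> 0) c u1)"
        by (rule tail_step)
          (use combi[of 0 "- C0"] combi[of 1 "- C0"] facts C0 \<rho>(1) k0 in \<open>auto simp: less_imp_le\<close>)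
      also have "outer_tail k c (\<rho> 0) (\<lambda>y. max 0 (- (C0 * u2 y))) = 0"
      proof -
        have "max 0 (- (C0 * u2 y)) = 0" for y using facts(5) C0 by simp
        then show ?thesis by simp
      qed
      also have "2 powr k * tail k (\<rho> 0) c u1 \<le> 2 powr k * (8 powr k * t1)"
      proof -
        have W8: "weight k (\<rho> 0) c y \<le> 8 powr k * weight k R c y" for y
          by (rule weight_le) (use R k0 in \<open>auto simp: \<rho>_def intro: add_pos_nonneg\<close>)
        have "tail k (\<rho> 0) c u1 \<le> (\<integral>y. 8 powr k * (u1 y * weight k R c y) \<partial>lborel)"
          unfolding tail_def
        proof (intro integral_mono integrable_mult_right uW \<rho> R)
          fix y show "u1 y * weight k (\<rho> 0) c y \<le> 8 powr k * (u1 y * weight k R c y)"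
            using mult_left_mono[OF W8[of y], of "u1 y"] facts(4) by (simp add: mult_ac)
        qed
        also have "\<dots> \<le> 8 powr k * t1" using T1 by (simp add: tail_def)
        finally show ?thesis by (intro mult_left_mono) auto
      qed
      also have "2 powr k * (8 powr k * t1) = 16 powr k * t1" by (simp add: mult.assoc[symmetric] flip: powr_mult)
      also have "\<dots> \<le> \<epsilon> * C0 * t0" by (rule C0)
      also have "\<dots> \<le> \<epsilon> * C0 * T 0" using \<epsilon> C0 T_t0 by (intro mult_left_mono) auto
      finally have "outer_tail k c (\<rho> 0) (\<lambda>y. max 0 (u1 y - C0 * u2 y)) \<le> \<epsilon> * (C0 * q ^ 0 * T 0)"
        by simp
      with 1 2 show ?thesis unfolding I_def using C0 by auto
    qed
    have step: "\<exists>m' M'. I (Suc i) m' M'" if "I i m M" for i m M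
    proof -
      define \<omega> where "\<omega> = C0 * q ^ i"
      have \<omega>: "0 < \<omega>" using C0 q by (simp add: \<omega>_def)
      from that have mM: "0 \<le> m" "M \<le> C0" "M - m = \<omega>"
        and bd: "\<And>y. y \<in> ball c (\<rho> i) \<Longrightarrow> m * u2 y \<le> u1 y \<and> u1 y \<le> M * u2 y"
        and tm: "outer_tail k c (\<rho> i) (\<lambda>y. max 0 (m * u2 y - u1 y)) \<le> \<epsilon> * (\<omega> * T i)"
        and tM: "outer_tail k c (\<rho> i) (\<lambda>y. max 0 (u1 y - M * u2 y)) \<le> \<epsilon> * (\<omega> * T i)"
        by (auto simp: I_def \<omega>_def)
      have \<theta>\<omega>: "0 \<le> \<theta> * \<omega>" "\<theta> * \<omega> \<le> \<omega>" using \<theta> \<omega> by auto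
      have MC: "m \<le> C0" "0 \<le> M" "\<omega> \<le> C0" using mM \<omega> by linarith+
      have eT: "\<delta> * (1 + 2 * C0) \<le> \<epsilon> * (\<omega> * T i)"
      proof -
        have "\<epsilon> * C0 * t0 \<le> \<epsilon> * C0 * (q ^ i * T i)" using qT \<epsilon> C0 by (intro mult_left_mono) auto
        with \<delta>(5) show ?thesis by (simp add: \<omega>_def mult_ac)
      qed
      have err: "\<delta> * (1 + \<bar>a\<bar>) \<le> \<epsilon> * (\<omega> * T i)" if "\<bar>a\<bar> \<le> 2 * C0" for a
      proof -
        have "\<delta> * (1 + \<bar>a\<bar>) \<le> \<delta> * (1 + 2 * C0)" using that \<delta> by (intro mult_left_mono) auto
        with eT show ?thesis by linarith
      qed
      \<comment> \<open>The old tail gains the factor 1/G from T_i <= T_(i+1)/G, the change of m or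
        M adds \<theta> 2^k, and together they fit under \<epsilon> q.\<close>
      have small: "\<epsilon> * (\<omega> * T i) + \<theta> * \<omega> * (2 powr k * T (Suc i)) \<le> \<epsilon> * (C0 * q ^ Suc i * T (Suc i))"
      proof -
        have "T i \<le> T (Suc i) / G" using masses[of i] G by (simp add: pos_le_divide_eq mult.commute)
        then have "\<epsilon> * \<omega> * T i \<le> \<epsilon> * \<omega> * (T (Suc i) / G)" using \<epsilon> \<omega> by (intro mult_left_mono) auto
        then have "\<epsilon> * (\<omega> * T i) + \<theta> * \<omega> * (2 powr k * T (Suc i)) \<le> (\<epsilon> / G + \<theta> * 2 powr k) * (\<omega> * T (Suc i))"
          by (simp add: algebra_simps)
        also have "\<dots> \<le> (\<epsilon> * q) * (\<omega> * T (Suc i))" using q(4) \<omega> T0[of "Suc i"] by (intro mult_right_mono) auto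
        finally show ?thesis by (simp add: \<omega>_def mult_ac)
      qed
      have newtail1: "outer_tail k c (\<rho> (Suc i)) (\<lambda>y. max 0 (m' * u2 y - u1 y))
          \<le> \<epsilon> * (C0 * q ^ Suc i * T (Suc i))" if m': "m' \<le> m + \<theta> * \<omega>" for m'
      proof -
        have "outer_tail k c (\<rho> (Suc i)) (\<lambda>y. max 0 (m' * u2 y - u1 y))
          \<le> outer_tail k c (\<rho> i) (\<lambda>y. max 0 (m * u2 y - u1 y))
             + \<theta> * \<omega> * (2 powr k * tail k (\<rho> (Suc i)) c u2)"
        proof (rule tail_step)
          show "tail_integrable k 1 0 (\<lambda>y. m * u2 y - u1 y)"
            "tail_integrable k 1 0 (\<lambda>y. m' * u2 y - u1 y)"
            using combi[of "-1" m] combi[of "-1" m'] by (simp_all add: algebra_simps)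
          show "m' * u2 y - u1 y \<le> m * u2 y - u1 y + \<theta> * \<omega> * u2 y" for y
            using mult_right_mono[OF m', of "u2 y"] facts(5) by (simp add: algebra_simps)
          show "m * u2 y - u1 y \<le> 0" if "y \<in> ball c (\<rho> i)" for y using bd[OF that] by simp
        qed (use facts \<theta>\<omega> \<rho> k0 in auto)
        then show ?thesis using tm small by (simp add: T_def)
      qed
      have newtail2: "outer_tail k c (\<rho> (Suc i)) (\<lambda>y. max 0 (u1 y - M' * u2 y))
          \<le> \<epsilon> * (C0 * q ^ Suc i * T (Suc i))" if M': "M - \<theta> * \<omega> \<le> M'" for M'
      proof -
        have "outer_tail k c (\<rho> (Suc i)) (\<lambda>y. max 0 (u1 y - M' * u2 y))
          \<le> outer_tail k c (\<rho> i) (\<lambda>y. max 0 (u1 y - M * u2 y))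
             + \<theta> * \<omega> * (2 powr k * tail k (\<rho> (Suc i)) c u2)"
        proof (rule tail_step)
          show "tail_integrable k 1 0 (\<lambda>y. u1 y - M * u2 y)"
            "tail_integrable k 1 0 (\<lambda>y. u1 y - M' * u2 y)"
            using combi[of 1 "- M"] combi[of 1 "- M'"] by (simp_all add: algebra_simps)
          show "u1 y - M' * u2 y \<le> u1 y - M * u2 y + \<theta> * \<omega> * u2 y" for y
            using mult_right_mono[OF M', of "u2 y"] facts(5) by (simp add: algebra_simps)
          show "u1 y - M * u2 y \<le> 0" if "y \<in> ball c (\<rho> i)" for y using bd[OF that] by simp
        qed (use facts \<theta>\<omega> \<rho> k0 in auto)
        then show ?thesis using tM small by (simp add: T_def)
      qed
      have ballsub: "ball c (\<rho> (Suc i)) \<subseteq> ball c (\<rho> i)" "ball c (\<rho> (Suc i)) \<subseteq> cball c (\<rho> i / 8)"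
        using \<rho>(1)[of i] by (auto simp: \<rho>(3))
      have om: "C0 * q ^ Suc i = \<omega> - \<theta> * \<omega>" by (simp add: \<omega>_def q_def algebra_simps)
      \<comment> \<open>Stated for f = a u1 + b u2 with |a| = 1 to serve both cases; then \<theta>
        \<omega> u2 - f is again a linear combination, so the hypothesis applies to it with error
        \<delta> (1 + |\<theta> \<omega> - b|).\<close>
      have apply_gain: "\<forall>x\<in>cball c (\<rho> i / 8). \<theta> * \<omega> * u2 x \<le> f x"
        if f: "f = (\<lambda>y. a * u1 y + b * u2 y)" and ab: "\<bar>a\<bar> = 1" "\<bar>\<theta> * \<omega> - b\<bar> \<le> 2 * C0"
          and f0: "\<forall>y\<in>ball c (\<rho> i). 0 \<le> f y \<and> f y \<le> \<omega> * u2 y"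
          and ms: "\<mu> / 2 * (\<omega> * T i) \<le> (\<integral>y. f y * weight k (\<rho> i) c y * indicator (ball c (\<rho> i)) y \<partial>lborel)"
          and tl: "outer_tail k c (\<rho> i) (\<lambda>y. max 0 (- f y)) \<le> \<epsilon> * (\<omega> * T i)"
        for f a b
      proof
        fix x assume x: "x \<in> cball c (\<rho> i / 8)"
        show "\<theta> * \<omega> * u2 x \<le> f x"
        proof (rule gn[unfolded gain_property_def, rule_format, where f = f and v = u2 and c = c and r = "\<rho> i" and \<omega> = \<omega> and \<theta> = \<theta>
              and e = "\<delta> * (1 + \<bar>\<theta> * \<omega> - b\<bar>)" and \<Omega> = \<Omega> and x = x])
          show "open \<Omega>" "continuous_on (ball 0 1) u2" "u2 \<in> borel_measurable borel"
            "tail_integrable k 1 0 u2" "0 \<le> u2 y" for y using facts by auto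
          show "continuous_on (ball 0 1) f" unfolding f by (intro continuous_intros facts)
          show "f \<in> borel_measurable borel" unfolding f by measurable
          show "tail_integrable k 1 0 f" unfolding f by (rule combi)
          show "f x = 0 \<and> u2 x = 0" if "x \<in> ball 0 1 - \<Omega>" for x using that facts unfolding f by auto
          have "(\<lambda>x. \<theta> * \<omega> * u2 x - f x) = (\<lambda>x. (- a) * u1 x + (\<theta> * \<omega> - b) * u2 x)"
            unfolding f by (auto simp: algebra_simps)
          then show "visc_Mplus_ge lam Lam beta s (\<lambda>x. \<theta> * \<omega> * u2 x - f x) (\<lambda>_. - (\<delta> * (1 + \<bar>\<theta> * \<omega> - b\<bar>))) (ball 0 1 \<inter> \<Omega>)"
            using visc[of "- a" "\<theta> * \<omega> - b"] ab by simp
          show "\<rho> i \<le> 1" using \<rho>(2)[of i] R by linarith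
          show "ball c (\<rho> i) \<subseteq> ball 0 1" using \<rho>sub[of i] by (auto dest!: subsetD)
          show "\<delta> * (1 + \<bar>\<theta> * \<omega> - b\<bar>) \<le> \<epsilon> * (\<omega> * tail k (\<rho> i) c u2)"
            using err[OF ab(2)] by (simp add: T_def)
          show "u2 y \<le> C * ((\<rho> i) powr (2 * s) * tail k (\<rho> i) c u2)" if "y \<in> ball c (\<rho> i / 2)" for y
            using u2C[OF \<rho>(1,2)] that by blast
        qed (use f0 ms tl \<rho> \<theta> \<omega> T0[of i] x in \<open>auto simp: T_def\<close>)
      qed
      have fi: "integrable lborel (\<lambda>y. (a * u1 y + b * u2 y) * weight k (\<rho> i) c y * indicator (ball c (\<rho> i)) y)" for a b
        by (rule integrable_weight_mono[OF combi, of _ _ "\<rho> i"]) (use k0 \<rho>(1) in \<open>auto simp: less_imp_le\<close>)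
      \<comment> \<open>The two candidate functions add up to \<omega> u2, so at least one of them
        carries half of its local mass.\<close>
      have split: "(\<integral>y. (1 * u1 y + (- m) * u2 y) * weight k (\<rho> i) c y * indicator (ball c (\<rho> i)) y \<partial>lborel)
          + (\<integral>y. ((- 1) * u1 y + M * u2 y) * weight k (\<rho> i) c y * indicator (ball c (\<rho> i)) y \<partial>lborel)
          = \<omega> * (\<integral>y. u2 y * weight k (\<rho> i) c y * indicator (ball c (\<rho> i)) y \<partial>lborel)"
      proof -
        have "(\<integral>y. (1 * u1 y + (- m) * u2 y) * weight k (\<rho> i) c y * indicator (ball c (\<rho> i)) y \<partial>lborel)
          + (\<integral>y. ((- 1) * u1 y + M * u2 y) * weight k (\<rho> i) c y * indicator (ball c (\<rho> i)) y \<partial>lborel)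
          = (\<integral>y. (1 * u1 y + (- m) * u2 y) * weight k (\<rho> i) c y * indicator (ball c (\<rho> i)) y
             + ((- 1) * u1 y + M * u2 y) * weight k (\<rho> i) c y * indicator (ball c (\<rho> i)) y \<partial>lborel)"
          by (rule Bochner_Integration.integral_add[symmetric]; rule fi)
        also have "\<dots> = (\<integral>y. \<omega> * (u2 y * weight k (\<rho> i) c y * indicator (ball c (\<rho> i)) y) \<partial>lborel)"
          by (rule Bochner_Integration.integral_cong) (auto simp: mM(3)[symmetric] algebra_simps)
        finally show ?thesis by simp
      qed
      have "\<omega> * (\<mu> * T i) \<le> \<omega> * (\<integral>y. u2 y * weight k (\<rho> i) c y * indicator (ball c (\<rho> i)) y \<partial>lborel)"
        using masses[of i] \<omega> by (intro mult_left_mono) auto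
      then consider
          "\<mu> / 2 * (\<omega> * T i) \<le> (\<integral>y. (1 * u1 y + (- m) * u2 y) * weight k (\<rho> i) c y * indicator (ball c (\<rho> i)) y \<partial>lborel)"
        | "\<mu> / 2 * (\<omega> * T i) \<le> (\<integral>y. ((- 1) * u1 y + M * u2 y) * weight k (\<rho> i) c y * indicator (ball c (\<rho> i)) y \<partial>lborel)"
        using split by (smt (verit) mult.commute mult.left_commute field_sum_of_halves distrib_right)
      then show ?thesis
      proof cases
        case 1
        have "\<forall>x\<in>cball c (\<rho> i / 8). \<theta> * \<omega> * u2 x \<le> 1 * u1 x + (- m) * u2 x"
        proof (rule apply_gain[OF refl _ _ _ 1])
          show "\<bar>\<theta> * \<omega> - - m\<bar> \<le> 2 * C0" using \<theta>\<omega> MC mM by auto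
          have "m * u2 y + \<omega> * u2 y = M * u2 y" for y
            unfolding mM(3)[symmetric] by (simp add: algebra_simps)
          then show "\<forall>y\<in>ball c (\<rho> i). 0 \<le> 1 * u1 y + - m * u2 y \<and> 1 * u1 y + - m * u2 y \<le> \<omega> * u2 y"
            using bd by (fastforce simp: algebra_simps)
          show "outer_tail k c (\<rho> i) (\<lambda>y. max 0 (- (1 * u1 y + - m * u2 y))) \<le> \<epsilon> * (\<omega> * T i)"
            using tm by simp
        qed simp
        then have "\<forall>y\<in>ball c (\<rho> (Suc i)). (m + \<theta> * \<omega>) * u2 y \<le> u1 y \<and> u1 y \<le> M * u2 y"
          using bd ballsub by (auto simp: algebra_simps)
        then have "I (Suc i) (m + \<theta> * \<omega>) M"
          unfolding I_def using mM \<theta>\<omega> om newtail1[OF order_refl] newtail2[of M] by auto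
        then show ?thesis by blast
      next
        case 2
        have "\<forall>x\<in>cball c (\<rho> i / 8). \<theta> * \<omega> * u2 x \<le> (- 1) * u1 x + M * u2 x"
        proof (rule apply_gain[OF refl _ _ _ 2])
          show "\<bar>\<theta> * \<omega> - M\<bar> \<le> 2 * C0" using \<theta>\<omega> MC mM by auto
          have mM': "m * u2 y + \<omega> * u2 y = M * u2 y" for y
            unfolding mM(3)[symmetric] by (simp add: algebra_simps)
          show "\<forall>y\<in>ball c (\<rho> i). 0 \<le> - 1 * u1 y + M * u2 y \<and> - 1 * u1 y + M * u2 y \<le> \<omega> * u2 y"
          proof
            fix y assume "y \<in> ball c (\<rho> i)"
            from bd[OF this] mM'[of y]
            show "0 \<le> - 1 * u1 y + M * u2 y \<and> - 1 * u1 y + M * u2 y \<le> \<omega> * u2 y" by linarith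
          qed
          show "outer_tail k c (\<rho> i) (\<lambda>y. max 0 (- (- 1 * u1 y + M * u2 y))) \<le> \<epsilon> * (\<omega> * T i)"
            using tM by simp
        qed simp
        then have "\<forall>y\<in>ball c (\<rho> (Suc i)). m * u2 y \<le> u1 y \<and> u1 y \<le> (M - \<theta> * \<omega>) * u2 y"
          using bd ballsub by (auto simp: algebra_simps)
        then have "I (Suc i) m (M - \<theta> * \<omega>)"
          unfolding I_def using mM \<theta>\<omega> om newtail1[of m] newtail2[OF order_refl] by auto
        then show ?thesis by blast
      qed
    qed
    have "\<exists>m M. I j m M" by (induction j) (use base step in blast)+
    then show "\<exists>m M. 0 \<le> m \<and> M \<le> C0 \<and> M - m = C0 * q ^ j \<and>
       (\<forall>y\<in>ball c (R / 8 ^ Suc j). m * u2 y \<le> u1 y \<and> u1 y \<le> M * u2 y)"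
      unfolding I_def \<rho>_def by blast
  qed
qed

subsection \<open>Interior balls in Lipschitz domains\<close>

text \<open>Near a boundary point, moving from x by r/2 along the graph direction e gains height
  r/2, while a perturbation of size \<kappa> r raises the Lipschitz graph by at most 2 L \<kappa> r.
  The point x may be anywhere in \<Omega> near p, which later permits arbitrary centres.\<close>

lemma corkscrew_local:
  fixes \<Omega> :: "'a::euclidean_space set"
  assumes \<Omega>: "lipschitz_domain \<Omega>" and p: "p \<in> closure \<Omega>"
  shows "\<exists>d>0. \<exists>\<kappa>>0. \<forall>x\<in>\<Omega> \<inter> ball p d. \<forall>r. 0 < r \<and> r \<le> d \<longrightarrow> (\<exists>z. cball z (\<kappa> * r) \<subseteq> \<Omega> \<inter> ball x r)"
proof (cases "p \<in> \<Omega>")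
  case True
  have "open \<Omega>" using \<Omega> by (simp add: lipschitz_domain_def)
  then obtain d where d: "0 < d" "ball p d \<subseteq> \<Omega>" using True open_contains_ball by blast
  have "cball x (1/2 * r) \<subseteq> \<Omega> \<inter> ball x r" if "x \<in> ball p (d/2)" "0 < r" "r \<le> d/2" for x r
  proof
    fix y assume "y \<in> cball x (1/2 * r)"
    then have y: "dist x y \<le> r / 2" by simp
    then have "dist p y < d" using that dist_triangle[of p y x] by simp
    then show "y \<in> \<Omega> \<inter> ball x r" using d y that by auto
  qed
  then have "\<forall>x\<in>\<Omega> \<inter> ball p (d/2). \<forall>r. 0 < r \<and> r \<le> d/2 \<longrightarrow> (\<exists>z. cball z (1/2 * r) \<subseteq> \<Omega> \<inter> ball x r)"
    by blast
  moreover have "0 < d/2" "0 < (1/2::real)" using d by auto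
  ultimately show ?thesis by blast
next
  case False
  have "open \<Omega>" using \<Omega> by (simp add: lipschitz_domain_def)
  then have "p \<in> frontier \<Omega>" using p False by (simp add: frontier_def interior_open)
  from \<Omega>[unfolded lipschitz_domain_def, THEN conjunct2, THEN conjunct2, THEN conjunct2, rule_format, OF this]
  obtain e R \<Gamma> L where e: "norm e = 1" and R: "0 < R" and lip: "L-lipschitz_on {z. z \<bullet> e = 0} \<Gamma>"
    and graph: "\<Omega> \<inter> ball p R = {x \<in> ball p R. \<Gamma> (x - (x \<bullet> e) *\<^sub>R e) < x \<bullet> e}"
    by (elim exE conjE) (rule that)
  have L: "0 \<le> L" using lip by (rule lipschitz_on_nonneg)
  \<comment> \<open>Ensures 2 L \<kappa> + \<kappa> < 1/2: a perturbation v shifts the tangential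
    part by at most 2 |v| and the height by at most |v|.\<close>
  define \<kappa> where "\<kappa> = 1 / (4 * (L + 1))"
  have \<kappa>: "0 < \<kappa>" "\<kappa> \<le> 1/4" "2 * L * \<kappa> + \<kappa> < 1/2" using L by (auto simp: \<kappa>_def field_simps)
  have ee: "e \<bullet> e = 1" using e by (simp add: dot_square_norm)
  have "cball (x + (r/2) *\<^sub>R e) (\<kappa> * r) \<subseteq> \<Omega> \<inter> ball x r"
    if x: "x \<in> \<Omega> \<inter> ball p (R/2)" and r: "0 < r" "r \<le> R/2" for x r
  proof
    fix y assume "y \<in> cball (x + (r/2) *\<^sub>R e) (\<kappa> * r)"
    define v where "v = y - (x + (r/2) *\<^sub>R e)"
    have v: "norm v \<le> \<kappa> * r" using \<open>y \<in> _\<close> by (simp add: v_def dist_norm norm_minus_commute)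
    have y: "y = x + (r/2) *\<^sub>R e + v" by (simp add: v_def)
    have "norm (y - x) \<le> norm ((r/2) *\<^sub>R e) + norm v" unfolding y by (metis add.assoc add_diff_cancel_left' norm_triangle_ineq)
    moreover have "\<kappa> * r \<le> 1/4 * r" using \<kappa>(2) r by (intro mult_right_mono) auto
    moreover have "norm ((r/2) *\<^sub>R e) = r/2" using e r by simp
    ultimately have yx: "norm (y - x) < r" using v r by linarith
    then have y1: "y \<in> ball x r" by (simp add: dist_norm norm_minus_commute)
    have "y \<in> ball p R" using y1 x r dist_triangle[of p y x] by simp
    moreover have "\<Gamma> (y - (y \<bullet> e) *\<^sub>R e) < y \<bullet> e"
    proof -
      have ve: "\<bar>v \<bullet> e\<bar> \<le> norm v" using Cauchy_Schwarz_ineq2[of v e] e by simp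
      have "(y - (y \<bullet> e) *\<^sub>R e) - (x - (x \<bullet> e) *\<^sub>R e) = v - (v \<bullet> e) *\<^sub>R e"
        unfolding y by (simp add: inner_add_left ee algebra_simps)
      then have "norm ((y - (y \<bullet> e) *\<^sub>R e) - (x - (x \<bullet> e) *\<^sub>R e)) \<le> norm v + norm ((v \<bullet> e) *\<^sub>R e)"
        using norm_triangle_ineq4[of v "(v \<bullet> e) *\<^sub>R e"] by simp
      also have "\<dots> \<le> 2 * (\<kappa> * r)" using v ve e by simp
      finally have n: "dist (y - (y \<bullet> e) *\<^sub>R e) (x - (x \<bullet> e) *\<^sub>R e) \<le> 2 * (\<kappa> * r)" by (simp add: dist_norm)
      have "dist (\<Gamma> (y - (y \<bullet> e) *\<^sub>R e)) (\<Gamma> (x - (x \<bullet> e) *\<^sub>R e))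
        \<le> L * dist (y - (y \<bullet> e) *\<^sub>R e) (x - (x \<bullet> e) *\<^sub>R e)"
        by (rule lipschitz_onD[OF lip]) (auto simp: inner_diff_left ee)
      also have "\<dots> \<le> L * (2 * (\<kappa> * r))" using n L by (rule mult_left_mono)
      finally have "\<Gamma> (y - (y \<bullet> e) *\<^sub>R e) \<le> \<Gamma> (x - (x \<bullet> e) *\<^sub>R e) + L * (2 * (\<kappa> * r))"
        by (simp add: dist_real_def)
      moreover have "x \<in> {x \<in> ball p R. \<Gamma> (x - (x \<bullet> e) *\<^sub>R e) < x \<bullet> e}"
        unfolding graph[symmetric] using x R by simp
      then have "\<Gamma> (x - (x \<bullet> e) *\<^sub>R e) < x \<bullet> e" by simp
      moreover have "y \<bullet> e = x \<bullet> e + r/2 + v \<bullet> e" unfolding y by (simp add: inner_add_left ee)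
      moreover have "L * (2 * (\<kappa> * r)) + \<kappa> * r < r / 2"
        using mult_strict_right_mono[OF \<kappa>(3) r(1)] by (simp add: algebra_simps)
      ultimately show ?thesis using v ve by linarith
    qed
    ultimately have "y \<in> \<Omega> \<inter> ball p R" unfolding graph by simp
    then show "y \<in> \<Omega> \<inter> ball x r" using y1 by blast
  qed
  then have "\<forall>x\<in>\<Omega> \<inter> ball p (R/2). \<forall>r. 0 < r \<and> r \<le> R/2 \<longrightarrow> (\<exists>z. cball z (\<kappa> * r) \<subseteq> \<Omega> \<inter> ball x r)"
    by blast
  moreover have "0 < R/2" using R by auto
  ultimately show ?thesis using \<kappa>(1) by blast
qed

text \<open>Charts, radii and Lipschitz constants vary along the boundary; compactness of the part
  of the closure in the unit ball makes them uniform.\<close>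

lemma corkscrew:
  fixes \<Omega> :: "'a::euclidean_space set"
  assumes \<Omega>: "lipschitz_domain \<Omega>"
  shows "\<exists>r0>0. \<exists>\<kappa>>0. \<forall>x\<in>\<Omega> \<inter> cball 0 1. \<forall>r. 0 < r \<and> r \<le> r0 \<longrightarrow> (\<exists>z. cball z (\<kappa> * r) \<subseteq> \<Omega> \<inter> ball x r)"
proof -
  have "\<forall>p\<in>closure \<Omega>. \<exists>d \<kappa>. 0 < d \<and> 0 < \<kappa> \<and>
    (\<forall>x\<in>\<Omega> \<inter> ball p d. \<forall>r. 0 < r \<and> r \<le> d \<longrightarrow> (\<exists>z. cball z (\<kappa> * r) \<subseteq> \<Omega> \<inter> ball x r))"
    using corkscrew_local[OF \<Omega>] by metis
  then obtain d \<kappa> where d\<kappa>: "\<And>p. p \<in> closure \<Omega> \<Longrightarrow> 0 < d p \<and> 0 < \<kappa> p \<and>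
    (\<forall>x\<in>\<Omega> \<inter> ball p (d p). \<forall>r. 0 < r \<and> r \<le> d p \<longrightarrow> (\<exists>z. cball z (\<kappa> p * r) \<subseteq> \<Omega> \<inter> ball x r))"
    by metis
  have cK: "compact (closure \<Omega> \<inter> cball 0 1)" by (intro closed_Int_compact) auto
  have cov: "closure \<Omega> \<inter> cball 0 1 \<subseteq> (\<Union>p\<in>closure \<Omega> \<inter> cball 0 1. ball p (d p))" using d\<kappa> by auto
  obtain F where F: "F \<subseteq> closure \<Omega> \<inter> cball 0 1" "finite F"
    "closure \<Omega> \<inter> cball 0 1 \<subseteq> (\<Union>p\<in>F. ball p (d p))"
    by (rule compactE_image[OF cK _ cov]) auto
  \<comment> \<open>Inserting 1 keeps \<open>Min\<close> meaningful even for an empty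
    subcover.\<close>
  define r0 where "r0 = Min (insert 1 (d ` F))"
  define \<kappa>0 where "\<kappa>0 = Min (insert 1 (\<kappa> ` F))"
  have pos: "0 < r0" "0 < \<kappa>0" unfolding r0_def \<kappa>0_def using F d\<kappa> by auto
  have "\<exists>z. cball z (\<kappa>0 * r) \<subseteq> \<Omega> \<inter> ball x r" if x: "x \<in> \<Omega> \<inter> cball 0 1" and r: "0 < r" "r \<le> r0" for x r
  proof -
    have "x \<in> closure \<Omega> \<inter> cball 0 1" using x closure_subset by blast
    then obtain p where p: "p \<in> F" "x \<in> ball p (d p)" using F by blast
    have "r0 \<le> d p" "\<kappa>0 \<le> \<kappa> p" unfolding r0_def \<kappa>0_def using F p by auto
    then obtain z where z: "cball z (\<kappa> p * r) \<subseteq> \<Omega> \<inter> ball x r"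
      using d\<kappa>[of p] p F x r by (metis IntD1 IntI order_trans subsetD)
    have "cball z (\<kappa>0 * r) \<subseteq> cball z (\<kappa> p * r)"
      using \<open>\<kappa>0 \<le> \<kappa> p\<close> r by (intro subset_cball mult_right_mono) auto
    with z show ?thesis by blast
  qed
  with pos show ?thesis by blast
qed

section \<open>Dependence on the error, positivity, and assembly of the estimate\<close>

lemma visc_mono:
  assumes "visc_Mplus_ge lam Lam beta s w F D" "\<And>x. F' x \<le> F x"
  shows "visc_Mplus_ge lam Lam beta s w F' D"
  using assms unfolding visc_Mplus_ge_def by (meson ereal_less_eq(3) order_trans)

lemma solves_mono:
  assumes "solves lam Lam beta s \<Omega> e u" "e \<le> e'"
  shows "solves lam Lam beta s \<Omega> e' u"
  using assms visc_mono[of lam Lam beta s _ "\<lambda>_. - e" _ "\<lambda>_. - e'"] unfolding solves_def by auto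

lemma solves_pair_mono:
  assumes "solves_pair lam Lam beta s \<Omega> \<delta> u1 u2" "\<delta> \<le> \<delta>'"
  shows "solves_pair lam Lam beta s \<Omega> \<delta>' u1 u2"
  unfolding solves_pair_def
proof (intro conjI allI)
  show "solves lam Lam beta s \<Omega> \<delta>' u1" "solves lam Lam beta s \<Omega> \<delta>' u2"
    using assms solves_mono unfolding solves_pair_def by blast+
  fix a b
  have "visc_Mplus_ge lam Lam beta s (\<lambda>x. a * u1 x + b * u2 x) (\<lambda>_. - (\<delta> * (\<bar>a\<bar> + \<bar>b\<bar>))) (ball 0 1 \<inter> \<Omega>)"
    using assms unfolding solves_pair_def by blast
  then show "visc_Mplus_ge lam Lam beta s (\<lambda>x. a * u1 x + b * u2 x) (\<lambda>_. - (\<delta>' * (\<bar>a\<bar> + \<bar>b\<bar>))) (ball 0 1 \<inter> \<Omega>)"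
    by (rule visc_mono) (use assms in \<open>simp add: mult_right_mono\<close>)
qed

text \<open>The lower bound is applied in a ball centred at x itself and small enough to lie in
  \<Omega>. Its radius depends on x, but \<delta> does not, since the tails are bounded below by t0
  at every radius. Positivity gives the quotient its meaning.\<close>

lemma solves_pos:
  assumes s: "1/2 \<le> s" "s < 1" and k: "k = real DIM('a::euclidean_space) + 2 * s"
    and lam: "0 < lam" "lam \<le> Lam" "0 \<le> beta" and t0: "0 < t0"
  shows "\<exists>\<delta>>0. \<forall>\<Omega> (u :: 'a \<Rightarrow> real) (x :: 'a).
    solves lam Lam beta s \<Omega> \<delta> u \<longrightarrow> (\<forall>r. 0 < r \<and> r \<le> 1/4 \<longrightarrow> t0 \<le> tail k r x u) \<longrightarrow>
    x \<in> \<Omega> \<inter> ball 0 (1/2) \<longrightarrow> 0 < u x"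
proof -
  have "0 < (1/12::real)" "(1/12::real) < 1" by auto
  from solves_inf[OF s k lam this] obtain c0 \<gamma> where c0: "0 < c0" and \<gamma>: "0 < \<gamma>" and inf:
   "\<forall>\<Omega> (u :: 'a \<Rightarrow> real) (c :: 'a) r e z.
    solves lam Lam beta s \<Omega> e u \<longrightarrow> 0 < r \<longrightarrow> r < 1 \<longrightarrow> cball c r \<subseteq> ball 0 1 \<longrightarrow> e \<le> \<gamma> * tail k r c u \<longrightarrow>
    cball z (3 * (1/12) * r) \<subseteq> \<Omega> \<inter> ball c (r/2) \<longrightarrow>
    (\<forall>x\<in>cball z (1/12 * r). c0 * (r powr (2 * s) * tail k r c u) \<le> u x)"
    by (elim exE conjE) (rule that)
  show ?thesis
  proof (rule exI[of _ "\<gamma> * t0"], intro conjI allI impI)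
    show "0 < \<gamma> * t0" using \<gamma> t0 by simp
    fix \<Omega> and u :: "'a \<Rightarrow> real" and x
    assume sol: "solves lam Lam beta s \<Omega> (\<gamma> * t0) u" and tl: "\<forall>r. 0 < r \<and> r \<le> 1/4 \<longrightarrow> t0 \<le> tail k r x u"
      and x: "x \<in> \<Omega> \<inter> ball 0 (1/2)"
    have "open \<Omega>" using sol by (simp add: solves_def)
    then obtain d where d: "0 < d" "ball x d \<subseteq> \<Omega>" using x open_contains_ball by blast
    define r where "r = min d (1/4)"
    have r: "0 < r" "r \<le> 1/4" "r \<le> d" using d by (auto simp: r_def)
    have T: "t0 \<le> tail k r x u" using tl r by blast
    have "c0 * (r powr (2 * s) * tail k r x u) \<le> u x"
    proof (rule inf[rule_format, OF sol r(1)])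
      show "r < 1" using r by simp
      show "cball x r \<subseteq> ball 0 1"
      proof
        fix y assume "y \<in> cball x r"
        then show "y \<in> ball 0 1" using x r dist_triangle[of 0 y x] by simp
      qed
      show "\<gamma> * t0 \<le> \<gamma> * tail k r x u" using T \<gamma> by simp
      show "cball x (3 * (1/12) * r) \<subseteq> \<Omega> \<inter> ball x (r/2)"
      proof
        fix y assume "y \<in> cball x (3 * (1/12) * r)"
        then have "dist x y \<le> r / 4" by simp
        then have "y \<in> ball x d" "y \<in> ball x (r/2)" using r by auto
        then show "y \<in> \<Omega> \<inter> ball x (r/2)" using d by blast
      qed
      show "x \<in> cball x (1/12 * r)" using r by simp
    qed
    moreover have "0 < c0 * (r powr (2 * s) * tail k r x u)" using c0 r T t0 by simp
    ultimately show "0 < u x" by linarith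
  qed
qed

text \<open>Translates the normalising weight into the weight of radius 1 at the origin; the factor
  2^k becomes \<open>t0\<close> and the factor 2 enters \<open>t1\<close> in the theorem.\<close>

lemma weight_unit_bounds:
  assumes "0 \<le> k"
  shows "1 / (1 + norm y powr k) \<le> 2 powr k * weight k 1 0 y" "weight k 1 0 y \<le> 2 * (1 / (1 + norm y powr k))"
proof -
  have p: "0 < (1 + norm y) powr k" "0 < 1 + norm y powr k"
    by (auto intro: add_pos_nonneg simp: powr_gt_zero) (smt (verit) norm_ge_zero)
  have W: "weight k 1 0 y = 1 / (1 + norm y) powr k" by (simp add: weight_def powr_minus_divide)
  have "(1 + norm y) powr k \<le> (2 * max 1 (norm y)) powr k" using assms by (intro powr_mono2) auto
  also have "\<dots> = 2 powr k * max 1 (norm y) powr k" by (simp add: powr_mult)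
  also have "\<dots> \<le> 2 powr k * (1 + norm y powr k)" by (intro mult_left_mono) (auto simp: max_def)
  finally show "1 / (1 + norm y powr k) \<le> 2 powr k * weight k 1 0 y"
    unfolding W using p by (simp add: field_simps)
  have "norm y powr k \<le> (1 + norm y) powr k" "1 powr k \<le> (1 + norm y) powr k"
    using assms by (intro powr_mono2; simp)+
  then show "weight k 1 0 y \<le> 2 * (1 / (1 + norm y powr k))"
    unfolding W using p by (simp add: field_simps)
qed

text \<open>The quotient is estimated in \<Omega>, where u2 > 0, rather than on the closure, where
  u2 may vanish. A uniform Hoelder bound extends it continuously to the closure with the same
  constants.\<close>

theorem theorem5p2:
  fixes \<Omega> :: "'a::euclidean_space set"
    and s lam Lam beta :: real
  assumes "1/2 \<le> s" "s < 1"
    and "0 < lam" "lam \<le> Lam" "0 \<le> beta"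
    and "lipschitz_domain \<Omega>" "0 \<in> frontier \<Omega>"
  shows "\<exists>\<delta>>0. \<exists>\<alpha> C. 0 < \<alpha> \<and> \<alpha> < 1 \<and>
     (\<forall>u1 u2 :: 'a \<Rightarrow> real.
        continuous_on (ball 0 1) u1 \<and> continuous_on (ball 0 1) u2 \<and>
        (\<forall>a b. visc_Mplus_ge lam Lam beta s (\<lambda>x. a * u1 x + b * u2 x)
                  (\<lambda>x. - \<delta> * (\<bar>a\<bar> + \<bar>b\<bar>)) (ball 0 1 \<inter> \<Omega>)) \<and>
        (\<forall>x\<in>ball 0 1 - \<Omega>. u1 x = 0 \<and> u2 x = 0) \<and>
        (\<forall>x. 0 \<le> u1 x \<and> 0 \<le> u2 x) \<and>
        integrable lborel (\<lambda>x. u1 x / (1 + norm x powr (real DIM('a) + 2 * s))) \<and>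
        integrable lborel (\<lambda>x. u2 x / (1 + norm x powr (real DIM('a) + 2 * s))) \<and>
        (\<integral>x. u1 x / (1 + norm x powr (real DIM('a) + 2 * s)) \<partial>lborel) = 1 \<and>
        (\<integral>x. u2 x / (1 + norm x powr (real DIM('a) + 2 * s)) \<partial>lborel) = 1
        \<longrightarrow> holder_norm \<alpha> (\<Omega> \<inter> ball 0 (1/2)) (\<lambda>x. u1 x / u2 x) \<le> ereal C)"
proof -
  note s = assms(1,2) and lam = assms(3-5) and lip = assms(6)
  define k where "k = real DIM('a) + 2 * s"
  have k0: "0 < k" using s by (simp add: k_def)
  have op: "open \<Omega>" using lip by (simp add: lipschitz_domain_def)
  from corkscrew[OF lip] obtain r0 \<kappa>' where r0: "0 < r0" and \<kappa>': "0 < \<kappa>'"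
    and cork: "\<forall>x\<in>\<Omega> \<inter> cball 0 1. \<forall>r. 0 < r \<and> r \<le> r0 \<longrightarrow> (\<exists>z. cball z (\<kappa>' * r) \<subseteq> \<Omega> \<inter> ball x r)"
    by (elim exE conjE) (rule that)
  \<comment> \<open>6 \<kappa> <= \<kappa>' because the interior ball of radius 3 \<kappa> r is
    sought within B_(r/2)(c), so \<open>corkscrew\<close> is used with r/2.\<close>
  define \<kappa> where "\<kappa> = min (1/2) (\<kappa>' / 6)"
  have \<kappa>: "0 < \<kappa>" "\<kappa> < 1" "6 * \<kappa> \<le> \<kappa>'" using \<kappa>' by (auto simp: \<kappa>_def min_def)
  define R where "R = min r0 (1/4)"
  have R: "0 < R" "R \<le> r0" "R \<le> 1/4" "R < 1" using r0 by (auto simp: R_def min_def)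
  define t0 where "t0 = 2 powr (- k)"
  \<comment> \<open>3/R bounds (1 + |c| + R)/R for |c| < 1/2; thus \<open>t1\<close> bounds T_R(u1)
    uniformly in the centre.\<close>
  define t1 where "t1 = 2 * (3 / R) powr k"
  have t0: "0 < t0" by (simp add: t0_def)
  have "2 powr (- k) \<le> 2 powr (0::real)" using k0 by (intro powr_mono) auto
  moreover have "1 powr k \<le> (3 / R) powr k" using k0 R by (intro powr_mono2) auto
  ultimately have t01: "t0 \<le> t1" by (simp add: t0_def t1_def)
  from oscillation[OF s k_def lam \<kappa>(1,2) t0 t01] obtain \<delta>1 C0 q where \<delta>1: "0 < \<delta>1" and C0: "0 < C0"
    and q: "1/8 < q" "q < 1" and osc: "\<forall>\<Omega> (u1 :: 'a \<Rightarrow> real) u2 c R.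
    solves_pair lam Lam beta s \<Omega> \<delta>1 u1 u2 \<longrightarrow> 0 < R \<longrightarrow> R < 1 \<longrightarrow> cball c R \<subseteq> ball 0 1 \<longrightarrow>
    (\<forall>r. 0 < r \<and> r \<le> R \<longrightarrow> (\<exists>z. cball z (3 * \<kappa> * r) \<subseteq> \<Omega> \<inter> ball c (r/2))) \<longrightarrow>
    t0 \<le> tail k R c u1 \<longrightarrow> tail k R c u1 \<le> t1 \<longrightarrow> t0 \<le> tail k R c u2 \<longrightarrow>
    (\<forall>j. \<exists>m M. 0 \<le> m \<and> M \<le> C0 \<and> M - m = C0 * q ^ j \<and>
       (\<forall>y\<in>ball c (R / 8 ^ Suc j). m * u2 y \<le> u1 y \<and> u1 y \<le> M * u2 y))"
    by (elim exE conjE) (rule that)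
  from solves_pos[OF s k_def lam t0] obtain \<delta>2 where \<delta>2: "0 < \<delta>2" and pos: "\<forall>\<Omega> (u :: 'a \<Rightarrow> real) (x :: 'a).
    solves lam Lam beta s \<Omega> \<delta>2 u \<longrightarrow> (\<forall>r. 0 < r \<and> r \<le> 1/4 \<longrightarrow> t0 \<le> tail k r x u) \<longrightarrow>
    x \<in> \<Omega> \<inter> ball 0 (1/2) \<longrightarrow> 0 < u x"
    by (elim exE conjE) (rule that)
  define \<delta> where "\<delta> = min \<delta>1 \<delta>2"
  have \<delta>: "0 < \<delta>" "\<delta> \<le> \<delta>1" "\<delta> \<le> \<delta>2" using \<delta>1 \<delta>2 by (auto simp: \<delta>_def)
  \<comment> \<open>Solves 8^(-\<alpha>) = q, so that one step of the iteration matches one change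
    of scale; q > 1/8 gives \<alpha> < 1.\<close>
  define \<alpha> where "\<alpha> = - log 8 q"
  have q0: "0 < q" using q by simp
  have \<alpha>: "0 < \<alpha>" "\<alpha> < 1"
  proof -
    show "0 < \<alpha>" using q q0 by (simp add: \<alpha>_def)
    have "log 8 (1 / 8) < log 8 q" using q by simp
    moreover have "log 8 (1 / 8) = (- 1 :: real)" by (simp add: log_divide)
    ultimately show "\<alpha> < 1" by (simp add: \<alpha>_def)
  qed
  have q\<alpha>: "(1 / 8) powr \<alpha> = q"
    using q0 by (simp add: \<alpha>_def powr_divide powr_minus_divide)
  define C where "C = C0 + C0 * (128 / R) powr \<alpha>"
  show ?thesis
  proof (rule exI[of _ \<delta>], rule conjI[OF \<delta>(1)], rule exI[of _ \<alpha>], rule exI[of _ C],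
      rule conjI[OF \<alpha>(1)], rule conjI[OF \<alpha>(2)], intro allI impI, elim conjE)
    fix u1 u2 :: "'a \<Rightarrow> real"
    assume c1: "continuous_on (ball 0 1) u1" and c2: "continuous_on (ball 0 1) u2"
      and visc: "\<forall>a b. visc_Mplus_ge lam Lam beta s (\<lambda>x. a * u1 x + b * u2 x)
                  (\<lambda>x. - \<delta> * (\<bar>a\<bar> + \<bar>b\<bar>)) (ball 0 1 \<inter> \<Omega>)"
      and zero: "\<forall>x\<in>ball 0 1 - \<Omega>. u1 x = 0 \<and> u2 x = 0"
      and nonneg: "\<forall>x. 0 \<le> u1 x \<and> 0 \<le> u2 x"
      and i1: "integrable lborel (\<lambda>x. u1 x / (1 + norm x powr (real DIM('a) + 2 * s)))"
      and i2: "integrable lborel (\<lambda>x. u2 x / (1 + norm x powr (real DIM('a) + 2 * s)))"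
      and n1: "(\<integral>x. u1 x / (1 + norm x powr (real DIM('a) + 2 * s)) \<partial>lborel) = 1"
      and n2: "(\<integral>x. u2 x / (1 + norm x powr (real DIM('a) + 2 * s)) \<partial>lborel) = 1"
    have weight: "u \<in> borel_measurable borel \<and> tail_integrable k 1 0 u \<and>
        t0 \<le> tail k 1 0 u \<and> tail k 1 0 u \<le> 2"
      if i: "integrable lborel (\<lambda>x. u x / (1 + norm x powr k))" and n: "(\<integral>x. u x / (1 + norm x powr k) \<partial>lborel) = 1"
        and u0: "\<forall>x. 0 \<le> u x" for u :: "'a \<Rightarrow> real"
    proof -
      have ne: "1 + norm x powr k \<noteq> 0" for x :: 'a using powr_ge_zero[of "norm x" k] by linarith
      \<comment> \<open>Measurability of u is recovered from integrability of the quotient by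
        multiplying back the nonvanishing denominator.\<close>
      have "(\<lambda>x. u x / (1 + norm x powr k) * (1 + norm x powr k)) \<in> borel_measurable borel"
        using borel_measurable_integrable[OF i] by measurable
      then have um [measurable]: "u \<in> borel_measurable borel" using ne by simp
      have W2: "u y * weight k 1 0 y \<le> 2 * (u y / (1 + norm y powr k))" for y
        using mult_left_mono[OF weight_unit_bounds(2)[of k y], of "u y"] k0 u0 by (simp add: mult_ac)
      have uW: "tail_integrable k 1 0 u"
      proof (rule Bochner_Integration.integrable_bound)
        show "integrable lborel (\<lambda>y. 2 * (u y / (1 + norm y powr k)))" using i by (rule integrable_mult_right)
        show "AE y in lborel. norm (u y * weight k 1 0 y) \<le> norm (2 * (u y / (1 + norm y powr k)))"
        proof (rule AE_I2)
          fix y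
          have "0 \<le> u y * weight k 1 0 y" using u0 by simp
          then show "norm (u y * weight k 1 0 y) \<le> norm (2 * (u y / (1 + norm y powr k)))"
            using W2[of y] unfolding real_norm_def by linarith
        qed
      qed simp
      have "tail k 1 0 u \<le> (\<integral>y. 2 * (u y / (1 + norm y powr k)) \<partial>lborel)"
        unfolding tail_def by (intro integral_mono uW integrable_mult_right i W2)
      also have "\<dots> = 2" unfolding integral_mult_right_zero n by simp
      finally have up: "tail k 1 0 u \<le> 2" .
      have "(\<integral>x. u x / (1 + norm x powr k) \<partial>lborel) \<le> (\<integral>y. 2 powr k * (u y * weight k 1 0 y) \<partial>lborel)"
      proof (intro integral_mono i integrable_mult_right uW)
        fix y show "u y / (1 + norm y powr k) \<le> 2 powr k * (u y * weight k 1 0 y)"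
          using mult_left_mono[OF weight_unit_bounds(1)[of k y], of "u y"] k0 u0 by (simp add: mult_ac)
      qed
      then have "1 \<le> 2 powr k * tail k 1 0 u" unfolding n tail_def by simp
      then have "t0 \<le> tail k 1 0 u" by (simp add: t0_def powr_minus_divide pos_divide_le_eq mult.commute)
      then show ?thesis using um uW up by blast
    qed
    have w1: "u1 \<in> borel_measurable borel" "tail_integrable k 1 0 u1" "t0 \<le> tail k 1 0 u1" "tail k 1 0 u1 \<le> 2"
      using weight[of u1] i1 n1 nonneg unfolding k_def by blast+
    have w2: "u2 \<in> borel_measurable borel" "tail_integrable k 1 0 u2" "t0 \<le> tail k 1 0 u2" "tail k 1 0 u2 \<le> 2"
      using weight[of u2] i2 n2 nonneg unfolding k_def by blast+
    have v: "visc_Mplus_ge lam Lam beta s (\<lambda>x. a * u1 x + b * u2 x) (\<lambda>_. - (\<delta> * (\<bar>a\<bar> + \<bar>b\<bar>))) (ball 0 1 \<inter> \<Omega>)" for a b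
      using visc by simp
    \<comment> \<open>The coefficient pairs (1,0), (-1,0), (0,1), (0,-1) give the one-function
      inequalities for u1, u2 and their negatives.\<close>
    have pr: "solves_pair lam Lam beta s \<Omega> \<delta> u1 u2"
      unfolding solves_pair_def solves_def k_def[symmetric]
      using op c1 c2 nonneg zero w1 w2 \<delta> v v[of 1 0] v[of "-1" 0] v[of 0 1] v[of 0 "-1"] by simp
    have pr1: "solves_pair lam Lam beta s \<Omega> \<delta>1 u1 u2" by (rule solves_pair_mono[OF pr \<delta>(2)])
    have sol2: "solves lam Lam beta s \<Omega> \<delta>2 u2" using solves_pair_mono[OF pr \<delta>(3)] by (simp add: solves_pair_def)
    have lower: "t0 \<le> tail k r x u"
      if x: "norm x < 1/2" and r: "0 < r" "r \<le> 1/4" and u: "tail_integrable k 1 0 u"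
        "\<forall>y. 0 \<le> u y" "t0 \<le> tail k 1 0 u" "u \<in> borel_measurable borel" for x r u
    proof -
      have "tail k 1 0 u \<le> tail k r x u"
        unfolding tail_def
      proof (intro integral_mono u(1) mult_left_mono)
        show "tail_integrable k r x u" by (rule integrable_weight[OF u(1)]) (use k0 r u in auto)
        fix y
        have "r + dist y x \<le> 1 + dist y 0" using x r dist_triangle[of y x 0] by simp
        moreover have "0 < r + dist y x" using r by (simp add: add_pos_nonneg)
        ultimately show "weight k 1 0 y \<le> weight k r x y" unfolding weight_def using k0 by (intro powr_mono2') auto
      qed (use u in auto)
      with u show ?thesis by linarith
    qed
    have key: "\<exists>m M. 0 \<le> m \<and> M \<le> C0 \<and> M - m = C0 * q ^ j \<and>
       (\<forall>y\<in>ball c (R / 8 ^ Suc j). m * u2 y \<le> u1 y \<and> u1 y \<le> M * u2 y)" if c: "c \<in> \<Omega> \<inter> ball 0 (1/2)" for c j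
    proof (rule osc[rule_format, OF pr1 R(1) R(4)])
      show "cball c R \<subseteq> ball 0 1"
      proof
        fix y assume "y \<in> cball c R"
        then show "y \<in> ball 0 1" using c R dist_triangle[of 0 y c] by simp
      qed
      show "\<exists>z. cball z (3 * \<kappa> * r) \<subseteq> \<Omega> \<inter> ball c (r/2)" if r: "0 < r \<and> r \<le> R" for r
      proof -
        have "c \<in> \<Omega> \<inter> cball 0 1" "0 < r/2 \<and> r/2 \<le> r0" using c r R by auto
        then obtain z where z: "cball z (\<kappa>' * (r/2)) \<subseteq> \<Omega> \<inter> ball c (r/2)" using cork by blast
        have "3 * \<kappa> * r \<le> \<kappa>' * (r/2)" using mult_right_mono[OF \<kappa>(3), of "r/2"] r by simp
        then have "cball z (3 * \<kappa> * r) \<subseteq> cball z (\<kappa>' * (r/2))" by (rule subset_cball)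
        with z show ?thesis by blast
      qed
      show "t0 \<le> tail k R c u1" "t0 \<le> tail k R c u2" using lower w1 w2 nonneg c R by auto
      have Wle: "weight k R c y \<le> (3 / R) powr k * weight k 1 0 y" for y
      proof -
        have "(1 + dist 0 c) / R + 1 = (1 + dist 0 c + R) / R" using R by (simp add: add_divide_distrib)
        also have "\<dots> \<le> 3 / R" using c R by (intro divide_right_mono) auto
        finally have le: "(1 + dist 0 c) / R + 1 \<le> 3 / R" .
        have "weight k R c y \<le> ((1 + dist 0 c) / R + 1) powr k * weight k 1 0 y"
          by (rule weight_le_weight) (use R k0 in auto)
        also have "\<dots> \<le> (3 / R) powr k * weight k 1 0 y"
          using le R k0 by (intro mult_right_mono powr_mono2) (auto intro: add_nonneg_nonneg)
        finally show ?thesis .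
      qed
      have "tail k R c u1 \<le> (\<integral>y. (3 / R) powr k * (u1 y * weight k 1 0 y) \<partial>lborel)"
        unfolding tail_def
      proof (intro integral_mono integrable_mult_right w1)
        show "tail_integrable k R c u1" by (rule integrable_weight[OF w1(2)]) (use k0 R w1 in auto)
        fix y show "u1 y * weight k R c y \<le> (3 / R) powr k * (u1 y * weight k 1 0 y)"
          using mult_left_mono[OF Wle[of y], of "u1 y"] nonneg by (simp add: mult_ac)
      qed
      also have "\<dots> = (3 / R) powr k * tail k 1 0 u1" by (simp add: tail_def)
      also have "\<dots> \<le> (3 / R) powr k * 2" using w1 by (intro mult_left_mono) auto
      finally show "tail k R c u1 \<le> t1" by (simp add: t1_def)
    qed
    have u2pos: "0 < u2 x" if "x \<in> \<Omega> \<inter> ball 0 (1/2)" for x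
      by (rule pos[rule_format, OF sol2 _ that]) (use lower w2 nonneg that in auto)
    define f where "f x = u1 x / u2 x" for x
    have between: "m \<le> f x \<and> f x \<le> M"
      if "x \<in> \<Omega> \<inter> ball 0 (1/2)" "m * u2 x \<le> u1 x \<and> u1 x \<le> M * u2 x" for x m M
      using u2pos[OF that(1)] that(2) by (simp add: f_def pos_divide_le_eq pos_le_divide_eq)
    have bound: "0 \<le> f x \<and> f x \<le> C0" if x: "x \<in> \<Omega> \<inter> ball 0 (1/2)" for x
    proof -
      obtain m M where m: "0 \<le> m" "M \<le> C0" "\<forall>y\<in>ball x (R / 8 ^ Suc 0). m * u2 y \<le> u1 y \<and> u1 y \<le> M * u2 y"
        using key[OF x, of 0] by blast
      have "x \<in> ball x (R / 8 ^ Suc 0)" using R by simp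
      then have "m \<le> f x \<and> f x \<le> M" using m between[OF x] by blast
      with m show ?thesis by linarith
    qed
    have hoelder: "\<bar>f x - f y\<bar> \<le> C0 * (128 / R) powr \<alpha> * dist x y powr \<alpha>"
      if x: "x \<in> \<Omega> \<inter> ball 0 (1/2)" and y: "y \<in> \<Omega> \<inter> ball 0 (1/2)" and xy: "x \<noteq> y" for x y
    proof -
      \<comment> \<open>Normalised so that t <= 8^(-j) gives |x - y| <= (R/16) 8^(-j), strictly
        inside the ball of radius R/8^(j+1) about x. The smallest scale still containing y is then
        selected up to a factor 8, whence 128 = 8 * 16.\<close>
      define t where "t = 16 * dist x y / R"
      have t: "0 < t" using xy R by (simp add: t_def)
      have tpow: "(128 / R) powr \<alpha> * dist x y powr \<alpha> = (8 * t) powr \<alpha>"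
        using R by (simp add: t_def flip: powr_mult)
      have "\<bar>f x - f y\<bar> \<le> C0 * (8 * t) powr \<alpha>"
      proof (cases "t \<le> 1")
        case True
        then obtain j where j: "(1/8) ^ Suc j < t" "t \<le> (1/8) ^ j"
          using ex_power_bracket[of "1/8" t] t by auto
        obtain m M where m: "M - m = C0 * q ^ j"
          "\<forall>z\<in>ball x (R / 8 ^ Suc j). m * u2 z \<le> u1 z \<and> u1 z \<le> M * u2 z"
          using key[OF x, of j] by blast
        have "x \<in> ball x (R / 8 ^ Suc j)" using R by simp
        moreover have "y \<in> ball x (R / 8 ^ Suc j)"
        proof -
          have "dist x y = R / 16 * t" using R by (simp add: t_def)
          also have "\<dots> \<le> R / 16 * (1/8) ^ j" using j R by (intro mult_left_mono) auto
          also have "\<dots> < R / 8 * (1/8) ^ j" using R by simp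
          also have "\<dots> = R / 8 ^ Suc j" by (simp add: power_one_over)
          finally show ?thesis by simp
        qed
        ultimately have "m \<le> f x \<and> f x \<le> M" "m \<le> f y \<and> f y \<le> M" using m between x y by blast+
        then have "\<bar>f x - f y\<bar> \<le> C0 * q ^ j" using m by linarith
        also have "q ^ j = ((1/8) ^ j) powr \<alpha>"
          unfolding q\<alpha>[symmetric] by (simp add: powr_powr mult.commute flip: powr_realpow)
        also have "((1/8) ^ j) powr \<alpha> \<le> (8 * t) powr \<alpha>"
          using j \<alpha> by (intro powr_mono2) auto
        finally show ?thesis using C0 by simp
      next
        case False
        \<comment> \<open>Points too far apart for a common ball: the bound 0 <= f <= C0
          suffices.\<close>
        have "\<bar>f x - f y\<bar> \<le> C0 * 1" using bound[OF x] bound[OF y] by linarith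
        also have "1 powr \<alpha> \<le> (8 * t) powr \<alpha>" using False \<alpha> by (intro powr_mono2) auto
        then have "C0 * 1 \<le> C0 * (8 * t) powr \<alpha>" using C0 by (intro mult_left_mono) auto
        finally show ?thesis .
      qed
      then show ?thesis using tpow by (simp add: mult.assoc)
    qed
    have "holder_norm \<alpha> (\<Omega> \<inter> ball 0 (1/2)) f \<le> ereal C0 + ereal (C0 * (128 / R) powr \<alpha>)"
      unfolding holder_norm_def
    proof (intro add_mono SUP_least)
      fix x assume "x \<in> \<Omega> \<inter> ball 0 (1/2)"
      then show "ereal \<bar>f x\<bar> \<le> ereal C0" using bound by simp
    next
      fix xy assume "xy \<in> {(x, y). x \<in> \<Omega> \<inter> ball 0 (1/2) \<and> y \<in> \<Omega> \<inter> ball 0 (1/2) \<and> x \<noteq> y}"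
      then have "fst xy \<in> \<Omega> \<inter> ball 0 (1/2)" "snd xy \<in> \<Omega> \<inter> ball 0 (1/2)" "fst xy \<noteq> snd xy" by auto
      from hoelder[OF this] show "ereal (\<bar>f (fst xy) - f (snd xy)\<bar> / dist (fst xy) (snd xy) powr \<alpha>)
        \<le> ereal (C0 * (128 / R) powr \<alpha>)"
        using \<open>fst xy \<noteq> snd xy\<close> by (simp add: pos_divide_le_eq)
    qed
    then show "holder_norm \<alpha> (\<Omega> \<inter> ball 0 (1/2)) (\<lambda>x. u1 x / u2 x) \<le> ereal C"
      by (simp add: f_def[abs_def] C_def)
  qed
qed

end
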